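(* Let $M$ be a Hadamard manifold of constant sectional curvature $-k^2$, where $k>0$, and let $p\in M$. Then, for every $y\in M$, setting $\rho:=d(y,p)$, one has $$\mathcal{N}^p(y)=-\frac{\rho}{k}\log\left(\cosh\left(\frac{k\rho}{2}\right)\right).$$ Equivalently, for $\rho>0$, $$\mathcal{N}^p(y)=-\frac{\rho^2}{2}\,\varphi\left(\frac{k\rho}{2}\right),\qquad \varphi(t)=\frac{\log(\cosh t)}{t}.$$ In particular, if $\rho=1$, then $\mathcal{N}^p(y)=-\frac{1}{k}\log\left(\cosh\left(\frac{k}{2}\right)\right)$.
   Context: A Hadamard manifold is a complete, simply connected Riemannian manifold of nonpositive sectional curvature; $d$ is its Riemannian distance and $\exp$ its exponential map (each $\exp_p$ is a diffeomorphism). Having constant sectional curvature $-k^2$ presupposes $\dim M\ge 2$. For $q\in M$ and a unit vector $u\in T_qM$, $B_u^q(x)=\lim_{t\to+\infty}\bigl(d(x,\exp_q(tu))-t\bigr)$ is the Busemann function; for a nonzero $u\in T_qM$, $B_u^q:=B_{u/\|u\|}^q$. Busemann coupling with base point $p$: $H_p:M\times M\to\mathbb{R}$, $H_p(z,y)=d(p,z)\,B^p_{-\exp_p^{-1}z}(y)$ if $z\ne p$, and $H_p(p,y)=0$. Nonlinearity measure: $\mathcal{N}^p(y):=\inf_{z\in M}\{H_p(y,z)-H_p(z,y)\}$, $y\in M$. *)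

theory Defs
  imports "HOL-Analysis.Analysis"
begin

section \<open>Smooth manifolds\<close>

text \<open>Intended for open \<open>S\<close>.\<close>

primrec Ck_on :: "nat \<Rightarrow> 'a::euclidean_space set \<Rightarrow> ('a \<Rightarrow> 'b::real_normed_vector) \<Rightarrow> bool" where
  "Ck_on 0 S f \<longleftrightarrow> continuous_on S f"
| "Ck_on (Suc n) S f \<longleftrightarrow>
     (\<forall>x\<in>S. f differentiable (at x)) \<and> (\<forall>v. Ck_on n S (\<lambda>x. frechet_derivative f (at x) v))"

definition smooth_on :: "'a::euclidean_space set \<Rightarrow> ('a \<Rightarrow> 'b::real_normed_vector) \<Rightarrow> bool" where
  "smooth_on S f \<longleftrightarrow> (\<forall>n. Ck_on n S f)"

text \<open>
  A chart is a pair of a domain and a coordinate map; the coordinate map is only relevant on the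
  domain. The manifold is the whole type \<open>'m\<close>, modelled on \<open>'e\<close>, so its dimension is \<open>DIM('e)\<close>.
\<close>

type_synonym ('m, 'e) chart = "'m set \<times> ('m \<Rightarrow> 'e)"

definition chart_dom :: "('m, 'e) chart \<Rightarrow> 'm set" where
  "chart_dom c = fst c"

definition coord :: "('m, 'e) chart \<Rightarrow> 'm \<Rightarrow> 'e" where
  "coord c = snd c"

definition coord_inv :: "('m, 'e) chart \<Rightarrow> 'e \<Rightarrow> 'm" where
  "coord_inv c = inv_into (chart_dom c) (coord c)"

definition is_chart :: "('m::topological_space, 'e::euclidean_space) chart \<Rightarrow> bool" where
  "is_chart c \<longleftrightarrow> open (chart_dom c) \<and> open (coord c ` chart_dom c) \<and>
     homeomorphism (chart_dom c) (coord c ` chart_dom c) (coord c) (coord_inv c)"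

definition transition :: "('m, 'e) chart \<Rightarrow> ('m, 'e) chart \<Rightarrow> 'e \<Rightarrow> 'e" where
  "transition c c' = coord c' \<circ> coord_inv c"

definition smooth_atlas :: "('m::{t2_space, second_countable_topology}, 'e::euclidean_space) chart set \<Rightarrow> bool" where
  "smooth_atlas A \<longleftrightarrow> (\<forall>c\<in>A. is_chart c) \<and> (\<Union>c\<in>A. chart_dom c) = UNIV \<and>
     (\<forall>c\<in>A. \<forall>c'\<in>A. smooth_on (coord c ` (chart_dom c \<inter> chart_dom c')) (transition c c'))"

text \<open>
  The tangent space at \<open>p\<close> is identified with \<open>'e\<close>: a tangent vector at \<open>p\<close> is given by its
  components with respect to one fixed chart \<open>chart_at A p\<close> around \<open>p\<close>. The identification is
  linear, so sums, multiples and negatives of tangent vectors at \<open>p\<close> are those of \<open>'e\<close>. The function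
  \<open>from_chart A c p\<close> turns the components in an arbitrary chart \<open>c\<close> around \<open>p\<close> into a tangent vector.
\<close>

definition chart_at :: "('m, 'e) chart set \<Rightarrow> 'm \<Rightarrow> ('m, 'e) chart" where
  "chart_at A p = (SOME c. c \<in> A \<and> p \<in> chart_dom c)"

definition from_chart ::
  "('m, 'e::euclidean_space) chart set \<Rightarrow> ('m, 'e) chart \<Rightarrow> 'm \<Rightarrow> 'e \<Rightarrow> 'e" where
  "from_chart A c p = frechet_derivative (transition c (chart_at A p)) (at (coord c p))"

definition velocity ::
  "('m, 'e::euclidean_space) chart set \<Rightarrow> (real \<Rightarrow> 'm) \<Rightarrow> real \<Rightarrow> 'e" where
  "velocity A \<gamma> t = vector_derivative (coord (chart_at A (\<gamma> t)) \<circ> \<gamma>) (at t)"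


section \<open>Riemannian metrics\<close>

text \<open>The local expression of the metric \<open>g\<close> in the chart \<open>c\<close>, at the coordinate point \<open>x\<close>.\<close>

definition metric_in ::
  "('m, 'e::euclidean_space) chart set \<Rightarrow> ('m \<Rightarrow> 'e \<Rightarrow> 'e \<Rightarrow> real) \<Rightarrow> ('m, 'e) chart
     \<Rightarrow> 'e \<Rightarrow> 'e \<Rightarrow> 'e \<Rightarrow> real" where
  "metric_in A g c x u v =
     (let p = coord_inv c x in g p (from_chart A c p u) (from_chart A c p v))"

definition riemannian_metric ::
  "('m, 'e::euclidean_space) chart set \<Rightarrow> ('m \<Rightarrow> 'e \<Rightarrow> 'e \<Rightarrow> real) \<Rightarrow> bool" where
  "riemannian_metric A g \<longleftrightarrow>
     (\<forall>p. bilinear (g p) \<and> (\<forall>u v. g p u v = g p v u) \<and> (\<forall>u. u \<noteq> 0 \<longrightarrow> 0 < g p u u)) \<and>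
     (\<forall>c\<in>A. \<forall>u v. smooth_on (coord c ` chart_dom c) (\<lambda>x. metric_in A g c x u v))"

definition tnorm :: "('m \<Rightarrow> 'e \<Rightarrow> 'e \<Rightarrow> real) \<Rightarrow> 'm \<Rightarrow> 'e \<Rightarrow> real" where
  "tnorm g p u = sqrt (g p u u)"


section \<open>Levi-Civita connection and curvature\<close>

text \<open>
  In this section, \<open>G\<close> is a metric on an open subset of \<open>'e\<close>. For constant vector fields \<open>u\<close> and \<open>v\<close>,
  \<open>christoffel G x u v\<close> is the covariant derivative of \<open>v\<close> along \<open>u\<close> at \<open>x\<close>, determined by the
  Koszul formula, and \<open>curvature_tensor G x u v w\<close> is the value at \<open>x\<close> of
  \<open>\<nabla>\<^sub>u \<nabla>\<^sub>v w - \<nabla>\<^sub>v \<nabla>\<^sub>u w\<close>.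
\<close>

definition christoffel ::
  "('e::euclidean_space \<Rightarrow> 'e \<Rightarrow> 'e \<Rightarrow> real) \<Rightarrow> 'e \<Rightarrow> 'e \<Rightarrow> 'e \<Rightarrow> 'e" where
  "christoffel G x u v = (THE w. \<forall>z. G x w z =
     (frechet_derivative (\<lambda>x. G x v z) (at x) u
      + frechet_derivative (\<lambda>x. G x u z) (at x) v
      - frechet_derivative (\<lambda>x. G x u v) (at x) z) / 2)"

definition curvature_tensor ::
  "('e::euclidean_space \<Rightarrow> 'e \<Rightarrow> 'e \<Rightarrow> real) \<Rightarrow> 'e \<Rightarrow> 'e \<Rightarrow> 'e \<Rightarrow> 'e \<Rightarrow> 'e" where
  "curvature_tensor G x u v w =
     frechet_derivative (\<lambda>x. christoffel G x v w) (at x) u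
     - frechet_derivative (\<lambda>x. christoffel G x u w) (at x) v
     + christoffel G x u (christoffel G x v w)
     - christoffel G x v (christoffel G x u w)"

definition sectional ::
  "('e::euclidean_space \<Rightarrow> 'e \<Rightarrow> 'e \<Rightarrow> real) \<Rightarrow> 'e \<Rightarrow> 'e \<Rightarrow> 'e \<Rightarrow> real" where
  "sectional G x u v =
     G x (curvature_tensor G x u v v) u / (G x u u * G x v v - (G x u v)\<^sup>2)"

definition sectional_curvature ::
  "('m, 'e::euclidean_space) chart set \<Rightarrow> ('m \<Rightarrow> 'e \<Rightarrow> 'e \<Rightarrow> real) \<Rightarrow> 'm \<Rightarrow> 'e \<Rightarrow> 'e \<Rightarrow> real" where
  "sectional_curvature A g p u v =
     sectional (metric_in A g (chart_at A p)) (coord (chart_at A p) p) u v"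

definition nonpositive_curvature ::
  "('m, 'e::euclidean_space) chart set \<Rightarrow> ('m \<Rightarrow> 'e \<Rightarrow> 'e \<Rightarrow> real) \<Rightarrow> bool" where
  "nonpositive_curvature A g \<longleftrightarrow>
     (\<forall>p u v. u \<noteq> v \<and> independent {u, v} \<longrightarrow> sectional_curvature A g p u v \<le> 0)"

definition constant_curvature ::
  "('m, 'e::euclidean_space) chart set \<Rightarrow> ('m \<Rightarrow> 'e \<Rightarrow> 'e \<Rightarrow> real) \<Rightarrow> real \<Rightarrow> bool" where
  "constant_curvature A g K \<longleftrightarrow>
     (\<forall>p u v. u \<noteq> v \<and> independent {u, v} \<longrightarrow> sectional_curvature A g p u v = K)"


section \<open>Geodesics, exponential map and distance\<close>

text \<open>
  Geodesics parametrised by the whole real line. If \<open>\<gamma> t\<close> lies in the domain of \<open>c\<close>, then so does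
  \<open>\<gamma> s\<close> for \<open>s\<close> near \<open>t\<close>, and the condition below is the geodesic equation in the chart \<open>c\<close>.
\<close>

definition is_geodesic ::
  "('m::topological_space, 'e::euclidean_space) chart set \<Rightarrow> ('m \<Rightarrow> 'e \<Rightarrow> 'e \<Rightarrow> real)
     \<Rightarrow> (real \<Rightarrow> 'm) \<Rightarrow> bool" where
  "is_geodesic A g \<gamma> \<longleftrightarrow> continuous_on UNIV \<gamma> \<and>
     (\<forall>c\<in>A. \<forall>t. \<gamma> t \<in> chart_dom c \<longrightarrow>
        (let x = coord c \<circ> \<gamma>; x' = (\<lambda>s. vector_derivative x (at s)) in
           x differentiable (at t) \<and>
           (x' has_vector_derivative - christoffel (metric_in A g c) (x t) (x' t) (x' t)) (at t)))"

definition geodesically_complete ::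
  "('m::topological_space, 'e::euclidean_space) chart set \<Rightarrow> ('m \<Rightarrow> 'e \<Rightarrow> 'e \<Rightarrow> real) \<Rightarrow> bool" where
  "geodesically_complete A g \<longleftrightarrow>
     (\<forall>p v. \<exists>\<gamma>. is_geodesic A g \<gamma> \<and> \<gamma> 0 = p \<and> velocity A \<gamma> 0 = v)"

definition riem_exp ::
  "('m::topological_space, 'e::euclidean_space) chart set \<Rightarrow> ('m \<Rightarrow> 'e \<Rightarrow> 'e \<Rightarrow> real)
     \<Rightarrow> 'm \<Rightarrow> 'e \<Rightarrow> 'm" where
  "riem_exp A g p v = (THE \<gamma>. is_geodesic A g \<gamma> \<and> \<gamma> 0 = p \<and> velocity A \<gamma> 0 = v) 1"

text \<open>
  Curves that are \<open>C\<^sup>1\<close> on each of finitely many closed subintervals, with one-sided derivatives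
  at the break points; hence the speed is bounded and integrable. The library predicate
  \<open>piecewise_C1_differentiable_on\<close> would allow an unbounded speed near the break points.
\<close>

definition C1_curve_on ::
  "('m::topological_space, 'e::euclidean_space) chart set \<Rightarrow> (real \<Rightarrow> 'm) \<Rightarrow> real \<Rightarrow> real \<Rightarrow> bool" where
  "C1_curve_on A \<gamma> a b \<longleftrightarrow> continuous_on {a..b} \<gamma> \<and>
     (\<forall>c\<in>A. \<forall>t\<in>{a..b}. \<gamma> t \<in> chart_dom c \<longrightarrow>
        (coord c \<circ> \<gamma>) differentiable (at t within {a..b}) \<and>
        continuous (at t within {a..b})
          (\<lambda>s. vector_derivative (coord c \<circ> \<gamma>) (at s within {a..b})))"

definition piecewise_C1_path ::
  "('m::topological_space, 'e::euclidean_space) chart set \<Rightarrow> (real \<Rightarrow> 'm) \<Rightarrow> bool" where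
  "piecewise_C1_path A \<gamma> \<longleftrightarrow>
     (\<exists>n (s::nat \<Rightarrow> real). s 0 = 0 \<and> s n = 1 \<and>
        (\<forall>i<n. s i < s (Suc i) \<and> C1_curve_on A \<gamma> (s i) (s (Suc i))))"

definition curve_length ::
  "('m, 'e::euclidean_space) chart set \<Rightarrow> ('m \<Rightarrow> 'e \<Rightarrow> 'e \<Rightarrow> real) \<Rightarrow> (real \<Rightarrow> 'm) \<Rightarrow> real" where
  "curve_length A g \<gamma> = integral {0..1} (\<lambda>t. tnorm g (\<gamma> t) (velocity A \<gamma> t))"

definition riem_dist ::
  "('m::topological_space, 'e::euclidean_space) chart set \<Rightarrow> ('m \<Rightarrow> 'e \<Rightarrow> 'e \<Rightarrow> real)
     \<Rightarrow> 'm \<Rightarrow> 'm \<Rightarrow> real" where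
  "riem_dist A g p q =
     Inf {curve_length A g \<gamma> | \<gamma>. piecewise_C1_path A \<gamma> \<and> pathstart \<gamma> = p \<and> pathfinish \<gamma> = q}"

definition hadamard_manifold ::
  "('m::{t2_space, second_countable_topology}, 'e::euclidean_space) chart set
     \<Rightarrow> ('m \<Rightarrow> 'e \<Rightarrow> 'e \<Rightarrow> real) \<Rightarrow> bool" where
  "hadamard_manifold A g \<longleftrightarrow>
     smooth_atlas A \<and> riemannian_metric A g \<and> geodesically_complete A g \<and>
     simply_connected (UNIV :: 'm set) \<and> nonpositive_curvature A g"


section \<open>Busemann functions and the nonlinearity measure\<close>

text \<open>For nonzero \<open>u\<close>, which is normalised first.\<close>

definition busemann ::
  "('m::topological_space, 'e::euclidean_space) chart set \<Rightarrow> ('m \<Rightarrow> 'e \<Rightarrow> 'e \<Rightarrow> real)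
     \<Rightarrow> 'm \<Rightarrow> 'e \<Rightarrow> 'm \<Rightarrow> real" where
  "busemann A g q u x =
     Lim at_top (\<lambda>t::real. riem_dist A g x (riem_exp A g q (t *\<^sub>R (u /\<^sub>R tnorm g q u))) - t)"

definition busemann_coupling ::
  "('m::topological_space, 'e::euclidean_space) chart set \<Rightarrow> ('m \<Rightarrow> 'e \<Rightarrow> 'e \<Rightarrow> real)
     \<Rightarrow> 'm \<Rightarrow> 'm \<Rightarrow> 'm \<Rightarrow> real" where
  "busemann_coupling A g p z y =
     (if z = p then 0
      else riem_dist A g p z * busemann A g p (- inv (riem_exp A g p) z) y)"

text \<open>
  The infimum is taken in the extended reals: a real infimum would be an unspecified number if
  the set were not bounded below.
\<close>

definition nonlinearity ::
  "('m::topological_space, 'e::euclidean_space) chart set \<Rightarrow> ('m \<Rightarrow> 'e \<Rightarrow> 'e \<Rightarrow> real)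
     \<Rightarrow> 'm \<Rightarrow> 'm \<Rightarrow> ereal" where
  "nonlinearity A g p y =
     (INF z. ereal (busemann_coupling A g p y z - busemann_coupling A g p z y))"

definition phi :: "real \<Rightarrow> real" where
  "phi t = ln (cosh t) / t"

end

theory Submission
  imports Defs
begin

text \<open>
  On a simply connected manifold of constant curvature \<open>-k\<^sup>2\<close> the equation \<open>Hess f = k\<^sup>2 f g\<close> is a
  flat linear system for \<open>(f, grad f)\<close>, so it has a unique global solution with any prescribed value
  and gradient at a point, and \<open>g(grad f, grad f') - k\<^sup>2 f f'\<close> is constant for two solutions. Along a
  geodesic of speed \<open>a\<close> a solution satisfies \<open>f'' = (k a)\<^sup>2 f\<close>. Hence the solution with value \<open>1\<close> and
  gradient \<open>0\<close> at \<open>x\<close> is \<open>cosh (k d(x, \<cdot>))\<close>, and evaluating the constant form at two points yields the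
  hyperbolic law of cosines without any Jacobi fields. The solutions vanishing at \<open>p\<close> give local
  coordinates in which geodesics from \<open>p\<close> are explicit; lifting through them shows that \<open>exp\<^sub>p\<close>
  is a continuous bijection.

  The law of cosines gives \<open>B(y) = ln (cosh (k r) - sinh (k r) cos \<theta>) / k\<close>. For \<open>|exp\<^sub>p\<^sup>-\<^sup>1 y| = \<rho>\<close>,
  \<open>|exp\<^sub>p\<^sup>-\<^sup>1 z| = r\<close> and \<open>a\<close> the cosine of the angle between them, one minimises
  \<open>\<rho> ln (cosh (k r) + a sinh (k r)) - r ln (cosh (k \<rho>) + a sinh (k \<rho>))\<close>; the minimum is at
  \<open>r = \<rho> / 2\<close>, \<open>a = - tanh (k \<rho> / 2)\<close>.
\<close>

section \<open>Continuation along families of paths\<close>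

text \<open>Two features of the setting shape the proof. A tangent vector at a point is read in a
  chart chosen for that point, so velocities and gradients may jump with the point; every
  differential statement is therefore made in one fixed chart and moved to others by isometry
  invariance. And the distance is an infimum of curve lengths: it is bounded below through the
  gradient of \<open>cosh (k d)\<close>, whose length is fixed by the constant Lorentz form, and
  geodesics attain the bound. Global solutions arise from parallel transport along rays in
  coordinate balls, followed by a monodromy argument. Uniqueness of geodesics and continuity of
  \<open>exp\<close> are continuation arguments too, since shadows of geodesics from
  \<open>p\<close> are explicit. The minimiser has a geometric meaning: for
  \<open>a = - tanh (k \<rho> / 2)\<close> one has
  \<open>cosh (k \<rho>) + a sinh (k \<rho>) = 1\<close>, so \<open>y\<close> lies on the horosphere
  through \<open>p\<close> for the ray opposite to \<open>z\<close>. Then \<open>H_p(z, y)\<close>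
  vanishes and only \<open>H_p(y, z)\<close> contributes. For \<open>\<rho> > 0\<close> this angle
  is strictly between a right angle and a straight one, which is where dimension at least 2
  enters.\<close>

lemma open_eventuallyI:
  assumes "\<And>x. x \<in> S \<Longrightarrow> eventually (\<lambda>y. y \<in> S) (nhds x)"
  shows "open S"
proof (rule open_subopen[THEN iffD2], intro ballI)
  fix x assume "x \<in> S"
  from assms[OF this] show "\<exists>T. open T \<and> x \<in> T \<and> T \<subseteq> S"
    unfolding eventually_nhds by blast
qed

text \<open>Local constancy of the truth value splits \<open>I\<close> into two open pieces. All
  continuation arguments below are phrased this way: one shows separately that agreement and
  disagreement persist nearby, typically by local injectivity and by Hausdorff separation.\<close>

lemma connected_eventually_induct:
  assumes "connected I" "open I" "a \<in> I" "P a" "x \<in> I"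
    and loc: "\<And>x. x \<in> I \<Longrightarrow> eventually (\<lambda>y. P y \<longleftrightarrow> P x) (nhds x)"
  shows "P x"
proof (rule ccontr)
  assume "\<not> P x"
  have "eventually (\<lambda>y. y \<in> I \<and> (P y \<longleftrightarrow> P x)) (nhds x)" if "x \<in> I" for x
    using loc[OF that] that \<open>open I\<close> eventually_nhds_in_open eventually_conj by blast
  then have "open {x \<in> I. P x}" "open {x \<in> I. \<not> P x}"
    by (intro open_eventuallyI; fastforce elim: eventually_mono)+
  then show False
    using connectedD[OF \<open>connected I\<close>, of "{x \<in> I. P x}" "{x \<in> I. \<not> P x}"] assms \<open>\<not> P x\<close> by auto
qed

text \<open>Read \<open>L z l\<close> as: \<open>l\<close> is an admissible lift near
  \<open>z\<close>. The family \<open>\<Sigma>\<close> is admissible along each fibre with fixed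
  parameter and jointly at time 0; the dichotomy spreads joint admissibility to all times. It serves
  twice: for parallel sections over a homotopy and for lifting geodesics through local
  coordinates.\<close>

lemma parametrized_continuation:
  fixes L :: "'a::topological_space \<times> real \<Rightarrow> ('a \<times> real \<Rightarrow> 'v) \<Rightarrow> bool"
  assumes nbh: "\<And>z l. L z l \<Longrightarrow> eventually (\<lambda>z'. L z' l) (nhds z)"
    and dich: "\<And>z l m. L z l \<Longrightarrow> L z m \<Longrightarrow> eventually (\<lambda>z'. l z' = m z' \<longleftrightarrow> l z = m z) (nhds z)"
    and slice: "\<And>s t. \<exists>l. L (s, t) l \<and> eventually (\<lambda>t'. \<Sigma> (s, t') = l (s, t')) (nhds t)"
    and start: "\<exists>l. L (s0, 0) l \<and> eventually (\<lambda>s. \<Sigma> (s, 0) = l (s, 0)) (nhds s0)"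
  shows "\<exists>l. L (s0, t) l \<and> eventually (\<lambda>z. \<Sigma> z = l z) (nhds (s0, t))"
proof -
  define good where "good t \<longleftrightarrow> (\<exists>l. L (s0, t) l \<and> eventually (\<lambda>z. \<Sigma> z = l z) (nhds (s0, t)))" for t
  have Pair_nhds: "\<exists>N d. open N \<and> s0 \<in> N \<and> d > 0 \<and> (\<forall>s\<in>N. \<forall>t'. \<bar>t' - t\<bar> < d \<longrightarrow> P (s, t'))"
    if "eventually P (nhds (s0, t))" for P and t :: real
  proof -
    from that obtain W where W: "open W" "(s0, t) \<in> W" "\<And>z. z \<in> W \<Longrightarrow> P z"
      by (auto simp: eventually_nhds)
    obtain N B where NB: "open N" "open B" "(s0, t) \<in> N \<times> B" "N \<times> B \<subseteq> W"
      using open_prod_elim[OF W(1,2)] by metis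
    then obtain d where "d > 0" "ball t d \<subseteq> B"
      by (metis mem_Sigma_iff open_contains_ball_eq)
    then show ?thesis
      using NB W(3) by (intro exI[of _ N] exI[of _ d]) (auto simp: subset_iff dist_real_def abs_minus_commute)
  qed
  text \<open>Two fibrewise sections over a common interval agree throughout once they agree at one point.\<close>
  have key: "\<exists>l. L (s0, t) l \<and> eventually (\<lambda>z. \<Sigma> z = l z) (nhds (s0, t))
      \<and> L (s0, t1) l \<and> eventually (\<lambda>z. \<Sigma> z = l z) (nhds (s0, t1))"
    if N: "open N" "s0 \<in> N" and d: "d > 0" and L: "\<And>s t'. s \<in> N \<Longrightarrow> \<bar>t' - t\<bar> < d \<Longrightarrow> L (s, t') l"
      and t1: "\<bar>t1 - t\<bar> < d" and ag: "eventually (\<lambda>s. \<Sigma> (s, t1) = l (s, t1)) (nhds s0)" for N d l t1 t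
  proof -
    obtain N' where N': "open N'" "s0 \<in> N'" "\<And>s. s \<in> N' \<Longrightarrow> \<Sigma> (s, t1) = l (s, t1)"
      using ag by (auto simp: eventually_nhds)
    have all: "\<Sigma> (s, t') = l (s, t')" if s: "s \<in> N \<inter> N'" and t': "\<bar>t' - t\<bar> < d" for s t'
    proof -
      define I where "I = {t - d<..<t + d}"
      have I: "x \<in> I \<longleftrightarrow> \<bar>x - t\<bar> < d" for x by (auto simp: I_def)
      have loc: "eventually (\<lambda>\<tau>'. (\<Sigma> (s, \<tau>') = l (s, \<tau>')) = (\<Sigma> (s, \<tau>) = l (s, \<tau>))) (nhds \<tau>)"
        if "\<tau> \<in> I" for \<tau>
      proof -
        obtain m where m: "L (s, \<tau>) m" "eventually (\<lambda>t'. \<Sigma> (s, t') = m (s, t')) (nhds \<tau>)"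
          using slice by blast
        have Ll: "L (s, \<tau>) l" using L s that I by auto
        have cont: "filterlim (\<lambda>\<tau>'. (s, \<tau>')) (nhds (s, \<tau>)) (nhds \<tau>)"
          by (intro tendsto_intros filterlim_ident)
        have "m (s, \<tau>) = \<Sigma> (s, \<tau>)" using m(2) eventually_nhds_x_imp_x by fastforce
        then have "eventually (\<lambda>z. (m z = l z) = (\<Sigma> (s, \<tau>) = l (s, \<tau>))) (nhds (s, \<tau>))"
          using dich[OF m(1) Ll] by simp
        from filterlim_iff[THEN iffD1, OF cont, rule_format, OF this]
        show ?thesis using m(2) by eventually_elim auto
      qed
      show ?thesis
        by (rule connected_eventually_induct[of I t1 "\<lambda>\<tau>. \<Sigma> (s, \<tau>) = l (s, \<tau>)"])
          (use loc I t1 t' N'(3) s in \<open>auto simp: I_def\<close>)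
    qed
    have ev: "eventually (\<lambda>z. \<Sigma> z = l z) (nhds (s0, t2))" if "\<bar>t2 - t\<bar> < d" for t2
      unfolding eventually_nhds using N N' d that all
      by (intro exI[of _ "(N \<inter> N') \<times> {t - d<..<t + d}"]) (auto intro!: open_Times)
    show ?thesis
      using ev[of t] ev[of t1] t1 d L[of s0 t] L[of s0 t1] N by (intro exI[of _ l]) auto
  qed
  have good_ev: "eventually good (nhds t)" if g: "good t" for t
  proof -
    obtain l where l: "L (s0, t) l" "eventually (\<lambda>z. \<Sigma> z = l z) (nhds (s0, t))"
      using g unfolding good_def by auto
    have "eventually (\<lambda>z. L z l \<and> eventually (\<lambda>z. \<Sigma> z = l z) (nhds z)) (nhds (s0, t))"
      using l nbh by (intro eventually_conj) (auto simp: eventually_eventually)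
    moreover have "filterlim (\<lambda>t. (s0, t)) (nhds (s0, t)) (nhds t)"
      by (intro tendsto_intros filterlim_ident)
    ultimately show ?thesis
      unfolding good_def filterlim_iff by (auto elim!: eventually_mono)
  qed
  have bad_ev: "eventually (\<lambda>t'. \<not> good t') (nhds t)" if t: "\<not> good t" for t
  proof -
    obtain l where l: "L (s0, t) l" "eventually (\<lambda>t'. \<Sigma> (s0, t') = l (s0, t')) (nhds t)"
      using slice by blast
    obtain N d where N: "open N" "s0 \<in> N" "d > 0"
      "\<And>s t'. s \<in> N \<Longrightarrow> \<bar>t' - t\<bar> < d \<Longrightarrow> L (s, t') l"
      using Pair_nhds[OF nbh[OF l(1)]] by blast
    obtain e where e: "e > 0" "\<And>t'. \<bar>t' - t\<bar> < e \<Longrightarrow> \<Sigma> (s0, t') = l (s0, t')"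
      using l(2) unfolding eventually_nhds_metric by (auto simp: dist_real_def)
    \<comment> \<open>A good time \<open>t1\<close> close to the bad time \<open>t\<close> would
      make the lift \<open>l\<close> found at \<open>t\<close> agree with \<open>\<Sigma>\<close> at
      time \<open>t1\<close> on all nearby fibres, and \<open>key\<close> would carry this agreement
      back to \<open>t\<close>.\<close>
    have "\<not> good t1" if t1: "\<bar>t1 - t\<bar> < min d e" for t1
    proof
      assume "good t1"
      then obtain m where m: "L (s0, t1) m" "eventually (\<lambda>z. \<Sigma> z = m z) (nhds (s0, t1))"
        unfolding good_def by auto
      have "m (s0, t1) = l (s0, t1)"
        using m(2) e(2)[of t1] t1 eventually_nhds_x_imp_x by fastforce
      then have "eventually (\<lambda>z. m z = l z) (nhds (s0, t1))"
        using dich[OF m(1), of l] N(2) N(4)[of s0 t1] t1 by auto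
      with m(2) have "eventually (\<lambda>z. \<Sigma> z = l z) (nhds (s0, t1))"
        by eventually_elim auto
      moreover have "filterlim (\<lambda>s. (s, t1)) (nhds (s0, t1)) (nhds s0)"
        by (intro tendsto_intros filterlim_ident)
      ultimately have "eventually (\<lambda>s. \<Sigma> (s, t1) = l (s, t1)) (nhds s0)"
        unfolding filterlim_iff by auto
      then have "\<exists>l. L (s0, t) l \<and> eventually (\<lambda>z. \<Sigma> z = l z) (nhds (s0, t))
          \<and> L (s0, t1) l \<and> eventually (\<lambda>z. \<Sigma> z = l z) (nhds (s0, t1))"
        by (intro key[where N = N and d = d and l = l]) (use N t1 in auto)
      then show False using t unfolding good_def by blast
    qed
    then show ?thesis
      using N(3) e(1) unfolding eventually_nhds_metric dist_real_def
      by (intro exI[of _ "min d e"]) auto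
  qed
  have "good 0"
  proof -
    obtain l where l: "L (s0, 0) l" "eventually (\<lambda>s. \<Sigma> (s, 0) = l (s, 0)) (nhds s0)"
      using start by blast
    obtain N d where N: "open N" "s0 \<in> N" "d > 0"
      "\<And>s t'. s \<in> N \<Longrightarrow> \<bar>t' - 0\<bar> < d \<Longrightarrow> L (s, t') l"
      using Pair_nhds[OF nbh[OF l(1)]] by blast
    have "\<exists>l. L (s0, 0) l \<and> eventually (\<lambda>z. \<Sigma> z = l z) (nhds (s0, 0))
        \<and> L (s0, 0) l \<and> eventually (\<lambda>z. \<Sigma> z = l z) (nhds (s0, 0))"
      by (rule key[where N = N and d = d and l = l and t = 0]) (use N l(2) in auto)
    then show ?thesis unfolding good_def by blast
  qed
  have ev: "eventually (\<lambda>t'. good t' \<longleftrightarrow> good t) (nhds t)" for t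
    using good_ev[of t] bad_ev[of t] by (cases "good t") auto
  have "good t"
    by (rule connected_eventually_induct[where I = UNIV and a = 0 and P = good]) (use ev \<open>good 0\<close> in auto)
  then show ?thesis unfolding good_def .
qed

section \<open>Local systems and monodromy\<close>

lemma isCont_eventually_nhds:
  assumes "isCont c t" "eventually P (nhds (c t))"
  shows "eventually (\<lambda>x. P (c x)) (nhds t)"
proof -
  have "filterlim c (nhds (c t)) (nhds t)"
    using assms(1) by (simp add: isCont_def tendsto_at_iff_tendsto_nhds)
  then show ?thesis using assms(2) by (auto simp: filterlim_iff)
qed

text \<open>Simple connectedness makes any two loops freely homotopic, constant ones included; a
  homotopy between constant loops at \<open>a\<close> and \<open>b\<close> traces a path from
  \<open>a\<close> to \<open>b\<close>.\<close>

lemma simply_connected_imp_path_connected_top: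
  fixes S :: "'a::topological_space set"
  assumes "simply_connected S"
  shows "path_connected S"
  unfolding path_connected_def
proof (intro ballI)
  fix a b assume "a \<in> S" "b \<in> S"
  then have "homotopic_loops S (\<lambda>_. a) (\<lambda>_. b)"
    using assms[unfolded simply_connected_def, rule_format, of "\<lambda>_. a" "\<lambda>_. b"]
    by (auto simp: path_def pathstart_def pathfinish_def path_image_def)
  then obtain h :: "real \<times> real \<Rightarrow> 'a" where h: "continuous_on ({0..1} \<times> {0..1}) h" "h ` ({0..1} \<times> {0..1}) \<subseteq> S"
    "\<forall>x\<in>{0..1}. h (0, x) = a" "\<forall>x\<in>{0..1}. h (1, x) = b"
    unfolding homotopic_loops by blast
  have "path (\<lambda>t. h (t, 0))"
    unfolding path_def by (rule continuous_on_compose2[OF h(1)]) (auto intro!: continuous_intros)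
  moreover have "path_image (\<lambda>t. h (t, 0)) \<subseteq> S"
    using h(2) unfolding path_image_def by force
  ultimately show "\<exists>g. path g \<and> path_image g \<subseteq> S \<and> pathstart g = a \<and> pathfinish g = b"
    using h(3,4) by (intro exI[of _ "\<lambda>t. h (t, 0)"]) (auto simp: pathstart_def pathfinish_def)
qed

text \<open>An abstract flat bundle: \<open>S z s\<close> stands for \<open>s\<close> being parallel
  at \<open>z\<close>. Local existence with arbitrary prescribed value and unique continuation are
  what the monodromy argument consumes; the Hessian equation supplies the instance.\<close>

locale local_system =
  fixes S :: "'m::topological_space \<Rightarrow> ('m \<Rightarrow> 'v) \<Rightarrow> bool"
  assumes exists: "\<exists>U. open U \<and> path_connected U \<and> q \<in> U \<and> (\<forall>x\<in>U. \<forall>v. \<exists>s. s x = v \<and> (\<forall>z\<in>U. S z s))"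
    and unique: "\<lbrakk>open U; connected U; \<And>z. z \<in> U \<Longrightarrow> S z s; \<And>z. z \<in> U \<Longrightarrow> S z s';
      x \<in> U; s x = s' x; z \<in> U\<rbrakk> \<Longrightarrow> s z = s' z"
    and locally_connected: "\<lbrakk>open W; q \<in> W\<rbrakk> \<Longrightarrow> \<exists>U. open U \<and> connected U \<and> q \<in> U \<and> U \<subseteq> W"
    and cong: "\<lbrakk>S q s; eventually (\<lambda>z. s z = s' z) (nhds q)\<rbrakk> \<Longrightarrow> S q s'"
begin

definition germ :: "'m \<Rightarrow> ('m \<Rightarrow> 'v) \<Rightarrow> bool" where
  "germ q s \<longleftrightarrow> eventually (\<lambda>z. S z s) (nhds q)"

text \<open>A section of the pullback along \<open>c\<close>. The value is indexed by the parameter,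
  not by the point \<open>c t\<close>, because a curve may return to a point with a different value
  before monodromy is known to be trivial.\<close>

definition section_at :: "('a::topological_space \<Rightarrow> 'm) \<Rightarrow> ('a \<Rightarrow> 'v) \<Rightarrow> 'a \<Rightarrow> bool" where
  "section_at c \<sigma> t \<longleftrightarrow> (\<exists>s. germ (c t) s \<and> eventually (\<lambda>t'. \<sigma> t' = s (c t')) (nhds t))"

lemma germ_dichotomy:
  assumes "germ q s" "germ q s'"
  shows "eventually (\<lambda>z. s z = s' z \<longleftrightarrow> s q = s' q) (nhds q)"
proof -
  have "eventually (\<lambda>z. S z s \<and> S z s') (nhds q)"
    using assms by (auto simp: germ_def eventually_conj)
  then obtain W where W: "open W" "q \<in> W" "\<And>z. z \<in> W \<Longrightarrow> S z s \<and> S z s'"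
    by (auto simp: eventually_nhds)
  obtain U where U: "open U" "connected U" "q \<in> U" "U \<subseteq> W"
    using locally_connected[OF W(1,2)] by blast
  have "s z = s' z \<longleftrightarrow> s q = s' q" if "z \<in> U" for z
    using unique[OF U(1,2), of s s' z q] unique[OF U(1,2), of s s' q z] W(3) U that by blast
  then show ?thesis using U eventually_nhds by blast
qed

lemma section_at_dichotomy:
  assumes "section_at c \<sigma> t" "section_at c \<sigma>' t" "isCont c t"
  shows "eventually (\<lambda>t'. \<sigma> t' = \<sigma>' t' \<longleftrightarrow> \<sigma> t = \<sigma>' t) (nhds t)"
proof -
  obtain s s' where s: "germ (c t) s" "eventually (\<lambda>t'. \<sigma> t' = s (c t')) (nhds t)"
    and s': "germ (c t) s'" "eventually (\<lambda>t'. \<sigma>' t' = s' (c t')) (nhds t)"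
    using assms unfolding section_at_def by auto
  have "eventually (\<lambda>t'. s (c t') = s' (c t') \<longleftrightarrow> s (c t) = s' (c t)) (nhds t)"
    using assms(3) germ_dichotomy[OF s(1) s'(1)] by (rule isCont_eventually_nhds)
  with s(2) s'(2) have "eventually (\<lambda>t'. \<sigma> t' = \<sigma>' t' \<longleftrightarrow> s (c t) = s' (c t)) (nhds t)"
    by eventually_elim simp
  moreover have "\<sigma> t = s (c t)" "\<sigma>' t = s' (c t)"
    using eventually_nhds_x_imp_x[OF s(2)] eventually_nhds_x_imp_x[OF s'(2)] by auto
  ultimately show ?thesis by simp
qed

lemma section_at_cong:
  assumes "section_at c \<sigma> t" "eventually (\<lambda>t. \<sigma>' t = \<sigma> t) (nhds t)"
  shows "section_at c \<sigma>' t"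
proof -
  obtain s where s: "germ (c t) s" "eventually (\<lambda>t'. \<sigma> t' = s (c t')) (nhds t)"
    using assms(1) unfolding section_at_def by auto
  from assms(2) s(2) have "eventually (\<lambda>t'. \<sigma>' t' = s (c t')) (nhds t)"
    by eventually_elim simp
  then show ?thesis using s(1) unfolding section_at_def by blast
qed

lemma section_unique:
  fixes c :: "real \<Rightarrow> 'm"
  assumes "continuous_on UNIV c" "\<And>t. section_at c \<sigma> t" "\<And>t. section_at c \<sigma>' t" "\<sigma> a = \<sigma>' a"
  shows "\<sigma> t = \<sigma>' t"
proof (rule connected_eventually_induct[where I = UNIV and a = a and P = "\<lambda>t. \<sigma> t = \<sigma>' t"])
  fix x
  show "eventually (\<lambda>t. \<sigma> t = \<sigma>' t \<longleftrightarrow> \<sigma> x = \<sigma>' x) (nhds x)"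
    by (rule section_at_dichotomy[OF assms(2,3)])
      (use assms(1) in \<open>simp add: continuous_on_eq_continuous_at\<close>)
qed (use assms(4) in auto)

text \<open>The curve rests outside the unit interval, so time runs over the whole line and all
  neighbourhoods are two-sided. \<open>P T\<close> is locally constant: on a window of time that
  \<open>c\<close> maps into one \<open>U\<close>, a section reaching \<open>T1\<close> extends to
  any other \<open>T2\<close>.\<close>

lemma section_exists:
  fixes c :: "real \<Rightarrow> 'm"
  assumes c: "continuous_on UNIV c" and c0: "\<And>t. t \<le> 0 \<Longrightarrow> c t = c 0" and c1: "\<And>t. t \<ge> 1 \<Longrightarrow> c t = c 1"
  shows "\<exists>\<sigma>. (\<forall>t\<le>0. \<sigma> t = v) \<and> (\<forall>t. section_at c \<sigma> t)"
proof -
  define P where "P T \<longleftrightarrow> (\<exists>\<sigma>. (\<forall>t\<le>0. \<sigma> t = v) \<and> (\<forall>t\<le>T. section_at c \<sigma> t))" for T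
  have lim: "eventually (\<lambda>t. P (c t)) (nhds t)" if "eventually P (nhds (c t))" for P t
    by (rule isCont_eventually_nhds[where c = c, OF _ that]) (use c in \<open>simp add: continuous_on_eq_continuous_at\<close>)
  have P0: "P 0"
  proof -
    obtain U s where U: "open U" "c 0 \<in> U" "s (c 0) = v" "\<And>z. z \<in> U \<Longrightarrow> S z s"
      using exists[of "c 0"] by metis
    then have "germ (c 0) s" unfolding germ_def eventually_nhds by blast
    then have "section_at c (s \<circ> c) t" if "t \<le> 0" for t
      unfolding section_at_def using c0[OF that] by (intro exI[of _ s]) auto
    moreover have "(s \<circ> c) t = v" if "t \<le> 0" for t using c0[OF that] U(3) by simp
    ultimately show ?thesis unfolding P_def by blast
  qed
  have step: "eventually (\<lambda>T'. P T' \<longleftrightarrow> P T) (nhds T)" for T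
  proof -
    obtain U where U: "open U" "c T \<in> U" "\<And>x v. x \<in> U \<Longrightarrow> \<exists>s. s x = v \<and> (\<forall>z\<in>U. S z s)"
      using exists[of "c T"] by blast
    have gU: "germ x s" if "x \<in> U" "\<forall>z\<in>U. S z s" for x s
      using that U(1) unfolding germ_def eventually_nhds by blast
    have "eventually (\<lambda>t. c t \<in> U) (nhds T)"
      using U(1,2) by (intro lim eventually_nhds_in_open)
    then obtain d where d: "d > 0" "\<And>t. \<bar>t - T\<bar> < d \<Longrightarrow> c t \<in> U"
      by (auto simp: eventually_nhds_metric dist_real_def)
    have "P T2" if T1: "\<bar>T1 - T\<bar> < d" and T2: "\<bar>T2 - T\<bar> < d" and "P T1" for T1 T2
    proof -
      obtain \<sigma> where \<sigma>: "\<forall>t\<le>0. \<sigma> t = v" "\<forall>t\<le>T1. section_at c \<sigma> t"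
        using \<open>P T1\<close> unfolding P_def by blast
      obtain s where s: "s (c T1) = \<sigma> T1" "\<forall>z\<in>U. S z s"
        using U(3) d(2)[OF T1] by blast
      define \<tau> where "\<tau> t = (if t \<le> T1 then \<sigma> t else s (c t))" for t
      have "\<tau> t = v" if "t \<le> 0" for t
        using that \<sigma>(1) s(1) c0[of t] c0[of T1] by (auto simp: \<tau>_def)
      moreover have "section_at c \<tau> t" if t: "t \<le> T2" for t
      proof -
        consider "t < T1" | "t = T1" | "t > T1" by linarith
        then show ?thesis
        proof cases
          case 1
          then have "eventually (\<lambda>t'. \<tau> t' = \<sigma> t') (nhds t)"
            unfolding \<tau>_def eventually_nhds by (intro exI[of _ "{..<T1}"]) auto
          moreover obtain s' where "germ (c t) s'" "eventually (\<lambda>t'. \<sigma> t' = s' (c t')) (nhds t)"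
            using \<sigma>(2) 1 unfolding section_at_def by (meson less_imp_le)
          ultimately show ?thesis
            unfolding section_at_def by (auto intro!: exI[of _ s'] elim: eventually_elim2)
        next
          case 2
          obtain s' where s': "germ (c t) s'" "eventually (\<lambda>t'. \<sigma> t' = s' (c t')) (nhds t)"
            using \<sigma>(2) 2 unfolding section_at_def by force
          \<comment> \<open>At the seam the old germ \<open>s'\<close> and the new section
            \<open>s\<close> share one value, hence agree nearby, so \<open>s'\<close> represents
            the glued section on both sides.\<close>
          have "germ (c t) s" using gU s(2) d(2)[OF T1] 2 by auto
          moreover have "s (c t) = s' (c t)"
            using eventually_nhds_x_imp_x[OF s'(2)] s(1) 2 by auto
          ultimately have "eventually (\<lambda>z. s z = s' z) (nhds (c t))"
            using germ_dichotomy[of "c t" s s'] s'(1) by (auto elim: eventually_mono)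
          then have "eventually (\<lambda>t. s (c t) = s' (c t)) (nhds t)"
            by (rule lim)
          with s'(2) have "eventually (\<lambda>t'. \<tau> t' = s' (c t')) (nhds t)"
            by eventually_elim (auto simp: \<tau>_def)
          then show ?thesis unfolding section_at_def using s'(1) by blast
        next
          case 3
          then have "c t \<in> U" using T1 T2 t by (intro d(2)) auto
          moreover have "eventually (\<lambda>t'. \<tau> t' = s (c t')) (nhds t)"
            using 3 unfolding \<tau>_def eventually_nhds by (intro exI[of _ "{T1<..}"]) auto
          ultimately show ?thesis unfolding section_at_def using gU s(2) by blast
        qed
      qed
      ultimately show ?thesis unfolding P_def by blast
    qed
    then show ?thesis using d(1) unfolding eventually_nhds_metric dist_real_def
      by (intro exI[of _ d]) (metis diff_self abs_zero)
  qed
  have "P 1"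
    by (rule connected_eventually_induct[where I = UNIV and a = 0 and P = P]) (use P0 step in auto)
  then obtain \<sigma> where \<sigma>: "\<forall>t\<le>0. \<sigma> t = v" "\<forall>t\<le>1. section_at c \<sigma> t"
    unfolding P_def by blast
  define \<tau> where "\<tau> t = \<sigma> (min t 1)" for t
  have "section_at c \<tau> t" for t
  proof -
    obtain s where s: "germ (c (min t 1)) s" "eventually (\<lambda>t'. \<sigma> t' = s (c t')) (nhds (min t 1))"
      using \<sigma>(2) unfolding section_at_def by (metis min.cobounded2)
    have "eventually (\<lambda>t'. \<sigma> (min t' 1) = s (c (min t' 1))) (nhds t)"
      by (rule isCont_eventually_nhds[where c = "\<lambda>t. min t 1", OF _ s(2)]) (intro continuous_intros)
    moreover have cm: "c (min t 1) = c t" for t using c1[of t] by (auto simp: min_def)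
    ultimately show ?thesis using s(1) unfolding section_at_def \<tau>_def cm by blast
  qed
  moreover have "\<tau> t = v" if "t \<le> 0" for t using that \<sigma>(1) by (auto simp: \<tau>_def min_def)
  ultimately show ?thesis by blast
qed

text \<open>One link of parallel transport inside a single \<open>U\<close>. Its reflexive
  transitive closure stands for transport along paths, so that concatenation and reversal become
  closure properties of a relation.\<close>

definition local_transport :: "'m \<times> 'v \<Rightarrow> 'm \<times> 'v \<Rightarrow> bool" where
  "local_transport a b \<longleftrightarrow> (\<exists>U s. open U \<and> path_connected U \<and> fst a \<in> U \<and> fst b \<in> U \<and> (\<forall>z\<in>U. S z s)
     \<and> s (fst a) = snd a \<and> s (fst b) = snd b)"

lemma germI: "open U \<Longrightarrow> x \<in> U \<Longrightarrow> (\<And>z. z \<in> U \<Longrightarrow> S z s) \<Longrightarrow> germ x s"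
  unfolding germ_def eventually_nhds by blast

text \<open>Each link is traversed by a path inside its \<open>U\<close>; resting before and after
  lets the pieces be joined without one-sided limits.\<close>

lemma transport_lift:
  assumes "local_transport\<^sup>*\<^sup>* (p, v) b"
  shows "\<exists>c \<sigma> T. continuous_on UNIV c \<and> T > (0::real) \<and> (\<forall>t\<le>0. c t = p \<and> \<sigma> t = v)
    \<and> (\<forall>t\<ge>T. c t = fst b \<and> \<sigma> t = snd b) \<and> (\<forall>t. section_at c \<sigma> t)"
  using assms
proof (induction rule: rtranclp_induct)
  case base
  obtain U s where U: "open U" "p \<in> U" "s p = v" "\<And>z. z \<in> U \<Longrightarrow> S z s"
    using exists[of p] by metis
  then have "germ p s" using germI by blast
  then show ?case using U(3)
    by (intro exI[of _ "\<lambda>_. p"] exI[of _ "\<lambda>_. v"] exI[of _ "1::real"])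
      (auto simp: section_at_def intro!: exI[of _ s])
next
  case (step b b')
  then obtain c \<sigma> and T :: real where c: "continuous_on UNIV c" "T > 0"
    "\<And>t. t \<le> 0 \<Longrightarrow> c t = p \<and> \<sigma> t = v" "\<And>t. t \<ge> T \<Longrightarrow> c t = fst b \<and> \<sigma> t = snd b"
    "\<And>t. section_at c \<sigma> t" by auto
  obtain U s where U: "open U" "path_connected U" "fst b \<in> U" "fst b' \<in> U" "\<And>z. z \<in> U \<Longrightarrow> S z s"
     "s (fst b) = snd b" "s (fst b') = snd b'"
    using step(2) unfolding local_transport_def by blast
  obtain g where g: "path g" "path_image g \<subseteq> U" "g 0 = fst b" "g 1 = fst b'"
    using U(2-4) unfolding path_connected_def pathstart_def pathfinish_def by blast
  define h where "h t = g (max 0 (min 1 (t - T)))" for t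
  have contg: "continuous_on UNIV h"
    unfolding h_def by (rule continuous_on_compose2[OF g(1)[unfolded path_def]]) (auto intro!: continuous_intros)
  have hU: "h t \<in> U" for t using g(2) by (auto simp: h_def path_image_def)
  have hT: "t \<le> T \<Longrightarrow> h t = fst b" "t \<ge> T + 1 \<Longrightarrow> h t = fst b'" for t
    using g by (auto simp: h_def max_def min_def)
  define c' where "c' t = (if t \<le> T then c t else h t)" for t
  define \<sigma>' where "\<sigma>' t = (if t \<le> T then \<sigma> t else s (h t))" for t
  have "continuous_on UNIV c'"
  proof -
    have "continuous_on ({..T} \<union> {T..}) c'" unfolding c'_def
      by (rule continuous_on_cases) (use hT[of T] c(4)[of T] in
        \<open>auto intro: continuous_on_subset[OF c(1)] continuous_on_subset[OF contg] simp: order_antisym_conv\<close>)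
    moreover have "{..T} \<union> {T..} = UNIV" by auto
    ultimately show ?thesis by simp
  qed
  moreover have "section_at c' \<sigma>' t" for t
  proof -
    consider "t < T" | "t = T" | "t > T" by linarith
    then show ?thesis
    proof cases
      case 1
      then have "eventually (\<lambda>t'. t' < T) (nhds t)" by (intro eventually_nhds_in_open[of "{..<T}", simplified]) auto
      moreover obtain s' where "germ (c t) s'" "eventually (\<lambda>t'. \<sigma> t' = s' (c t')) (nhds t)"
        using c(5) unfolding section_at_def by blast
      ultimately show ?thesis using 1 unfolding section_at_def
        by (auto intro!: exI[of _ s'] simp: c'_def \<sigma>'_def elim: eventually_elim2)
    next
      case 2
      obtain s' where s': "germ (c t) s'" "eventually (\<lambda>t'. \<sigma> t' = s' (c t')) (nhds t)"
        using c(5) unfolding section_at_def by blast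
      have "germ (c t) s" using germI U c(4)[of t] 2 by auto
      moreover have "s (c t) = s' (c t)"
        using eventually_nhds_x_imp_x[OF s'(2)] c(4)[of t] 2 U(6) by auto
      ultimately have "eventually (\<lambda>z. s z = s' z) (nhds (c t))"
        using germ_dichotomy[of "c t" s s'] s'(1) by (auto elim: eventually_mono)
      moreover have "isCont h t" using contg by (auto simp: continuous_on_eq_continuous_at)
      moreover have "h t = c t" using 2 hT[of t] c(4)[of t] by auto
      ultimately have "eventually (\<lambda>t. s (h t) = s' (h t)) (nhds t)"
        using isCont_eventually_nhds[of t h] by auto
      with s'(2) have "eventually (\<lambda>t'. \<sigma>' t' = s' (c' t')) (nhds t)"
        by eventually_elim (auto simp: \<sigma>'_def c'_def)
      moreover have "germ (c' t) s'" using s'(1) 2 by (simp add: c'_def)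
      ultimately show ?thesis unfolding section_at_def by blast
    next
      case 3
      then have "eventually (\<lambda>t'. t' > T) (nhds t)" by (intro eventually_nhds_in_open[of "{T<..}", simplified]) auto
      moreover have "germ (h t) s" using germI U hU by auto
      ultimately show ?thesis unfolding section_at_def using 3
        by (auto intro!: exI[of _ s] simp: c'_def \<sigma>'_def elim: eventually_mono)
    qed
  qed
  moreover have "\<forall>t\<le>0. c' t = p \<and> \<sigma>' t = v" using c(2,3) by (auto simp: c'_def \<sigma>'_def)
  moreover have "\<forall>t\<ge>T + 1. c' t = fst b' \<and> \<sigma>' t = snd b'" using hT(2) U(7) by (auto simp: c'_def \<sigma>'_def)
  ultimately show ?case using c(2) by (intro exI[of _ c'] exI[of _ \<sigma>'] exI[of _ "T + 1"]) auto
qed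

text \<open>Carry the section over a free homotopy from the loop to the constant loop at
  \<open>p\<close>. The base point moves along a closed-up track \<open>H (s, 0) = H (s, 1)\<close>,
  and both the initial values and the final values are parallel along it. They agree on the constant
  loop at \<open>s = 1\<close>, hence by uniqueness at \<open>s = 0\<close>, where they are
  \<open>v\<close> and \<open>w\<close>.\<close>

lemma transport_loop:
  assumes sc: "simply_connected (UNIV :: 'm set)"
    and "local_transport\<^sup>*\<^sup>* (p, v) (p, w)"
  shows "v = w"
proof -
  obtain c \<sigma> and T :: real where c: "continuous_on UNIV c" "T > 0"
    "\<And>t. t \<le> 0 \<Longrightarrow> c t = p \<and> \<sigma> t = v" "\<And>t. t \<ge> T \<Longrightarrow> c t = p \<and> \<sigma> t = w"
    "\<And>t. section_at c \<sigma> t" using transport_lift[OF assms(2)] by auto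
  define \<gamma> where "\<gamma> t = c (T * t)" for t
  have \<gamma>: "continuous_on A \<gamma>" for A unfolding \<gamma>_def
    by (rule continuous_on_compose2[OF c(1)]) (auto intro!: continuous_intros)
  have "homotopic_loops UNIV \<gamma> (\<lambda>_. p)"
    using sc \<gamma> c(2) c(3)[of 0] c(4)[of T] unfolding simply_connected_def
    by (auto simp: path_def pathstart_def pathfinish_def \<gamma>_def)
  then obtain h :: "real \<times> real \<Rightarrow> 'm" where h: "continuous_on ({0..1} \<times> {0..1}) h"
    "\<And>x. x \<in> {0..1} \<Longrightarrow> h (0, x) = \<gamma> x" "\<And>x. x \<in> {0..1} \<Longrightarrow> h (1, x) = p"
    "\<And>t. t \<in> {0..1} \<Longrightarrow> h (t, 1) = h (t, 0)"
    unfolding homotopic_loops pathstart_def pathfinish_def o_def by metis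
  \<comment> \<open>Clamping extends the homotopy from the square to the plane, which removes all
    boundary cases.\<close>
  define k where "k t = max 0 (min 1 t)" for t :: real
  have k: "k t \<in> {0..1}" "t \<le> 0 \<Longrightarrow> k t = 0" "t \<ge> 1 \<Longrightarrow> k t = 1" "k 0 = 0" "k 1 = 1" for t
    by (auto simp: k_def)
  define H where "H z = h (k (fst z), k (snd z))" for z
  have H: "continuous_on UNIV H"
    unfolding H_def by (rule continuous_on_compose2[OF h(1)]) (auto simp: k_def intro!: continuous_intros)
  have isCont_H: "isCont H z" for z
    using H by (simp add: continuous_on_eq_continuous_at del: split_paired_All)
  have H1: "continuous_on UNIV (\<lambda>t. H (s, t))" and H2: "continuous_on UNIV (\<lambda>s. H (s, t))" for s t
    by (rule continuous_on_compose2[OF H]; auto intro!: continuous_intros)+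
  have Hloop: "H (s, 1) = H (s, 0)" for s unfolding H_def using h(4) k by auto
  have Hp: "H (1, t) = p" for t unfolding H_def using h(3) k by auto
  \<comment> \<open>Since the homotopy is free, the starting values of the loops must themselves be
    transported along the moving base point.\<close>
  obtain \<beta> where \<beta>: "\<And>t. t \<le> 0 \<Longrightarrow> \<beta> t = v" "\<And>s. section_at (\<lambda>s. H (s, 0)) \<beta> s"
    using section_exists[OF H2, of 0 v] k by (auto simp: H_def)
  have "\<exists>\<sigma>. (\<forall>t\<le>0. \<sigma> t = \<beta> s) \<and> (\<forall>t. section_at (\<lambda>t. H (s, t)) \<sigma> t)" for s
    by (rule section_exists[OF H1]) (auto simp: H_def k)
  then obtain \<Sigma>' where \<Sigma>': "\<And>s t. t \<le> 0 \<Longrightarrow> \<Sigma>' s t = \<beta> s" "\<And>s t. section_at (\<lambda>t. H (s, t)) (\<Sigma>' s) t"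
    by metis
  define \<Sigma> where "\<Sigma> z = \<Sigma>' (fst z) (snd z)" for z
  have "section_at H \<Sigma> (s, t)" for s t
  proof -
    define L where "L z l \<longleftrightarrow> section_at H l z" for z and l :: "real \<times> real \<Rightarrow> 'v"
    have "eventually (\<lambda>z'. L z' l) (nhds z)" if "L z l" for z l
    proof -
      obtain s where s: "germ (H z) s" "eventually (\<lambda>t'. l t' = s (H t')) (nhds z)"
        using \<open>L z l\<close> unfolding L_def section_at_def by blast
      have "eventually (\<lambda>q. germ q s) (nhds (H z))"
        using s(1) unfolding germ_def by (simp add: eventually_eventually)
      from isCont_eventually_nhds[OF isCont_H this] 
      have "eventually (\<lambda>z. germ (H z) s) (nhds z)" .
      moreover have "eventually (\<lambda>z. eventually (\<lambda>t'. l t' = s (H t')) (nhds z)) (nhds z)"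
        using s(2) by (simp add: eventually_eventually)
      ultimately show ?thesis unfolding L_def section_at_def by eventually_elim blast
    qed
    moreover have "eventually (\<lambda>z'. l z' = m z' \<longleftrightarrow> l z = m z) (nhds z)" if "L z l" "L z m" for z l m
      using section_at_dichotomy that isCont_H unfolding L_def by blast
    moreover have "\<exists>l. L (s, t) l \<and> eventually (\<lambda>t'. \<Sigma> (s, t') = l (s, t')) (nhds t)" for s t
    proof -
      obtain f where f: "germ (H (s, t)) f" "eventually (\<lambda>t'. \<Sigma>' s t' = f (H (s, t'))) (nhds t)"
        using \<Sigma>'(2) unfolding section_at_def by blast
      then show ?thesis unfolding L_def section_at_def
        by (intro exI[of _ "\<lambda>z. f (H z)"]) (auto simp: \<Sigma>_def intro!: exI[of _ f])
    qed
    moreover have "\<exists>l. L (s, 0) l \<and> eventually (\<lambda>s. \<Sigma> (s, 0) = l (s, 0)) (nhds s)" for s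
    proof -
      obtain f where f: "germ (H (s, 0)) f" "eventually (\<lambda>s. \<beta> s = f (H (s, 0))) (nhds s)"
        using \<beta>(2) unfolding section_at_def by blast
      then show ?thesis unfolding L_def section_at_def
        by (intro exI[of _ "\<lambda>z. f (H z)"]) (auto simp: \<Sigma>_def \<Sigma>' intro!: exI[of _ f])
    qed
    ultimately have "\<exists>l. L (s, t) l \<and> eventually (\<lambda>z. \<Sigma> z = l z) (nhds (s, t))"
      by (rule parametrized_continuation)
    then obtain l where "L (s, t) l" "eventually (\<lambda>z. \<Sigma> z = l z) (nhds (s, t))"
      by blast
    then show ?thesis unfolding L_def by (rule section_at_cong)
  qed
  then obtain f where f: "\<And>s t. germ (H (s, t)) (f s t)" "\<And>s t. eventually (\<lambda>z. \<Sigma> z = f s t (H z)) (nhds (s, t))"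
    unfolding section_at_def by metis
  have end_section: "section_at (\<lambda>s. H (s, 0)) (\<lambda>s. \<Sigma> (s, 1)) s" for s
  proof -
    have "eventually (\<lambda>s'. \<Sigma> (s', 1) = f s 1 (H (s', 1))) (nhds s)"
      by (rule isCont_eventually_nhds[where c = "\<lambda>s. (s, 1)", OF _ f(2)]) (intro continuous_intros)
    then show ?thesis unfolding section_at_def using f(1)[of s 1] Hloop by auto
  qed
  have const_section: "section_at (\<lambda>t. H (1, t)) (\<lambda>_. \<beta> 1) t" for t
    using \<beta>(2)[of 1] eventually_nhds_x_imp_x unfolding section_at_def Hp
    by (smt (verit, best) Hp always_eventually)
  have "\<Sigma>' 1 1 = \<beta> 1"
    using section_unique[OF H1 \<Sigma>'(2) const_section, of 0] \<Sigma>'(1)[of 0 1] by auto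
  then have "\<Sigma> (s, 1) = \<beta> s" for s
    using section_unique[OF H2 end_section \<beta>(2), of 1] by (auto simp: \<Sigma>_def)
  then have "\<Sigma>' 0 1 = v" using \<beta>(1)[of 0] by (simp add: \<Sigma>_def) 
  moreover have sec0: "section_at (\<lambda>t. H (0, t)) (\<lambda>t. \<sigma> (T * t)) t" for t
  proof -
    have HT: "H (0, t) = c (T * t)" for t
    proof -
      have "H (0, t) = c (T * k t)" using h(2)[OF k(1)] k by (simp add: H_def \<gamma>_def)
      also have "\<dots> = c (T * t)"
      proof (cases "t \<le> 0")
        case True
        then have "T * t \<le> 0" using c(2) by (simp add: mult_le_0_iff)
        then show ?thesis using c(3)[of "T * t"] c(3)[of 0] k True by simp
      next
        case False
        then show ?thesis
          using c(4)[of "T * t"] c(4)[of T] k c(2) by (cases "t \<ge> 1") (auto simp: k_def)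
      qed
      finally show ?thesis .
    qed
    obtain s where s: "germ (c (T * t)) s" "eventually (\<lambda>t'. \<sigma> t' = s (c t')) (nhds (T * t))"
      using c(5) unfolding section_at_def by blast
    have "eventually (\<lambda>t'. \<sigma> (T * t') = s (c (T * t'))) (nhds t)"
      by (rule isCont_eventually_nhds[where c = "\<lambda>t. T * t", OF _ s(2)]) (intro continuous_intros)
    then show ?thesis unfolding section_at_def HT using s(1) by blast
  qed
  have "\<sigma> (T * 1) = \<Sigma>' 0 1"
    by (rule section_unique[where c = "\<lambda>t. H (0, t)" and a = 0 and t = 1 and \<sigma> = "\<lambda>t. \<sigma> (T * t)"
        and \<sigma>' = "\<Sigma>' 0"]) (use H1 sec0 c(3)[of 0] \<Sigma>' \<beta>(1)[of 0] in auto)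
  ultimately show ?thesis using c(4)[of T] by auto
qed

text \<open>Connectedness lets chains of local transports reach every point, and
  \<open>transport_loop\<close> makes the transported value independent of the chain, so an
  arbitrary choice of it is a well-defined parallel section.\<close>

theorem global_section:
  assumes sc: "simply_connected (UNIV :: 'm set)"
  shows "\<exists>s. s p = v \<and> (\<forall>q. S q s)"
proof -
  have sym: "local_transport a b \<Longrightarrow> local_transport b a" for a b
    unfolding local_transport_def by blast
  then have rsym: "local_transport\<^sup>*\<^sup>* a b \<Longrightarrow> local_transport\<^sup>*\<^sup>* b a" for a b
    by (metis sympI symp_rtranclp sympD)
  define Q where "Q x \<longleftrightarrow> (\<exists>w. local_transport\<^sup>*\<^sup>* (p, v) (x, w))" for x
  have Qloc: "\<exists>U. open U \<and> x \<in> U \<and> (\<forall>y\<in>U. \<forall>z\<in>U. Q y \<longrightarrow> Q z)" for x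
  proof -
    obtain U where U: "open U" "path_connected U" "x \<in> U" "\<And>x v. x \<in> U \<Longrightarrow> \<exists>s. s x = v \<and> (\<forall>z\<in>U. S z s)"
      using exists[of x] by blast
    have "Q z" if "y \<in> U" "z \<in> U" "Q y" for y z
    proof -
      obtain w where w: "local_transport\<^sup>*\<^sup>* (p, v) (y, w)" using \<open>Q y\<close> unfolding Q_def by blast
      obtain s where "s y = w" "\<forall>z\<in>U. S z s" using U(4) \<open>y \<in> U\<close> by blast
      then have "local_transport (y, w) (z, s z)"
        unfolding local_transport_def using U that by auto
      with w show ?thesis unfolding Q_def by (meson rtranclp.rtrancl_into_rtrancl)
    qed
    then show ?thesis using U by blast
  qed
  have "connected (UNIV :: 'm set)"
    using simply_connected_imp_path_connected_top[OF sc] path_connected_imp_connected by blast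
  then have Q: "Q x" for x
  proof (rule connected_eventually_induct[where a = p])
    show "Q p" unfolding Q_def by blast
    show "eventually (\<lambda>y. Q y \<longleftrightarrow> Q x) (nhds x)" for x
    proof -
      obtain U where U: "open U" "x \<in> U" "\<forall>y\<in>U. \<forall>z\<in>U. Q y \<longrightarrow> Q z" using Qloc[of x] by blast
      then have "\<forall>y\<in>U. Q y \<longleftrightarrow> Q x" by blast
      with U(1,2) show ?thesis unfolding eventually_nhds by blast
    qed
  qed auto
  define s where "s x = (SOME w. local_transport\<^sup>*\<^sup>* (p, v) (x, w))" for x
  have s: "local_transport\<^sup>*\<^sup>* (p, v) (x, s x)" for x
    unfolding s_def using Q[of x] unfolding Q_def by (rule someI_ex)
  have s_eq: "s x = w" if "local_transport\<^sup>*\<^sup>* (p, v) (x, w)" for x w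
    using transport_loop[OF sc] rtranclp_trans[OF rsym[OF s] that] by blast
  have "S q s" for q
  proof -
    obtain U where U: "open U" "path_connected U" "q \<in> U" "\<And>x v. x \<in> U \<Longrightarrow> \<exists>s. s x = v \<and> (\<forall>z\<in>U. S z s)"
      using exists[of q] by blast
    obtain s' where s': "s' q = s q" "\<And>z. z \<in> U \<Longrightarrow> S z s'" using U(3,4) by blast
    have "s' z = s z" if "z \<in> U" for z
    proof -
      have "local_transport (q, s q) (z, s' z)"
        unfolding local_transport_def using U(1-3) s' that by (intro exI[of _ U] exI[of _ s']) auto
      with s[of q] show ?thesis by (metis rtranclp.rtrancl_into_rtrancl s_eq)
    qed
    then have "eventually (\<lambda>z. s' z = s z) (nhds q)" using U unfolding eventually_nhds by blast
    then show ?thesis using cong s'(2) U(3) by blast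
  qed
  moreover have "s p = v" by (rule s_eq) auto
  ultimately show ?thesis by blast
qed

end

section \<open>Iterated derivatives\<close>

lemma frechet_derivative_cong_open:
  assumes "open S" "x \<in> S" "\<And>y. y \<in> S \<Longrightarrow> f y = g y"
  shows "frechet_derivative f (at x) = frechet_derivative g (at x)"
proof -
  have "(f has_derivative D) (at x) \<longleftrightarrow> (g has_derivative D) (at x)" for D
    using has_derivative_transform_within_open[OF _ assms(1,2)] assms(3) by metis
  then show ?thesis unfolding frechet_derivative_def by simp
qed

lemma differentiable_cong_open:
  assumes "open S" "x \<in> S" "\<And>y. y \<in> S \<Longrightarrow> f y = g y" "f differentiable (at x)"
  shows "g differentiable (at x)"
  using assms has_derivative_transform_within_open unfolding differentiable_def by metis

lemma Ck_on_cong: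
  assumes "open S" "\<And>x. x \<in> S \<Longrightarrow> f x = g x" "Ck_on n S f"
  shows "Ck_on n S g"
  using assms(2,3)
proof (induction n arbitrary: f g)
  case 0
  then show ?case by (simp cong: continuous_on_cong_simp)
next
  case (Suc n)
  have "Ck_on n S (\<lambda>x. frechet_derivative g (at x) v)" for v
  proof (rule Suc.IH)
    show "frechet_derivative f (at x) v = frechet_derivative g (at x) v" if "x \<in> S" for x
      using frechet_derivative_cong_open[OF assms(1) that Suc.prems(1)] by simp
  qed (use Suc.prems(2) in simp)
  then show ?case
    using Suc.prems differentiable_cong_open[OF assms(1)] by (auto, metis)
qed

lemma Ck_on_SucI:
  assumes "open S" "\<And>x. x \<in> S \<Longrightarrow> (f has_derivative f' x) (at x)" "\<And>v. Ck_on n S (\<lambda>x. f' x v)"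
  shows "Ck_on (Suc n) S f"
proof -
  have "f' x v = frechet_derivative f (at x) v" if "x \<in> S" for x v
    using frechet_derivative_at[OF assms(2)[OF that]] by simp
  then have "Ck_on n S (\<lambda>x. frechet_derivative f (at x) v)" for v
    by (intro Ck_on_cong[OF assms(1) _ assms(3)])
  then show ?thesis using assms(2) by (auto simp: differentiable_def)
qed

lemma Ck_on_subset: "Ck_on n S f \<Longrightarrow> T \<subseteq> S \<Longrightarrow> Ck_on n T f"
  by (induction n arbitrary: f) (auto intro: continuous_on_subset)

lemma Ck_on_SucD: "Ck_on (Suc n) S f \<Longrightarrow> Ck_on n S f"
proof (induction n arbitrary: f)
  case 0
  then show ?case by (auto intro!: continuous_at_imp_continuous_on differentiable_imp_continuous_within)
next
  case (Suc n)
  then show ?case by (metis Ck_on.simps(2))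
qed

lemma smooth_on_subset: "smooth_on S f \<Longrightarrow> T \<subseteq> S \<Longrightarrow> smooth_on T f"
  unfolding smooth_on_def using Ck_on_subset by blast

lemma smooth_on_continuous: "smooth_on S f \<Longrightarrow> continuous_on S f"
  unfolding smooth_on_def using Ck_on.simps(1) by blast

lemma smooth_on_differentiable: "smooth_on S f \<Longrightarrow> x \<in> S \<Longrightarrow> f differentiable (at x)"
  unfolding smooth_on_def using Ck_on.simps(2) by blast

lemma smooth_on_has_derivative:
  "smooth_on S f \<Longrightarrow> x \<in> S \<Longrightarrow> (f has_derivative frechet_derivative f (at x)) (at x)"
  using smooth_on_differentiable frechet_derivative_works by blast

lemma smooth_on_frechet_derivative: "smooth_on S f \<Longrightarrow> smooth_on S (\<lambda>x. frechet_derivative f (at x) v)"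
  unfolding smooth_on_def using Ck_on.simps(2) by blast

lemma Ck_on_const [simp]: "Ck_on n S (\<lambda>x. c)"
  by (induction n arbitrary: c) auto

lemma Ck_on_bounded_linear:
  assumes h: "bounded_linear h" and "open S" "Ck_on n S f"
  shows "Ck_on n S (\<lambda>x. h (f x))"
  using assms(3)
proof (induction n arbitrary: f)
  case 0
  then show ?case by (simp add: linear_continuous_on_compose bounded_linear.continuous_on[OF h])
next
  case (Suc n)
  have D: "((\<lambda>x. h (f x)) has_derivative (\<lambda>v. h (frechet_derivative f (at x) v))) (at x)" if "x \<in> S" for x
    using Suc.prems that by (intro bounded_linear.has_derivative[OF h]) (simp flip: frechet_derivative_works)
  show ?case
    by (rule Ck_on_SucI[OF \<open>open S\<close> D Suc.IH]) (use Suc.prems in auto)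
qed

lemma Ck_on_add:
  assumes "open S" "Ck_on n S f" "Ck_on n S g"
  shows "Ck_on n S (\<lambda>x. f x + g x)"
  using assms(2,3)
proof (induction n arbitrary: f g)
  case 0
  then show ?case by (simp add: continuous_on_add)
next
  case (Suc n)
  have D: "((\<lambda>x. f x + g x) has_derivative (\<lambda>v. frechet_derivative f (at x) v + frechet_derivative g (at x) v)) (at x)"
    if "x \<in> S" for x
    using Suc.prems that by (intro has_derivative_add) (simp_all flip: frechet_derivative_works)
  show ?case
    by (rule Ck_on_SucI[OF \<open>open S\<close> D Suc.IH]) (use Suc.prems in auto)
qed

lemma Ck_on_sum:
  assumes "open S" "\<And>i. i \<in> I \<Longrightarrow> Ck_on n S (f i)"
  shows "Ck_on n S (\<lambda>x. \<Sum>i\<in>I. f i x)"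
  using assms(2) by (induction I rule: infinite_finite_induct) (auto intro: Ck_on_add[OF assms(1)])

lemma Ck_on_bounded_bilinear:
  assumes p: "bounded_bilinear p" and "open S" "Ck_on n S f" "Ck_on n S g"
  shows "Ck_on n S (\<lambda>x. p (f x) (g x))"
  using assms(3,4)
proof (induction n arbitrary: f g)
  case 0
  then show ?case by (simp add: bounded_bilinear.continuous_on[OF p])
next
  case (Suc n)
  have D: "((\<lambda>x. p (f x) (g x)) has_derivative
      (\<lambda>v. p (f x) (frechet_derivative g (at x) v) + p (frechet_derivative f (at x) v) (g x))) (at x)"
    if "x \<in> S" for x
    using Suc.prems that by (intro bounded_bilinear.FDERIV[OF p]) (simp_all flip: frechet_derivative_works)
  have C: "Ck_on n S (\<lambda>x. p (f x) (frechet_derivative g (at x) v) + p (frechet_derivative f (at x) v) (g x))" for v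
    using Suc.prems Ck_on_SucD[OF Suc.prems(1)] Ck_on_SucD[OF Suc.prems(2)]
    by (intro Ck_on_add[OF \<open>open S\<close>] Suc.IH) auto
  show ?case by (rule Ck_on_SucI[OF \<open>open S\<close> D C])
qed

lemma Ck_on_diff:
  assumes "open S" "Ck_on n S f" "Ck_on n S g"
  shows "Ck_on n S (\<lambda>x. f x - g x)"
  using Ck_on_add[OF assms(1,2) Ck_on_bounded_linear[OF bounded_linear_minus[OF bounded_linear_ident] assms(1,3)]] by simp

section \<open>Symmetry of second derivatives\<close>

text \<open>Both mixed difference quotients are the second difference of \<open>f\<close> over \<open>t\<^sup>2\<close>, up to the mean value theorem.\<close>

lemma mixed_second_difference:
  fixes f :: "'a::real_normed_vector \<Rightarrow> real"
  assumes f: "\<And>y. y \<in> S \<Longrightarrow> (f has_derivative f' y) (at y)"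
    and f2: "\<And>y. y \<in> S \<Longrightarrow> ((\<lambda>y. f' y u) has_derivative f2 y) (at y)"
    and t: "t > 0" and S: "\<And>a b. a \<in> {0..t} \<Longrightarrow> b \<in> {0..t} \<Longrightarrow> x + a *\<^sub>R u + b *\<^sub>R v \<in> S"
  obtains a b where "a \<in> {0..t}" "b \<in> {0..t}"
    "f (x + t *\<^sub>R u + t *\<^sub>R v) - f (x + t *\<^sub>R u) - f (x + t *\<^sub>R v) + f x = t\<^sup>2 * f2 (x + a *\<^sub>R u + b *\<^sub>R v) v"
proof -
  define \<phi> where "\<phi> a = f (x + a *\<^sub>R u + t *\<^sub>R v) - f (x + a *\<^sub>R u + 0 *\<^sub>R v)" for a
  have "(\<phi> has_real_derivative f' (x + a *\<^sub>R u + t *\<^sub>R v) u - f' (x + a *\<^sub>R u + 0 *\<^sub>R v) u) (at a)" if "a \<in> {0..t}" for a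
  proof -
    have *: "((\<lambda>a. f (x + a *\<^sub>R u + b *\<^sub>R v)) has_real_derivative f' (x + a *\<^sub>R u + b *\<^sub>R v) u) (at a)" if "b \<in> {0..t}" for b
      unfolding has_field_derivative_def
      by (rule has_derivative_eq_rhs[OF has_derivative_compose[where f = "\<lambda>a. x + a *\<^sub>R u + b *\<^sub>R v", OF _ f[OF S[OF \<open>a \<in> {0..t}\<close> that]]]])
        (auto intro!: derivative_eq_intros simp: linear_scale[OF has_derivative_linear[OF f[OF S[OF \<open>a \<in> {0..t}\<close> that]]]])
    show ?thesis unfolding \<phi>_def using t by (intro DERIV_diff * ) auto
  qed
  then obtain a where a: "0 < a" "a < t" "\<phi> t - \<phi> 0 = t * (f' (x + a *\<^sub>R u + t *\<^sub>R v) u - f' (x + a *\<^sub>R u + 0 *\<^sub>R v) u)"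
    using MVT2[OF t, of \<phi> "\<lambda>a. f' (x + a *\<^sub>R u + t *\<^sub>R v) u - f' (x + a *\<^sub>R u + 0 *\<^sub>R v) u"] by (auto simp: atLeastAtMost_iff)
  have "((\<lambda>b. f' (x + a *\<^sub>R u + b *\<^sub>R v) u) has_real_derivative f2 (x + a *\<^sub>R u + b *\<^sub>R v) v) (at b)" if "b \<in> {0..t}" for b
  proof -
    have m: "x + a *\<^sub>R u + b *\<^sub>R v \<in> S" using S[of a b] a that by auto
    show ?thesis
      unfolding has_field_derivative_def
      by (rule has_derivative_eq_rhs[OF has_derivative_compose[where f = "\<lambda>b. x + a *\<^sub>R u + b *\<^sub>R v", OF _ f2[OF m]]])
        (auto intro!: derivative_eq_intros simp: linear_scale[OF has_derivative_linear[OF f2[OF m]]])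
  qed
  then obtain b where b: "0 < b" "b < t" "f' (x + a *\<^sub>R u + t *\<^sub>R v) u - f' (x + a *\<^sub>R u + 0 *\<^sub>R v) u = t * f2 (x + a *\<^sub>R u + b *\<^sub>R v) v"
    using MVT2[OF t, of "\<lambda>b. f' (x + a *\<^sub>R u + b *\<^sub>R v) u" "\<lambda>b. f2 (x + a *\<^sub>R u + b *\<^sub>R v) v"] by (auto simp: atLeastAtMost_iff)
  show ?thesis
    by (rule that[of a b]) (use a b in \<open>auto simp: \<phi>_def power2_eq_square algebra_simps\<close>)
qed

lemma second_derivative_limit:
  fixes f :: "'a::euclidean_space \<Rightarrow> real"
  assumes "open S" "x \<in> S" and C: "Ck_on 2 S f"
  shows "((\<lambda>t. (f (x + t *\<^sub>R u + t *\<^sub>R v) - f (x + t *\<^sub>R u) - f (x + t *\<^sub>R v) + f x) / t\<^sup>2) \<longlongrightarrow>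
    frechet_derivative (\<lambda>y. frechet_derivative f (at y) u) (at x) v) (at_right 0)"
proof -
  define f2 where "f2 y = frechet_derivative (\<lambda>y. frechet_derivative f (at y) u) (at y)" for y
  have C': "\<And>y. y \<in> S \<Longrightarrow> (f has_derivative frechet_derivative f (at y)) (at y)"
    "\<And>y. y \<in> S \<Longrightarrow> ((\<lambda>y. frechet_derivative f (at y) u) has_derivative f2 y) (at y)"
    "continuous_on S (\<lambda>y. f2 y v)"
    using C by (auto simp: numeral_2_eq_2 f2_def simp flip: frechet_derivative_works)
  show ?thesis unfolding f2_def[symmetric]
  proof (rule tendstoI)
    fix e :: real assume e: "e > 0"
    have "isCont (\<lambda>y. f2 y v) x" using C'(3) assms(1,2) continuous_on_eq_continuous_at by blast
    then obtain d1 where d1: "d1 > 0" "\<And>y. dist y x < d1 \<Longrightarrow> dist (f2 y v) (f2 x v) < e"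
      using e unfolding continuous_at_eps_delta by (metis)
    obtain d2 where d2: "d2 > 0" "ball x d2 \<subseteq> S" using assms(1,2) open_contains_ball by blast
    \<comment> \<open>Keeps the whole parallelogram spanned by \<open>t u\<close> and
      \<open>t v\<close> inside both balls; the summand 1 covers \<open>u = v = 0\<close>.\<close>
    define r where "r = min d1 d2 / (norm u + norm v + 1)"
    have nz: "norm u + norm v + 1 > 0" using norm_ge_zero[of u] norm_ge_zero[of v] by linarith
    have r: "r > 0" unfolding r_def using d1 d2 nz by auto
    have "dist ((f (x + t *\<^sub>R u + t *\<^sub>R v) - f (x + t *\<^sub>R u) - f (x + t *\<^sub>R v) + f x) / t\<^sup>2) (f2 x v) < e"
      if t: "0 < t" "t < r" for t
    proof -
      have near: "dist (x + a *\<^sub>R u + b *\<^sub>R v) x < min d1 d2" if "a \<in> {0..t}" "b \<in> {0..t}" for a b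
      proof -
        have "dist (x + a *\<^sub>R u + b *\<^sub>R v) x = norm (a *\<^sub>R u + b *\<^sub>R v)" by (simp add: dist_norm algebra_simps)
        also have "\<dots> \<le> a * norm u + b * norm v" using that norm_triangle_ineq[of "a *\<^sub>R u" "b *\<^sub>R v"] by auto
        also have "\<dots> \<le> t * norm u + t * norm v" using that by (intro add_mono mult_right_mono) auto
        also have "\<dots> \<le> t * (norm u + norm v + 1)" using t by (simp add: algebra_simps)
        also have "\<dots> < r * (norm u + norm v + 1)" using t nz by (intro mult_strict_right_mono) auto
        also have "\<dots> = min d1 d2" unfolding r_def using nz by simp
        finally show ?thesis .
      qed
      have inS: "x + a *\<^sub>R u + b *\<^sub>R v \<in> S" if "a \<in> {0..t}" "b \<in> {0..t}" for a b
        using near[OF that] d2(2) by (auto simp: dist_commute subset_iff)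
      obtain a b where ab: "a \<in> {0..t}" "b \<in> {0..t}"
        "f (x + t *\<^sub>R u + t *\<^sub>R v) - f (x + t *\<^sub>R u) - f (x + t *\<^sub>R v) + f x = t\<^sup>2 * f2 (x + a *\<^sub>R u + b *\<^sub>R v) v"
        using mixed_second_difference[OF C'(1,2) t(1) inS] by metis
      then show ?thesis using d1(2)[of "x + a *\<^sub>R u + b *\<^sub>R v"] near[OF ab(1,2)] t by simp
    qed
    then show "\<forall>\<^sub>F t in at_right 0. dist ((f (x + t *\<^sub>R u + t *\<^sub>R v) - f (x + t *\<^sub>R u) - f (x + t *\<^sub>R v) + f x) / t\<^sup>2) (f2 x v) < e"
      unfolding eventually_at_right_field using r by auto
  qed
qed

text \<open>The second difference is symmetric in \<open>u\<close> and \<open>v\<close>, so the two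
  orders of differentiation are limits of the same quotient.\<close>

lemma second_derivative_symmetric_real:
  fixes f :: "'a::euclidean_space \<Rightarrow> real"
  assumes "open S" "x \<in> S" "Ck_on 2 S f"
  shows "frechet_derivative (\<lambda>y. frechet_derivative f (at y) u) (at x) v =
    frechet_derivative (\<lambda>y. frechet_derivative f (at y) v) (at x) u"
proof -
  have "((\<lambda>t. (f (x + t *\<^sub>R u + t *\<^sub>R v) - f (x + t *\<^sub>R u) - f (x + t *\<^sub>R v) + f x) / t\<^sup>2) \<longlongrightarrow>
    frechet_derivative (\<lambda>y. frechet_derivative f (at y) v) (at x) u) (at_right 0)"
    using second_derivative_limit[OF assms, of v u] by (simp add: algebra_simps)
  with second_derivative_limit[OF assms, of u v] show ?thesis
    using tendsto_unique trivial_limit_at_right_real by blast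
qed

lemma second_derivative_symmetric:
  fixes f :: "'a::euclidean_space \<Rightarrow> 'b::euclidean_space"
  assumes "open S" "x \<in> S" "Ck_on 2 S f"
  shows "frechet_derivative (\<lambda>y. frechet_derivative f (at y) u) (at x) v =
    frechet_derivative (\<lambda>y. frechet_derivative f (at y) v) (at x) u"
proof (rule euclidean_eqI)
  fix b :: 'b assume "b \<in> Basis"
  have C: "Ck_on 2 S (\<lambda>x. f x \<bullet> b)"
    using Ck_on_bounded_linear[OF bounded_linear_inner_left assms(1,3)] .
  have D: "((\<lambda>y. f y \<bullet> b) has_derivative (\<lambda>u. frechet_derivative f (at y) u \<bullet> b)) (at y)" if "y \<in> S" for y
    using assms(3) that by (intro has_derivative_inner_left) (simp add: numeral_2_eq_2 flip: frechet_derivative_works)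
  have D2: "((\<lambda>y. frechet_derivative f (at y) u \<bullet> b) has_derivative
      (\<lambda>v. frechet_derivative (\<lambda>y. frechet_derivative f (at y) u) (at y) v \<bullet> b)) (at y)" if "y \<in> S" for y u
    using assms(3) that by (intro has_derivative_inner_left) (simp add: numeral_2_eq_2 flip: frechet_derivative_works)
  have "frechet_derivative (\<lambda>y. frechet_derivative f (at y) u) (at x) v \<bullet> b =
    frechet_derivative (\<lambda>y. frechet_derivative (\<lambda>y. f y \<bullet> b) (at y) u) (at x) v" for u v
    using frechet_derivative_cong_open[OF assms(1,2), of "\<lambda>y. frechet_derivative (\<lambda>y. f y \<bullet> b) (at y) u" "\<lambda>y. frechet_derivative f (at y) u \<bullet> b"]
      frechet_derivative_at[OF D] frechet_derivative_at[OF D2[OF assms(2)]] by metis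
  then show "frechet_derivative (\<lambda>y. frechet_derivative f (at y) u) (at x) v \<bullet> b =
      frechet_derivative (\<lambda>y. frechet_derivative f (at y) v) (at x) u \<bullet> b"
    using second_derivative_symmetric_real[OF assms(1,2) C] by metis
qed

section \<open>Regularity of solutions of linear systems with smooth coefficients\<close>

lemma has_derivative_mult_vanishing:
  fixes a :: "'a::real_normed_vector \<Rightarrow> real" and m :: "'a \<Rightarrow> 'b::real_normed_vector"
  assumes "isCont a x" "(m has_derivative m') (at x)" "m x = 0"
  shows "((\<lambda>y. a y *\<^sub>R m y) has_derivative (\<lambda>v. a x *\<^sub>R m' v)) (at x)"
proof -
  interpret m': bounded_linear m' using assms(2) has_derivative_bounded_linear by blast
  have 1: "((\<lambda>y. norm (m y - m x - m' (y - x)) / norm (y - x)) \<longlongrightarrow> 0) (at x)"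
    using assms(2) by (simp only: has_derivative_iff_norm)
  have a: "((\<lambda>y. \<bar>a y\<bar>) \<longlongrightarrow> \<bar>a x\<bar>) (at x)" and a0: "((\<lambda>y. \<bar>a y - a x\<bar> * onorm m') \<longlongrightarrow> 0) (at x)"
    using assms(1) by (auto simp: isCont_def intro!: tendsto_eq_intros)
  have "((\<lambda>y. \<bar>a y\<bar> * (norm (m y - m x - m' (y - x)) / norm (y - x)) + \<bar>a y - a x\<bar> * onorm m') \<longlongrightarrow> 0) (at x)"
    using tendsto_add[OF tendsto_mult[OF a 1] a0] by simp
  then have "((\<lambda>y. norm (a y *\<^sub>R m y - a x *\<^sub>R m x - a x *\<^sub>R m' (y - x)) / norm (y - x)) \<longlongrightarrow> 0) (at x)"
  proof (rule Lim_null_comparison[rotated], intro always_eventually allI)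
    fix y
    have "a y *\<^sub>R m y - a x *\<^sub>R m x - a x *\<^sub>R m' (y - x) = a y *\<^sub>R (m y - m x - m' (y - x)) + (a y - a x) *\<^sub>R m' (y - x)"
      using assms(3) by (simp add: algebra_simps)
    also have "norm \<dots> \<le> \<bar>a y\<bar> * norm (m y - m x - m' (y - x)) + \<bar>a y - a x\<bar> * norm (m' (y - x))"
      using norm_triangle_ineq by (metis norm_scaleR)
    also have "\<dots> \<le> \<bar>a y\<bar> * norm (m y - m x - m' (y - x)) + \<bar>a y - a x\<bar> * (onorm m' * norm (y - x))"
      by (intro add_left_mono mult_left_mono onorm m'.bounded_linear_axioms) auto
    finally show "norm (norm (a y *\<^sub>R m y - a x *\<^sub>R m x - a x *\<^sub>R m' (y - x)) / norm (y - x)) \<le>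
       \<bar>a y\<bar> * (norm (m y - m x - m' (y - x)) / norm (y - x)) + \<bar>a y - a x\<bar> * onorm m'"
      by (cases "y = x") (auto simp: divide_simps algebra_simps)
  qed
  then show ?thesis
    by (simp add: has_derivative_iff_norm m'.bounded_linear_axioms bounded_linear_const_scaleR)
qed

locale linear_family =
  fixes S :: "'a::euclidean_space set" and L :: "'a \<Rightarrow> 'e::euclidean_space \<Rightarrow> 'e"
  assumes S: "open S" and L: "\<And>x. x \<in> S \<Longrightarrow> linear (L x)" "\<And>x. x \<in> S \<Longrightarrow> inj (L x)"
begin

text \<open>Freezing the coefficients: \<open>L x0 w\<close> is \<open>L x w\<close> minus the
  correction \<open>(L x - L x0) w\<close>, and \<open>J\<close> inverts \<open>L x0\<close>. The
  correction is expanded in the basis so that only the maps \<open>\<lambda>x. L x b\<close> with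
  constant \<open>b\<close> occur.\<close>

lemma solve_fixed_point:
  assumes "x0 \<in> S"
  obtains J where "linear J" "\<And>x w. x \<in> S \<Longrightarrow> w = J (L x w - (\<Sum>b\<in>Basis. (w \<bullet> b) *\<^sub>R (L x b - L x0 b)))"
    "\<And>w. L x0 (J w) = w"
proof -
  obtain J where J: "linear J" "J \<circ> L x0 = id"
    using linear_injective_left_inverse[OF L[OF assms]] by blast
  have "w = J (L x w - (\<Sum>b\<in>Basis. (w \<bullet> b) *\<^sub>R (L x b - L x0 b)))" if "x \<in> S" for x w
  proof -
    have sum: "(\<Sum>b\<in>Basis. (w \<bullet> b) *\<^sub>R L y b) = L y w" if "y \<in> S" for y
      using linear_sum[OF L(1)[OF that], of "\<lambda>b. (w \<bullet> b) *\<^sub>R b" Basis] linear_scale[OF L(1)[OF that]]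
      by (simp add: euclidean_representation)
    have "L x w - (\<Sum>b\<in>Basis. (w \<bullet> b) *\<^sub>R (L x b - L x0 b)) = L x0 w"
      by (simp add: scaleR_diff_right sum_subtractf sum that assms)
    then show ?thesis using J(2) by (metis comp_apply id_apply)
  qed
  moreover have "L x0 (J w) = w" for w
  proof -
    obtain v where "w = L x0 v"
      using linear_injective_imp_surjective[OF L[OF assms]] by (meson surjD)
    then show ?thesis using J(2) by (metis comp_apply id_apply)
  qed
  ultimately show ?thesis using that J(1) by blast
qed

lemma solve_isCont:
  assumes x0: "x0 \<in> S" and Lc: "\<And>b. isCont (\<lambda>x. L x b) x0" and \<kappa>: "isCont \<kappa> x0"
    and sol: "\<And>x. x \<in> S \<Longrightarrow> L x (w x) = \<kappa> x"
  shows "isCont w x0"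
proof -
  obtain J where J: "linear J" "\<And>x w. x \<in> S \<Longrightarrow> w = J (L x w - (\<Sum>b\<in>Basis. (w \<bullet> b) *\<^sub>R (L x b - L x0 b)))"
    using solve_fixed_point[OF x0] by metis
  interpret J: bounded_linear J using J(1) linear_conv_bounded_linear by blast
  obtain K where K: "K > 0" "\<And>v. norm (J v) \<le> norm v * K" using J.pos_bounded by blast
  define \<delta> where "\<delta> x = (\<Sum>b\<in>Basis. norm (L x b - L x0 b))" for x
  have \<delta>: "(\<delta> \<longlongrightarrow> 0) (at x0)"
    unfolding \<delta>_def using Lc by (auto simp: isCont_def intro!: tendsto_eq_intros)
  have est: "norm (\<Sum>b\<in>Basis. (w \<bullet> b) *\<^sub>R (L x b - L x0 b)) \<le> norm w * \<delta> x" for w x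
  proof -
    have "norm (\<Sum>b\<in>Basis. (w \<bullet> b) *\<^sub>R (L x b - L x0 b)) \<le> (\<Sum>b\<in>Basis. norm ((w \<bullet> b) *\<^sub>R (L x b - L x0 b)))"
      by (rule norm_sum)
    also have "\<dots> \<le> (\<Sum>b\<in>Basis. norm w * norm (L x b - L x0 b))"
      by (intro sum_mono) (auto intro!: mult_right_mono Basis_le_norm)
    finally show ?thesis by (simp add: \<delta>_def sum_distrib_left)
  qed
  \<comment> \<open>With this bound the correction contributes at most half of
    \<open>norm (w x)\<close>, which is absorbed on the left and leaves an a priori bound on
    \<open>w\<close>.\<close>
  have "eventually (\<lambda>x. \<delta> x < 1 / (2 * K)) (at x0)" using \<delta> K(1) by (intro order_tendstoD) auto
  moreover have "eventually (\<lambda>x. x \<in> S) (at x0)" using S x0 by (rule eventually_at_in_open')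
  moreover have "eventually (\<lambda>x. norm (\<kappa> x) < norm (\<kappa> x0) + 1) (at x0)"
    by (rule order_tendstoD(2)[OF tendsto_norm]) (use \<kappa> in \<open>auto simp: isCont_def\<close>)
  ultimately have bd: "eventually (\<lambda>x. norm (w x) \<le> 2 * K * (norm (\<kappa> x0) + 1)) (at x0)"
  proof eventually_elim
    case (elim x)
    have "norm (w x) \<le> norm (\<kappa> x - (\<Sum>b\<in>Basis. (w x \<bullet> b) *\<^sub>R (L x b - L x0 b))) * K"
      using J(2)[OF elim(2), of "w x"] K(2) sol[OF elim(2)] by metis
    also have "\<dots> \<le> (norm (\<kappa> x) + norm (w x) * \<delta> x) * K"
      using est[of "w x" x] norm_triangle_ineq4[of "\<kappa> x"] K(1)
      by (intro mult_right_mono) (auto intro: order_trans[OF norm_triangle_ineq4])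
    also have "\<dots> \<le> (norm (\<kappa> x0) + 1) * K + norm (w x) * (1 / 2)"
    proof -
      have "\<delta> x * K \<le> 1 / 2" using elim(1) K(1) by (simp add: field_simps)
      then have "norm (w x) * (\<delta> x * K) \<le> norm (w x) * (1 / 2)" by (intro mult_left_mono) auto
      moreover have "norm (\<kappa> x) * K \<le> (norm (\<kappa> x0) + 1) * K" using elim(3) K(1) by (intro mult_right_mono) auto
      ultimately show ?thesis by (simp add: algebra_simps)
    qed
    finally show ?case by (simp add: algebra_simps)
  qed
  have "((\<lambda>x. 2 * K * (norm (\<kappa> x0) + 1) * \<delta> x) \<longlongrightarrow> 0) (at x0)"
    using \<delta> by (auto intro!: tendsto_eq_intros)
  then have "((\<lambda>x. \<Sum>b\<in>Basis. (w x \<bullet> b) *\<^sub>R (L x b - L x0 b)) \<longlongrightarrow> 0) (at x0)"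
    by (rule Lim_null_comparison[rotated])
      (rule eventually_mono[OF bd], rule order_trans[OF est], auto intro!: mult_right_mono sum_nonneg simp: \<delta>_def)
  then have "((\<lambda>x. J (\<kappa> x - (\<Sum>b\<in>Basis. (w x \<bullet> b) *\<^sub>R (L x b - L x0 b)))) \<longlongrightarrow> J (\<kappa> x0 - 0)) (at x0)"
    using \<kappa> by (intro J.tendsto tendsto_diff) (auto simp: isCont_def)
  moreover have "eventually (\<lambda>x. J (\<kappa> x - (\<Sum>b\<in>Basis. (w x \<bullet> b) *\<^sub>R (L x b - L x0 b))) = w x) (at x0)"
    using eventually_at_in_open'[OF S x0] by eventually_elim (metis J(2) sol)
  moreover have "J (\<kappa> x0 - 0) = w x0" using J(2)[OF x0, of "w x0"] sol[OF x0] by simp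
  ultimately show ?thesis unfolding isCont_def using Lim_transform_eventually by fastforce
qed

text \<open>Continuity of \<open>w\<close> is enough because it multiplies
  \<open>L x b - L x0 b\<close>, which vanishes at \<open>x0\<close>: at a zero of the other factor
  the product rule asks no differentiability of this one.\<close>

lemma solve_has_derivative:
  assumes x0: "x0 \<in> S" and L': "\<And>b. b \<in> Basis \<Longrightarrow> ((\<lambda>x. L x b) has_derivative L' b) (at x0)"
    and \<kappa>: "(\<kappa> has_derivative \<kappa>') (at x0)" and w: "isCont w x0"
    and sol: "\<And>x. x \<in> S \<Longrightarrow> L x (w x) = \<kappa> x"
  obtains w' where "(w has_derivative w') (at x0)" "\<And>v. L x0 (w' v) = \<kappa>' v - (\<Sum>b\<in>Basis. (w x0 \<bullet> b) *\<^sub>R L' b v)"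
proof -
  obtain J where J: "linear J" "\<And>x w. x \<in> S \<Longrightarrow> w = J (L x w - (\<Sum>b\<in>Basis. (w \<bullet> b) *\<^sub>R (L x b - L x0 b)))"
    "\<And>w. L x0 (J w) = w"
    using solve_fixed_point[OF x0] by metis
  have "((\<lambda>x. (w x \<bullet> b) *\<^sub>R (L x b - L x0 b)) has_derivative (\<lambda>v. (w x0 \<bullet> b) *\<^sub>R L' b v)) (at x0)" if "b \<in> Basis" for b
    by (rule has_derivative_mult_vanishing) (use w L'[OF that] in \<open>auto intro!: derivative_eq_intros continuous_intros\<close>)
  then have "((\<lambda>x. J (\<kappa> x - (\<Sum>b\<in>Basis. (w x \<bullet> b) *\<^sub>R (L x b - L x0 b)))) has_derivative
     (\<lambda>v. J (\<kappa>' v - (\<Sum>b\<in>Basis. (w x0 \<bullet> b) *\<^sub>R L' b v)))) (at x0)"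
    using \<kappa> J(1) by (intro bounded_linear.has_derivative[of J] has_derivative_diff has_derivative_sum)
      (auto simp: linear_conv_bounded_linear)
  then have "(w has_derivative (\<lambda>v. J (\<kappa>' v - (\<Sum>b\<in>Basis. (w x0 \<bullet> b) *\<^sub>R L' b v)))) (at x0)"
    by (rule has_derivative_transform_within_open[OF _ S x0]) (metis J(2) sol)
  then show ?thesis using that J(3) by blast
qed

text \<open>The derivative of \<open>w\<close> in direction \<open>v\<close> solves the same system
  with right-hand side \<open>r v\<close>, which has one derivative fewer than the data, so
  induction on the order applies.\<close>

lemma Ck_on_solve:
  assumes Lc: "\<And>b. Ck_on n S (\<lambda>x. L x b)" and \<kappa>: "Ck_on n S \<kappa>"
    and sol: "\<And>x. x \<in> S \<Longrightarrow> L x (w x) = \<kappa> x"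
  shows "Ck_on n S w"
  using assms
proof (induction n arbitrary: \<kappa> w)
  case 0
  show ?case
    using solve_isCont[of _ \<kappa> w] 0 S by (auto simp: continuous_on_eq_continuous_at)
next
  case (Suc n)
  have w: "Ck_on n S w"
    by (rule Suc.IH[of \<kappa>]) (use Suc.prems Ck_on_SucD in \<open>blast+\<close>)
  define r where "r v x = frechet_derivative \<kappa> (at x) v - (\<Sum>b\<in>Basis. (w x \<bullet> b) *\<^sub>R frechet_derivative (\<lambda>x. L x b) (at x) v)" for v x
  have r: "Ck_on n S (r v)" for v
    unfolding r_def using Suc.prems w
    by (intro Ck_on_diff[OF S] Ck_on_sum[OF S] Ck_on_bounded_bilinear[OF bounded_bilinear_scaleR S]
        Ck_on_bounded_linear[OF bounded_linear_inner_left S]) auto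
  have cont: "isCont (\<lambda>x. L x b) x" "isCont \<kappa> x" if "x \<in> S" for x b
    using Suc.prems(1,2) that by (auto intro: differentiable_imp_continuous_within)
  have "\<exists>w'. (w has_derivative w') (at x) \<and> (\<forall>v. L x (w' v) = r v x)" if x: "x \<in> S" for x
  proof -
    have w: "isCont w x" using solve_isCont[OF x cont[OF x]] Suc.prems(3) by blast
    have "((\<lambda>x. L x b) has_derivative frechet_derivative (\<lambda>x. L x b) (at x)) (at x)"
      "(\<kappa> has_derivative frechet_derivative \<kappa> (at x)) (at x)" for b
      using Suc.prems(1,2) x by (simp_all flip: frechet_derivative_works)
    from solve_has_derivative[OF x this w Suc.prems(3)] obtain w' where "(w has_derivative w') (at x)"
      "\<And>v. L x (w' v) = r v x" unfolding r_def by blast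
    then show ?thesis by blast
  qed
  then obtain w' where w': "\<And>x. x \<in> S \<Longrightarrow> (w has_derivative w' x) (at x)" "\<And>x v. x \<in> S \<Longrightarrow> L x (w' x v) = r v x"
    by metis
  have "Ck_on n S (\<lambda>x. w' x v)" for v
    by (rule Suc.IH[OF Ck_on_SucD[OF Suc.prems(1)] r[of v] w'(2)])
  then show ?case using Ck_on_SucI[OF S w'(1)] by blast
qed

end

section \<open>Riemannian metrics on open sets\<close>

lemma bilinear_expand:
  fixes \<beta> :: "'a::euclidean_space \<Rightarrow> 'b::euclidean_space \<Rightarrow> 'c::real_vector"
  assumes "bilinear \<beta>"
  shows "\<beta> u v = (\<Sum>i\<in>Basis. \<Sum>j\<in>Basis. ((u \<bullet> i) * (v \<bullet> j)) *\<^sub>R \<beta> i j)"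
proof -
  have l: "linear (\<lambda>u. \<beta> u v)" "linear (\<lambda>v. \<beta> u v)" for u v using assms by (auto simp: bilinear_def)
  have 1: "\<beta> i v = (\<Sum>j\<in>Basis. (v \<bullet> j) *\<^sub>R \<beta> i j)" for i
    using linear_sum[OF l(2)[of i], of "\<lambda>j. (v \<bullet> j) *\<^sub>R j" Basis] linear_scale[OF l(2)[of i]]
    by (simp add: euclidean_representation)
  have "\<beta> u v = (\<Sum>i\<in>Basis. (u \<bullet> i) *\<^sub>R \<beta> i v)"
    using linear_sum[OF l(1)[of v], of "\<lambda>i. (u \<bullet> i) *\<^sub>R i" Basis] linear_scale[OF l(1)[of v]]
    by (simp add: euclidean_representation)
  also have "\<dots> = (\<Sum>i\<in>Basis. \<Sum>j\<in>Basis. ((u \<bullet> i) * (v \<bullet> j)) *\<^sub>R \<beta> i j)"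
    by (intro sum.cong refl) (subst 1, simp add: scaleR_sum_right)
  finally show ?thesis .
qed

lemma frechet_derivative_eqI: "(f has_derivative D) (at x) \<Longrightarrow> frechet_derivative f (at x) h = D h"
  using frechet_derivative_at by metis

lemma has_derivative_bilinear_family:
  fixes \<beta> :: "'x::real_normed_vector \<Rightarrow> 'a::euclidean_space \<Rightarrow> 'b::euclidean_space \<Rightarrow> 'c::real_normed_vector"
  assumes S: "open S" "x \<in> S" and bil: "\<And>y. y \<in> S \<Longrightarrow> bilinear (\<beta> y)"
    and D: "\<And>u v. ((\<lambda>y. \<beta> y u v) has_derivative D u v) (at x)"
    and a: "(a has_derivative a') (at x)" and b: "(b has_derivative b') (at x)"
  shows "((\<lambda>y. \<beta> y (a y) (b y)) has_derivative
    (\<lambda>h. D (a x) (b x) h + \<beta> x (a' h) (b x) + \<beta> x (a x) (b' h))) (at x)"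
proof -
  have expand: "(\<Sum>i\<in>Basis. \<Sum>j\<in>Basis. ((u \<bullet> i) * (v \<bullet> j)) *\<^sub>R \<beta> y i j) = \<beta> y u v" if "y \<in> S" for y u v
    using bilinear_expand[OF bil[OF that]] by metis
  have "((\<lambda>y. \<Sum>i\<in>Basis. \<Sum>j\<in>Basis. ((u \<bullet> i) * (v \<bullet> j)) *\<^sub>R \<beta> y i j) has_derivative
      (\<lambda>h. \<Sum>i\<in>Basis. \<Sum>j\<in>Basis. ((u \<bullet> i) * (v \<bullet> j)) *\<^sub>R D i j h)) (at x)" for u v
    by (intro has_derivative_sum bounded_linear.has_derivative[OF bounded_linear_scaleR_right] D)
  then have "((\<lambda>y. \<beta> y u v) has_derivative
      (\<lambda>h. \<Sum>i\<in>Basis. \<Sum>j\<in>Basis. ((u \<bullet> i) * (v \<bullet> j)) *\<^sub>R D i j h)) (at x)" for u v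
    by (rule has_derivative_transform_within_open[OF _ S]) (rule expand)
  then have Dsum: "D u v h = (\<Sum>i\<in>Basis. \<Sum>j\<in>Basis. ((u \<bullet> i) * (v \<bullet> j)) *\<^sub>R D i j h)" for u v h
    using fun_cong[OF has_derivative_unique[OF D]] by blast
  have "((\<lambda>y. \<Sum>i\<in>Basis. \<Sum>j\<in>Basis. ((a y \<bullet> i) * (b y \<bullet> j)) *\<^sub>R \<beta> y i j) has_derivative
      (\<lambda>h. \<Sum>i\<in>Basis. \<Sum>j\<in>Basis. ((a x \<bullet> i) * (b x \<bullet> j)) *\<^sub>R D i j h +
         ((a x \<bullet> i) * (b' h \<bullet> j) + (a' h \<bullet> i) * (b x \<bullet> j)) *\<^sub>R \<beta> x i j)) (at x)"
    by (intro has_derivative_sum has_derivative_scaleR D has_derivative_mult has_derivative_inner_left a b)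
  then have "((\<lambda>y. \<beta> y (a y) (b y)) has_derivative
      (\<lambda>h. \<Sum>i\<in>Basis. \<Sum>j\<in>Basis. ((a x \<bullet> i) * (b x \<bullet> j)) *\<^sub>R D i j h +
         ((a x \<bullet> i) * (b' h \<bullet> j) + (a' h \<bullet> i) * (b x \<bullet> j)) *\<^sub>R \<beta> x i j)) (at x)"
    by (rule has_derivative_transform_within_open[OF _ S]) (rule expand)
  moreover have "(\<Sum>i\<in>Basis. \<Sum>j\<in>Basis. ((a x \<bullet> i) * (b x \<bullet> j)) *\<^sub>R D i j h +
         ((a x \<bullet> i) * (b' h \<bullet> j) + (a' h \<bullet> i) * (b x \<bullet> j)) *\<^sub>R \<beta> x i j) =
      D (a x) (b x) h + \<beta> x (a' h) (b x) + \<beta> x (a x) (b' h)" for h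
    by (simp add: sum.distrib scaleR_add_left expand[OF S(2)] flip: Dsum)
  ultimately show ?thesis by simp
qed

lemma has_derivative_linear_family:
  fixes P :: "'x::real_normed_vector \<Rightarrow> 'a::euclidean_space \<Rightarrow> 'c::real_normed_vector"
  assumes S: "open S" "x \<in> S" and lin: "\<And>y. y \<in> S \<Longrightarrow> linear (P y)"
    and D: "\<And>u. ((\<lambda>y. P y u) has_derivative D u) (at x)"
    and a: "(a has_derivative a') (at x)"
  shows "((\<lambda>y. P y (a y)) has_derivative (\<lambda>h. D (a x) h + P x (a' h))) (at x)"
proof -
  \<comment> \<open>Reduction to the bilinear case by a dummy real factor, held at 1.\<close>
  have bil: "bilinear (\<lambda>(r::real) u. r *\<^sub>R P y u)" if "y \<in> S" for y
    using lin[OF that] by (auto simp: bilinear_def linear_iff scaleR_add_left scaleR_add_right)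
  have "((\<lambda>y. 1 *\<^sub>R P y (a y)) has_derivative (\<lambda>h. 1 *\<^sub>R D (a x) h + 0 *\<^sub>R P x (a x) + 1 *\<^sub>R P x (a' h))) (at x)"
    by (rule has_derivative_bilinear_family[where \<beta> = "\<lambda>y (r::real) u. r *\<^sub>R P y u" and a = "\<lambda>_. 1" and D = "\<lambda>r u h. r *\<^sub>R D u h", OF S bil])
      (auto intro!: derivative_eq_intros D a)
  then show ?thesis by simp
qed

text \<open>Polarise \<open>T(u, v, v, u) = 0\<close> twice and use the first Bianchi identity.\<close>

lemma curvature_like_zero:
  fixes T :: "'a::real_vector \<Rightarrow> 'a \<Rightarrow> 'a \<Rightarrow> 'a \<Rightarrow> real"
  assumes add: "\<And>u u' v w z. T (u + u') v w z = T u v w z + T u' v w z"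
      "\<And>u v v' w z. T u (v + v') w z = T u v w z + T u v' w z"
      "\<And>u v w w' z. T u v (w + w') z = T u v w z + T u v w' z"
      "\<And>u v w z z'. T u v w (z + z') = T u v w z + T u v w z'"
    and skew: "\<And>u v w z. T u v w z = - T v u w z" "\<And>u v w z. T u v w z = - T u v z w"
    and bianchi: "\<And>u v w z. T u v w z + T v w u z + T w u v z = 0"
    and zero: "\<And>u v. T u v v u = 0"
  shows "T u v w z = 0"
proof -
  \<comment> \<open>Pair symmetry is a linear consequence of four cyclic sums and the two
    skew-symmetries.\<close>
  have pair: "T u v w z = T w z u v" for u v w z
    using bianchi[of u v w z] bianchi[of v w z u] bianchi[of w z u v] bianchi[of z u v w]
      skew(1)[of u v w z] skew(2)[of u v w z] skew(1)[of v w u z] skew(2)[of v w u z]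
      skew(1)[of w u v z] skew(2)[of w u v z] skew(1)[of w z u v] skew(2)[of w z u v]
      skew(1)[of z v w u] skew(2)[of z v w u] skew(1)[of z u v w] skew(2)[of z u v w]
      skew(1)[of u w z v] skew(2)[of u w z v] skew(1)[of v w z u] skew(1)[of u w v z]
      skew(1)[of v z w u] skew(2)[of u w v z] skew(2)[of v z w u] skew(1)[of w u z v]
      skew(1)[of v z u w] skew(2)[of v z u w] skew(1)[of z v u w] skew(1)[of u v z w]
      skew(1)[of z w u v] skew(1)[of u z v w] skew(2)[of u z v w] skew(2)[of z w v u] 
      skew(2)[of v w z u] skew(2)[of z w u v] skew(2)[of z v u w] skew(2)[of w u z v]
    by linarith
  have mid: "T u v v z = 0" for u v z
  proof -
    have "T (u + z) v v (u + z) = T u v v u + T u v v z + T z v v u + T z v v z"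
      by (simp add: add)
    moreover have "T z v v u = T u v v z" using pair[of z v v u] skew(1)[of v u z v] skew(2)[of u v z v] by linarith
    ultimately show ?thesis using zero[of "u + z" v] zero[of u v] zero[of z v] by linarith
  qed
  have sw: "T u v w z = - T u w v z" for u v w z
  proof -
    have "T u (v + w) (v + w) z = T u v v z + T u v w z + T u w v z + T u w w z" by (simp add: add)
    then show ?thesis using mid[of u "v + w" z] mid[of u v z] mid[of u w z] by linarith
  qed
  \<comment> \<open>Now \<open>T\<close> is alternating in its first three arguments, so the cyclic
    sum is three times \<open>T u v w z\<close>.\<close>
  have "T v w u z = T u v w z" using sw[of v w u z] skew(1)[of v u w z] by linarith
  moreover have "T w u v z = T u v w z" using skew(1)[of w u v z] sw[of u w v z] by linarith
  ultimately show ?thesis using bianchi[of u v w z] by linarith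
qed

section \<open>Levi-Civita connection and curvature in coordinates\<close>

lemma isCont_open_preimage:
  assumes "isCont c t" "c t \<in> \<Omega>" "open \<Omega>"
  obtains S where "open S" "t \<in> S" "\<And>s. s \<in> S \<Longrightarrow> c s \<in> \<Omega>"
  using continuous_at_open[of t c] assms by blast

lemma has_vector_derivative_chain:
  assumes "(x has_vector_derivative v) (at t within T)" "(\<phi> has_derivative D) (at (x t))"
  shows "((\<lambda>s. \<phi> (x s)) has_vector_derivative D v) (at t within T)"
  using has_derivative_compose[OF assms(1)[unfolded has_vector_derivative_def] assms(2)]
  unfolding has_vector_derivative_def linear_scale[OF has_derivative_linear[OF assms(2)]] .

locale riemannian_patch =
  fixes \<Omega> :: "'e::euclidean_space set" and G :: "'e \<Rightarrow> 'e \<Rightarrow> 'e \<Rightarrow> real"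
  assumes open_dom: "open \<Omega>"
    and bilin: "x \<in> \<Omega> \<Longrightarrow> bilinear (G x)"
    and symm: "x \<in> \<Omega> \<Longrightarrow> G x u v = G x v u"
    and pos: "x \<in> \<Omega> \<Longrightarrow> u \<noteq> 0 \<Longrightarrow> 0 < G x u u"
    and smooth: "smooth_on \<Omega> (\<lambda>x. G x u v)"
begin

abbreviation \<Gamma> where "\<Gamma> \<equiv> christoffel G"
abbreviation DG where "DG x u v \<equiv> frechet_derivative (\<lambda>x. G x u v) (at x)"
abbreviation D\<Gamma> where "D\<Gamma> x u v \<equiv> frechet_derivative (\<lambda>x. \<Gamma> x u v) (at x)"
abbreviation R where "R \<equiv> curvature_tensor G"

lemmas G_simps = bilinear_ladd[OF bilin] bilinear_radd[OF bilin] bilinear_lmul[OF bilin] bilinear_rmul[OF bilin]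
  bilinear_lsub[OF bilin] bilinear_rsub[OF bilin] bilinear_lneg[OF bilin] bilinear_rneg[OF bilin]
  bilinear_lzero[OF bilin] bilinear_rzero[OF bilin]

lemma DG: "x \<in> \<Omega> \<Longrightarrow> ((\<lambda>x. G x u v) has_derivative DG x u v) (at x)"
  by (rule smooth_on_has_derivative[OF smooth])

lemma DG_linear: "x \<in> \<Omega> \<Longrightarrow> linear (DG x u v)"
  using DG has_derivative_linear by blast

lemma DG_sym: "x \<in> \<Omega> \<Longrightarrow> DG x u v = DG x v u"
  using frechet_derivative_cong_open[OF open_dom, of x "\<lambda>x. G x u v" "\<lambda>x. G x v u"] symm by auto

lemma DG_bilinear:
  assumes x: "x \<in> \<Omega>" shows "bilinear (\<lambda>u v. DG x u v h)"
proof -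
  have 1: "DG x (u + u') v h = DG x u v h + DG x u' v h" for u u' v
  proof -
    have "((\<lambda>x. G x (u + u') v) has_derivative (\<lambda>h. DG x u v h + DG x u' v h)) (at x)"
      by (rule has_derivative_transform_within_open[OF has_derivative_add[OF DG DG] open_dom x, OF x x])
        (simp add: G_simps)
    then show ?thesis by (rule frechet_derivative_eqI)
  qed
  have 2: "DG x (c *\<^sub>R u) v h = c * DG x u v h" for c u v
  proof -
    have "((\<lambda>x. G x (c *\<^sub>R u) v) has_derivative (\<lambda>h. c * DG x u v h)) (at x)"
      by (rule has_derivative_transform_within_open[OF has_derivative_mult_right[OF DG[OF x]] open_dom x])
        (simp add: G_simps)
    then show ?thesis by (rule frechet_derivative_eqI)
  qed
  have 3: "DG x v (u + u') h = DG x v u h + DG x v u' h" "DG x v (c *\<^sub>R u) h = c * DG x v u h" for u u' v c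
    unfolding DG_sym[OF x, of v] by (rule 1 2)+
  show ?thesis unfolding bilinear_def
    by (intro conjI allI linearI) (simp_all only: 1 2 3 real_scaleR_def)
qed

text \<open>The musical isomorphism, with covectors identified with vectors by the Euclidean
  product. It exhibits the Christoffel symbols as solutions of a linear system, so that
  \<open>linear_family\<close> yields their smoothness.\<close>

definition flat_map :: "'e \<Rightarrow> 'e \<Rightarrow> 'e" where
  "flat_map x w = (\<Sum>b\<in>Basis. G x w b *\<^sub>R b)"

lemma flat_map_inner: "x \<in> \<Omega> \<Longrightarrow> flat_map x w \<bullet> z = G x w z"
proof -
  assume x: "x \<in> \<Omega>"
  have l: "linear (G x w)" using bilin[OF x] by (auto simp: bilinear_def)
  have "G x w z = G x w (\<Sum>b\<in>Basis. (z \<bullet> b) *\<^sub>R b)" by (simp add: euclidean_representation)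
  also have "\<dots> = (\<Sum>b\<in>Basis. (z \<bullet> b) * G x w b)"
    by (simp add: linear_sum[OF l] linear_scale[OF l] o_def del: euclidean_representation)
  finally show ?thesis by (simp add: flat_map_def inner_sum_left inner_commute[of z] mult.commute)
qed

lemma nondegenerate: "x \<in> \<Omega> \<Longrightarrow> (\<And>z. G x w z = G x w' z) \<Longrightarrow> w = w'"
  using pos[of x "w - w'"] by (force simp: G_simps)

lemma flat_map_linear: "x \<in> \<Omega> \<Longrightarrow> linear (flat_map x)"
  by (rule linearI) (simp_all add: flat_map_def G_simps scaleR_add_left sum.distrib scaleR_sum_right)

lemma flat_map_inj: "x \<in> \<Omega> \<Longrightarrow> inj (flat_map x)"
  using nondegenerate flat_map_inner by (metis injI)

sublocale linear_family \<Omega> flat_map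
  by (rule linear_family.intro[OF open_dom flat_map_linear flat_map_inj])

definition koszul :: "'e \<Rightarrow> 'e \<Rightarrow> 'e \<Rightarrow> 'e \<Rightarrow> real" where
  "koszul x u v z = (DG x v z u + DG x u z v - DG x u v z) / 2"

text \<open>The Koszul expression is linear in \<open>z\<close>, hence is \<open>G x w\<close> for
  some \<open>w\<close> by surjectivity of \<open>flat_map x\<close>, and \<open>w\<close> is unique
  by nondegeneracy. This discharges the definite description in \<open>christoffel\<close>.\<close>

lemma christoffel_koszul:
  assumes x: "x \<in> \<Omega>" shows "G x (\<Gamma> x u v) z = koszul x u v z"
proof -
  interpret bounded_linear "koszul x u v"
    unfolding linear_conv_bounded_linear[symmetric] koszul_def linear_iff
    using bilinear_radd[OF DG_bilinear[OF x]] bilinear_rmul[OF DG_bilinear[OF x]] linear_add[OF DG_linear[OF x]] linear_scale[OF DG_linear[OF x]]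
    by (auto simp: field_simps)
  obtain w where "flat_map x w = (\<Sum>b\<in>Basis. koszul x u v b *\<^sub>R b)"
    using linear_injective_imp_surjective[OF L[OF x]] by (metis surjD)
  moreover have "(\<Sum>b\<in>Basis. koszul x u v b *\<^sub>R b) \<bullet> z = koszul x u v z" for z
  proof -
    have "koszul x u v z = koszul x u v (\<Sum>b\<in>Basis. (z \<bullet> b) *\<^sub>R b)" by (simp add: euclidean_representation)
    also have "\<dots> = (\<Sum>b\<in>Basis. (z \<bullet> b) * koszul x u v b)"
      by (simp add: sum scaleR del: euclidean_representation)
    finally show ?thesis by (simp add: inner_sum_left inner_commute[of z] mult.commute)
  qed
  ultimately have w: "\<forall>z. G x w z = koszul x u v z" using flat_map_inner[OF x] by metis
  then have "\<exists>!w. \<forall>z. G x w z = koszul x u v z" using nondegenerate[OF x] by metis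
  then show ?thesis unfolding christoffel_def koszul_def[symmetric] using theI'[where P = "\<lambda>w. \<forall>z. G x w z = koszul x u v z"] by blast
qed

lemma christoffel_sym: "x \<in> \<Omega> \<Longrightarrow> \<Gamma> x u v = \<Gamma> x v u"
  by (rule nondegenerate) (auto simp: christoffel_koszul koszul_def DG_sym[of x u v])

lemma christoffel_bilinear: assumes x: "x \<in> \<Omega>" shows "bilinear (\<Gamma> x)"
proof -
  have 1: "\<Gamma> x (u + u') v = \<Gamma> x u v + \<Gamma> x u' v" for u u' v
    by (rule nondegenerate[OF x])
      (simp add: G_simps x christoffel_koszul koszul_def linear_add[OF DG_linear[OF x]] bilinear_ladd[OF DG_bilinear[OF x]] field_simps)
  have 2: "\<Gamma> x (c *\<^sub>R u) v = c *\<^sub>R \<Gamma> x u v" for c u v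
    by (rule nondegenerate[OF x])
      (simp add: G_simps x christoffel_koszul koszul_def linear_scale[OF DG_linear[OF x]] bilinear_lmul[OF DG_bilinear[OF x]] field_simps)
  show ?thesis unfolding bilinear_def linear_iff using 1 2 christoffel_sym[OF x] by metis
qed

lemmas \<Gamma>_simps = bilinear_ladd[OF christoffel_bilinear] bilinear_radd[OF christoffel_bilinear]
  bilinear_lmul[OF christoffel_bilinear] bilinear_rmul[OF christoffel_bilinear]
  bilinear_lsub[OF christoffel_bilinear] bilinear_rsub[OF christoffel_bilinear]
  bilinear_lzero[OF christoffel_bilinear] bilinear_rzero[OF christoffel_bilinear]

lemma christoffel_smooth: "smooth_on \<Omega> (\<lambda>x. \<Gamma> x u v)"
  unfolding smooth_on_def
proof
  fix n
  have G: "Ck_on n \<Omega> (\<lambda>x. G x u v)" for u v using smooth smooth_on_def by blast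
  have DG: "Ck_on n \<Omega> (\<lambda>x. DG x u v h)" for u v h
    using smooth_on_frechet_derivative[OF smooth] smooth_on_def by blast
  have "Ck_on n \<Omega> (\<lambda>x. koszul x u v z)" for z
  proof -
    have "Ck_on n \<Omega> (\<lambda>x. (1/2) *\<^sub>R (DG x v z u + DG x u z v - DG x u v z))"
      by (intro Ck_on_bounded_linear[OF bounded_linear_scaleR_right] Ck_on_diff Ck_on_add DG open_dom)
    then show ?thesis unfolding koszul_def by simp
  qed
  then have K: "Ck_on n \<Omega> (\<lambda>x. \<Sum>b\<in>Basis. koszul x u v b *\<^sub>R b)"
    by (intro Ck_on_sum Ck_on_bounded_linear[OF bounded_linear_scaleR_left] open_dom)
  have F: "Ck_on n \<Omega> (\<lambda>x. flat_map x b)" for b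
    unfolding flat_map_def by (intro Ck_on_sum Ck_on_bounded_linear[OF bounded_linear_scaleR_left] open_dom G)
  show "Ck_on n \<Omega> (\<lambda>x. \<Gamma> x u v)"
    by (rule Ck_on_solve[OF F K]) (simp add: flat_map_def christoffel_koszul)
qed

lemma D\<Gamma>: "x \<in> \<Omega> \<Longrightarrow> ((\<lambda>x. \<Gamma> x u v) has_derivative D\<Gamma> x u v) (at x)"
  by (rule smooth_on_has_derivative[OF christoffel_smooth])

lemma D\<Gamma>_sym: "x \<in> \<Omega> \<Longrightarrow> D\<Gamma> x u v = D\<Gamma> x v u"
  using frechet_derivative_cong_open[OF open_dom, of x "\<lambda>x. \<Gamma> x u v" "\<lambda>x. \<Gamma> x v u"] christoffel_sym by auto

lemma metric_compatible:
  assumes x: "x \<in> \<Omega>" shows "DG x v w u = G x (\<Gamma> x u v) w + G x v (\<Gamma> x u w)"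
proof -
  have "G x v (\<Gamma> x u w) = koszul x u w v" using christoffel_koszul[OF x] symm[OF x] by metis
  then show ?thesis
    using christoffel_koszul[OF x, of u v w] DG_sym[OF x, of w v] unfolding koszul_def by (simp add: field_simps)
qed

lemma has_derivative_G:
  assumes x: "x \<in> \<Omega>" and "(a has_derivative a') (at x)" "(b has_derivative b') (at x)"
  shows "((\<lambda>y. G y (a y) (b y)) has_derivative
    (\<lambda>h. G x (a' h + \<Gamma> x h (a x)) (b x) + G x (a x) (b' h + \<Gamma> x h (b x)))) (at x)"
  by (rule has_derivative_eq_rhs[OF has_derivative_bilinear_family[OF open_dom x bilin DG[OF x] assms(2,3)]])
    (auto simp: metric_compatible x G_simps)

lemma R_def': "R x u v w = D\<Gamma> x v w u - D\<Gamma> x u w v + \<Gamma> x u (\<Gamma> x v w) - \<Gamma> x v (\<Gamma> x u w)"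
  by (rule curvature_tensor_def)

lemma R_skew: "R x u v w = - R x v u w"
  by (simp add: R_def')

lemma R_bianchi: "x \<in> \<Omega> \<Longrightarrow> R x u v w + R x v w u + R x w u v = 0"
  unfolding R_def' using D\<Gamma>_sym[of x] christoffel_sym[of x] by (simp add: algebra_simps)

text \<open>Second derivatives of \<open>G\<close> in directions \<open>u\<close> and
  \<open>v\<close> commute. Expanding both by metric compatibility, the products of two first-order
  terms are symmetric in \<open>u\<close> and \<open>v\<close> and cancel; the rest is
  \<open>G x (R w) z + G x w (R z) = 0\<close>.\<close>

lemma R_metric_skew: assumes x: "x \<in> \<Omega>" shows "G x (R x u v w) z = - G x w (R x u v z)"
proof -
  have C2: "Ck_on 2 \<Omega> (\<lambda>x. G x w z)" using smooth smooth_on_def by blast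
  have D2: "frechet_derivative (\<lambda>y. DG y w z v) (at x) u =
    G x (D\<Gamma> x v w u + \<Gamma> x u (\<Gamma> x v w)) z + G x (\<Gamma> x v w) (\<Gamma> x u z) + 
    (G x (\<Gamma> x u w) (\<Gamma> x v z) + G x w (D\<Gamma> x v z u + \<Gamma> x u (\<Gamma> x v z)))" for u v
  proof -
    have "((\<lambda>y. G y (\<Gamma> y v w) z + G y w (\<Gamma> y v z)) has_derivative
      (\<lambda>u. (G x (D\<Gamma> x v w u + \<Gamma> x u (\<Gamma> x v w)) z + G x (\<Gamma> x v w) (0 + \<Gamma> x u z)) +
        (G x (0 + \<Gamma> x u w) (\<Gamma> x v z) + G x w (D\<Gamma> x v z u + \<Gamma> x u (\<Gamma> x v z))))) (at x)"
      by (intro has_derivative_add has_derivative_G D\<Gamma> x has_derivative_const)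
    then have "((\<lambda>y. DG y w z v) has_derivative
      (\<lambda>u. (G x (D\<Gamma> x v w u + \<Gamma> x u (\<Gamma> x v w)) z + G x (\<Gamma> x v w) (0 + \<Gamma> x u z)) +
        (G x (0 + \<Gamma> x u w) (\<Gamma> x v z) + G x w (D\<Gamma> x v z u + \<Gamma> x u (\<Gamma> x v z))))) (at x)"
      by (rule has_derivative_transform_within_open[OF _ open_dom x]) (simp add: metric_compatible)
    then show ?thesis using frechet_derivative_at by (metis (no_types, lifting) add_0)
  qed
  have "frechet_derivative (\<lambda>y. DG y w z v) (at x) u = frechet_derivative (\<lambda>y. DG y w z u) (at x) v"
    by (rule second_derivative_symmetric[OF open_dom x C2])
  then show ?thesis unfolding D2 R_def' by (simp add: G_simps x)
qed

lemma R_linear: 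
  assumes x: "x \<in> \<Omega>"
  shows "R x (u + u') v w = R x u v w + R x u' v w" "R x u v (w + w') = R x u v w + R x u v w'"
proof -
  have D: "D\<Gamma> x (u + u') v h = D\<Gamma> x u v h + D\<Gamma> x u' v h" for u u' v h
  proof -
    have "((\<lambda>x. \<Gamma> x (u + u') v) has_derivative (\<lambda>h. D\<Gamma> x u v h + D\<Gamma> x u' v h)) (at x)"
      by (rule has_derivative_transform_within_open[OF has_derivative_add[OF D\<Gamma> D\<Gamma>] open_dom x, OF x x])
        (simp add: \<Gamma>_simps)
    then show ?thesis by (rule frechet_derivative_eqI)
  qed
  have l: "linear (D\<Gamma> x u v)" for u v using D\<Gamma>[OF x] has_derivative_linear by blast
  show "R x (u + u') v w = R x u v w + R x u' v w"
    by (simp add: R_def' D linear_add[OF l] \<Gamma>_simps x)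
  have D': "D\<Gamma> x v (u + u') h = D\<Gamma> x v u h + D\<Gamma> x v u' h" for u u' v h
    using D D\<Gamma>_sym[OF x] by metis
  show "R x u v (w + w') = R x u v w + R x u v w'"
    by (simp add: R_def' D' \<Gamma>_simps x)
qed

lemma gram_pos:
  assumes x: "x \<in> \<Omega>" and "u \<noteq> v" "independent {u, v}"
  shows "G x u u * G x v v - (G x u v)\<^sup>2 > 0"
proof -
  have v: "v \<noteq> 0" using assms(3) by (metis dependent_zero insertI1 insertI2)
  define t where "t = G x u v / G x v v"
  have nz: "u - t *\<^sub>R v \<noteq> 0"
  proof
    assume "u - t *\<^sub>R v = 0"
    then have "u \<in> span {v}" by (auto simp: span_singleton)
    then show False using assms(2,3) by (simp add: independent_insert)
  qed
  have vv: "G x v v > 0" using pos[OF x v] .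
  have "0 < G x (u - t *\<^sub>R v) (u - t *\<^sub>R v) * G x v v"
    using pos[OF x nz] vv by simp
  also have "\<dots> = G x u u * G x v v - (G x u v)\<^sup>2"
    using vv symm[OF x, of v u] by (simp add: G_simps x t_def power2_eq_square field_simps)
  finally show ?thesis .
qed

text \<open>The difference \<open>T\<close> from the model tensor has all curvature symmetries, so
  \<open>curvature_like_zero\<close> applies once \<open>T u v v u = 0\<close>. The hypothesis gives
  this for independent pairs only; parallel and zero vectors are treated by skew-symmetry.\<close>

lemma constant_sectional_curvature:
  assumes x: "x \<in> \<Omega>" and K: "\<And>u v. u \<noteq> v \<Longrightarrow> independent {u, v} \<Longrightarrow> sectional G x u v = K"
  shows "R x u v w = K *\<^sub>R (G x v w *\<^sub>R u - G x u w *\<^sub>R v)"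
proof (rule nondegenerate[OF x])
  fix z
  define T where "T u v w z = G x (R x u v w) z - K * (G x v w * G x u z - G x u w * G x v z)" for u v w z
  have radd: "R x u (v + v') w = R x u v w + R x u v' w" for u v v' w
    using R_linear(1)[OF x] R_skew by (metis minus_add_distrib)
  have zero: "T u v v u = 0" for u v
  proof (cases "u \<noteq> v \<and> independent {u, v}")
    case True
    then have "sectional G x u v = K" "G x u u * G x v v - (G x u v)\<^sup>2 > 0" using K gram_pos[OF x] by auto
    then have "G x (R x u v v) u = K * (G x u u * G x v v - (G x u v)\<^sup>2)"
      by (simp add: sectional_def field_simps)
    then show ?thesis using symm[OF x, of v u] by (simp add: T_def power2_eq_square algebra_simps)
  next
    case False
    have Rsc: "G x (R x u v w) w = 0" for u v w using R_metric_skew[OF x, of u v w w] symm[OF x] by force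
    consider "v = 0" | c where "u = c *\<^sub>R v"
    proof (cases "v = 0")
      case False
      then have "u = v \<or> u \<in> span {v}" using \<open>\<not> (u \<noteq> v \<and> independent {u, v})\<close> using dependent_single[of v] by (simp only: independent_insert) presburger
      then show ?thesis using that(2) by (auto simp: span_singleton) (metis scaleR_one)
    qed (rule that(1))
    then show ?thesis
    proof cases
      case 1
      then show ?thesis using Rsc[of u v v] R_linear(2)[OF x, of u v v 0] by (simp add: T_def G_simps x)
    next
      case 2
      have "G x (R x u v v) u = c * G x (R x u v v) v" using 2 by (simp add: G_simps x)
      then show ?thesis using Rsc[of u v v] 2 by (simp add: T_def G_simps x)
    qed
  qed
  have "T u v w z = 0"
  proof (rule curvature_like_zero[of T])
    show "T u v w z = - T v u w z" for u v w z
      using R_skew[of x u v w] by (simp add: T_def G_simps x algebra_simps)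
    show "T u v w z = - T u v z w" for u v w z
      using R_metric_skew[OF x, of u v w z] symm[OF x] by (simp add: T_def algebra_simps)
    show "T u v w z + T v w u z + T w u v z = 0" for u v w z
    proof -
      have "G x (R x u v w) z + G x (R x v w u) z + G x (R x w u v) z = 0"
        using arg_cong[OF R_bianchi[OF x, of u v w], of "\<lambda>r. G x r z"] by (simp add: G_simps x)
      then show ?thesis using symm[OF x] by (simp add: T_def algebra_simps)
    qed
  qed (use zero in \<open>auto simp: T_def R_linear radd G_simps x algebra_simps\<close>)
  then show "G x (R x u v w) z = G x (K *\<^sub>R (G x v w *\<^sub>R u - G x u w *\<^sub>R v)) z"
    by (simp add: T_def G_simps x)
qed

text \<open>The product rule with covariant derivatives: the derivative of the coefficients of
  \<open>G\<close> is distributed over the two slots by \<open>metric_compatible\<close>.\<close>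

lemma has_derivative_G_along:
  fixes c :: "'x::real_normed_vector \<Rightarrow> 'e"
  assumes c: "(c has_derivative c') (at t)" and t: "c t \<in> \<Omega>"
    and a: "(a has_derivative a') (at t)" and b: "(b has_derivative b') (at t)"
  shows "((\<lambda>s. G (c s) (a s) (b s)) has_derivative
    (\<lambda>h. G (c t) (a' h + \<Gamma> (c t) (c' h) (a t)) (b t) + G (c t) (a t) (b' h + \<Gamma> (c t) (c' h) (b t)))) (at t)"
proof -
  obtain S where S: "open S" "t \<in> S" "\<And>s. s \<in> S \<Longrightarrow> c s \<in> \<Omega>"
    using isCont_open_preimage[OF has_derivative_continuous[OF c] t open_dom] by blast
  have D: "((\<lambda>s. G (c s) u v) has_derivative (\<lambda>h. DG (c t) u v (c' h))) (at t)" for u v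
    by (rule has_derivative_compose[OF c DG[OF t]])
  show ?thesis
    by (rule has_derivative_eq_rhs[OF has_derivative_bilinear_family[OF S(1,2) bilin[OF S(3)] D a b]])
      (auto simp: metric_compatible t G_simps)
qed

lemma has_derivative_\<Gamma>_along:
  fixes c :: "'x::real_normed_vector \<Rightarrow> 'e"
  assumes c: "(c has_derivative c') (at t)" and t: "c t \<in> \<Omega>"
    and a: "(a has_derivative a') (at t)" and b: "(b has_derivative b') (at t)"
  shows "((\<lambda>s. \<Gamma> (c s) (a s) (b s)) has_derivative
    (\<lambda>h. D\<Gamma> (c t) (a t) (b t) (c' h) + \<Gamma> (c t) (a' h) (b t) + \<Gamma> (c t) (a t) (b' h))) (at t)"
proof -
  obtain S where S: "open S" "t \<in> S" "\<And>s. s \<in> S \<Longrightarrow> c s \<in> \<Omega>"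
    using isCont_open_preimage[OF has_derivative_continuous[OF c] t open_dom] by blast
  have D: "((\<lambda>s. \<Gamma> (c s) u v) has_derivative (\<lambda>h. D\<Gamma> (c t) u v (c' h))) (at t)" for u v
    by (rule has_derivative_compose[OF c D\<Gamma>[OF t]])
  show ?thesis
    by (rule has_derivative_bilinear_family[OF S(1,2) christoffel_bilinear[OF S(3)] D a b])
qed

lemma has_vector_derivative_G_along:
  assumes "(x has_vector_derivative x') (at t)" "x t \<in> \<Omega>"
    and "(a has_vector_derivative a') (at t)" "(b has_vector_derivative b') (at t)"
  shows "((\<lambda>s. G (x s) (a s) (b s)) has_real_derivative
     G (x t) (a' + \<Gamma> (x t) x' (a t)) (b t) + G (x t) (a t) (b' + \<Gamma> (x t) x' (b t))) (at t)"
  unfolding has_field_derivative_def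
  by (rule has_derivative_eq_rhs[OF has_derivative_G_along[OF assms(1)[unfolded has_vector_derivative_def] assms(2)
        assms(3,4)[unfolded has_vector_derivative_def]]])
    (auto simp: \<Gamma>_simps G_simps assms(2) algebra_simps)

end

section \<open>Invariance under isometries\<close>

locale patch_isometry =
  source: riemannian_patch \<Omega> G + target: riemannian_patch \<Omega>' G'
  for \<Omega> :: "'e::euclidean_space set" and G and \<Omega>' :: "'e set" and G' +
  fixes \<phi> \<psi> :: "'e \<Rightarrow> 'e"
  assumes maps: "x \<in> \<Omega> \<Longrightarrow> \<phi> x \<in> \<Omega>'" "y \<in> \<Omega>' \<Longrightarrow> \<psi> y \<in> \<Omega>"
    and inverse: "x \<in> \<Omega> \<Longrightarrow> \<psi> (\<phi> x) = x" "y \<in> \<Omega>' \<Longrightarrow> \<phi> (\<psi> y) = y"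
    and \<phi>_smooth: "smooth_on \<Omega> \<phi>" and \<psi>_smooth: "smooth_on \<Omega>' \<psi>"
    and isometry: "x \<in> \<Omega> \<Longrightarrow> G x u v =
      G' (\<phi> x) (frechet_derivative \<phi> (at x) u) (frechet_derivative \<phi> (at x) v)"
begin

abbreviation P where "P x \<equiv> frechet_derivative \<phi> (at x)"
abbreviation Q where "Q y \<equiv> frechet_derivative \<psi> (at y)"
abbreviation D2 where "D2 x u \<equiv> frechet_derivative (\<lambda>y. P y u) (at x)"
abbreviation D3 where "D3 x u v \<equiv> frechet_derivative (\<lambda>y. D2 y u v) (at x)"

lemma P: "x \<in> \<Omega> \<Longrightarrow> (\<phi> has_derivative P x) (at x)"
  by (rule smooth_on_has_derivative[OF \<phi>_smooth])

lemma Q: "y \<in> \<Omega>' \<Longrightarrow> (\<psi> has_derivative Q y) (at y)"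
  by (rule smooth_on_has_derivative[OF \<psi>_smooth])

lemma P_linear: "x \<in> \<Omega> \<Longrightarrow> linear (P x)"
  using P has_derivative_linear by blast

lemmas P_simps = linear_add[OF P_linear] linear_diff[OF P_linear] linear_scale[OF P_linear] linear_neg[OF P_linear]

lemma QP: assumes x: "x \<in> \<Omega>" shows "Q (\<phi> x) (P x u) = u"
proof -
  have "((\<lambda>x. \<psi> (\<phi> x)) has_derivative (\<lambda>u. Q (\<phi> x) (P x u))) (at x)"
    by (rule has_derivative_compose[OF P[OF x] Q[OF maps(1)[OF x]]])
  then have "((\<lambda>x. x) has_derivative (\<lambda>u. Q (\<phi> x) (P x u))) (at x)"
    by (rule has_derivative_transform_within_open[OF _ source.open_dom x]) (rule inverse)
  then show ?thesis using has_derivative_unique[OF has_derivative_ident] by metis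
qed

lemma PQ: assumes x: "x \<in> \<Omega>" shows "P x (Q (\<phi> x) u) = u"
proof -
  have y: "\<phi> x \<in> \<Omega>'" using maps(1)[OF x] .
  have "(\<phi> has_derivative P x) (at (\<psi> (\<phi> x)))" using P[OF x] inverse(1)[OF x] by simp
  then have "((\<lambda>x. \<phi> (\<psi> x)) has_derivative (\<lambda>u. P x (Q (\<phi> x) u))) (at (\<phi> x))"
    by (rule has_derivative_compose[OF Q[OF y]])
  then have "((\<lambda>x. x) has_derivative (\<lambda>u. P x (Q (\<phi> x) u))) (at (\<phi> x))"
    by (rule has_derivative_transform_within_open[OF _ target.open_dom y]) (rule inverse)
  then show ?thesis using has_derivative_unique[OF has_derivative_ident] by metis
qed

lemma P_eqD: "x \<in> \<Omega> \<Longrightarrow> P x u = P x v \<Longrightarrow> u = v"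
  using QP by metis

lemma D2: "x \<in> \<Omega> \<Longrightarrow> ((\<lambda>y. P y u) has_derivative D2 x u) (at x)"
  by (rule smooth_on_has_derivative[OF smooth_on_frechet_derivative[OF \<phi>_smooth]])

lemma D3: "x \<in> \<Omega> \<Longrightarrow> ((\<lambda>y. D2 y u v) has_derivative D3 x u v) (at x)"
  by (rule smooth_on_has_derivative[OF smooth_on_frechet_derivative[OF smooth_on_frechet_derivative[OF \<phi>_smooth]]])

lemma D2_sym: "x \<in> \<Omega> \<Longrightarrow> D2 x u v = D2 x v u"
  using second_derivative_symmetric[OF source.open_dom] \<phi>_smooth unfolding smooth_on_def by blast

lemma D3_sym: "x \<in> \<Omega> \<Longrightarrow> D3 x u v w = D3 x u w v"
  using second_derivative_symmetric[OF source.open_dom] smooth_on_frechet_derivative[OF \<phi>_smooth]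
  unfolding smooth_on_def by blast

text \<open>Differentiating the isometry relation expresses the derivatives of \<open>G\<close>
  through \<open>A\<close>, which is symmetric because second derivatives of \<open>\<phi>\<close>
  commute. In the Koszul formula all terms but those with \<open>A u v\<close> then cancel.\<close>

lemma christoffel_transform:
  assumes x: "x \<in> \<Omega>"
  shows "P x (source.\<Gamma> x u v) = target.\<Gamma> (\<phi> x) (P x u) (P x v) + D2 x v u"
proof -
  have y: "\<phi> x \<in> \<Omega>'" using maps(1)[OF x] .
  define A where "A h v = D2 x v h + target.\<Gamma> (\<phi> x) (P x h) (P x v)" for h v
  have A_sym: "A h v = A v h" for h v
    unfolding A_def using D2_sym[OF x] target.christoffel_sym[OF y] by metis
  have DG: "source.DG x v w h = G' (\<phi> x) (A h v) (P x w) + G' (\<phi> x) (P x v) (A h w)" for v w h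
  proof -
    have "((\<lambda>y. G' (\<phi> y) (P y v) (P y w)) has_derivative
       (\<lambda>h. G' (\<phi> x) (A h v) (P x w) + G' (\<phi> x) (P x v) (A h w))) (at x)"
      unfolding A_def by (rule target.has_derivative_G_along[OF P[OF x] y D2[OF x] D2[OF x]])
    then have "((\<lambda>y. G y v w) has_derivative
       (\<lambda>h. G' (\<phi> x) (A h v) (P x w) + G' (\<phi> x) (P x v) (A h w))) (at x)"
      by (rule has_derivative_transform_within_open[OF _ source.open_dom x]) (simp add: isometry)
    then show ?thesis by (rule frechet_derivative_eqI)
  qed
  have "P x (source.\<Gamma> x u v) = A u v"
  proof (rule target.nondegenerate[OF y])
    fix z
    define z' where "z' = Q (\<phi> x) z"
    have z: "z = P x z'" using PQ[OF x] by (simp add: z'_def)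
    have "G' (\<phi> x) (P x (source.\<Gamma> x u v)) z = G x (source.\<Gamma> x u v) z'"
      by (simp add: isometry[OF x] z)
    also have "\<dots> = G' (\<phi> x) (A u v) z"
      unfolding source.christoffel_koszul[OF x] source.koszul_def DG z
      using A_sym[of u v] A_sym[of z' u] A_sym[of z' v] target.symm[OF y, of "P x v" "A u z'"]
         target.symm[OF y, of "P x u" "A v z'"] by simp
    finally show "G' (\<phi> x) (P x (source.\<Gamma> x u v)) z = G' (\<phi> x) (A u v) z" .
  qed
  then show ?thesis by (simp add: A_def)
qed

text \<open>Differentiate the transformation law of the Christoffel symbols and antisymmetrise in
  \<open>u\<close> and \<open>v\<close>: the third derivatives of \<open>\<phi>\<close> cancel by
  \<open>D3_sym\<close>, the second ones through the law itself.\<close>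

lemma curvature_transform:
  assumes x: "x \<in> \<Omega>"
  shows "P x (source.R x u v w) = target.R (\<phi> x) (P x u) (P x v) (P x w)"
proof -
  have y: "\<phi> x \<in> \<Omega>'" using maps(1)[OF x] .
  let ?\<Gamma> = "source.\<Gamma> x" and ?\<Gamma>' = "target.\<Gamma> (\<phi> x)"
  have eq: "D2 x (?\<Gamma> v w) u + P x (source.D\<Gamma> x v w u) =
    target.D\<Gamma> (\<phi> x) (P x v) (P x w) (P x u) + ?\<Gamma>' (D2 x v u) (P x w) + ?\<Gamma>' (P x v) (D2 x w u) + D3 x w v u" for u v w
  proof -
    have "((\<lambda>y. P y (source.\<Gamma> y v w)) has_derivative
        (\<lambda>u. D2 x (?\<Gamma> v w) u + P x (source.D\<Gamma> x v w u))) (at x)"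
      by (rule has_derivative_linear_family[OF source.open_dom x P_linear D2[OF x] source.D\<Gamma>[OF x]])
    moreover have "((\<lambda>y. target.\<Gamma> (\<phi> y) (P y v) (P y w) + D2 y w v) has_derivative
        (\<lambda>u. (target.D\<Gamma> (\<phi> x) (P x v) (P x w) (P x u) + ?\<Gamma>' (D2 x v u) (P x w) + ?\<Gamma>' (P x v) (D2 x w u)) + D3 x w v u)) (at x)"
      by (intro has_derivative_add target.has_derivative_\<Gamma>_along P D2 D3 x y)
    then have "((\<lambda>y. P y (source.\<Gamma> y v w)) has_derivative
        (\<lambda>u. (target.D\<Gamma> (\<phi> x) (P x v) (P x w) (P x u) + ?\<Gamma>' (D2 x v u) (P x w) + ?\<Gamma>' (P x v) (D2 x w u)) + D3 x w v u)) (at x)"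
      by (rule has_derivative_transform_within_open[OF _ source.open_dom x]) (simp add: christoffel_transform)
    ultimately have "(\<lambda>u. D2 x (?\<Gamma> v w) u + P x (source.D\<Gamma> x v w u)) =
        (\<lambda>u. (target.D\<Gamma> (\<phi> x) (P x v) (P x w) (P x u) + ?\<Gamma>' (D2 x v u) (P x w) + ?\<Gamma>' (P x v) (D2 x w u)) + D3 x w v u)"
      by (rule has_derivative_unique)
    from fun_cong[OF this] show ?thesis .
  qed
  have D2\<Gamma>: "D2 x (?\<Gamma> v w) u = P x (?\<Gamma> u (?\<Gamma> v w)) - ?\<Gamma>' (P x u) (?\<Gamma>' (P x v) (P x w)) - ?\<Gamma>' (P x u) (D2 x w v)" for u v w
    using christoffel_transform[OF x, of u "?\<Gamma> v w"] christoffel_transform[OF x, of v w]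
    by (simp add: target.\<Gamma>_simps y algebra_simps)
  have "P x (source.R x u v w) = P x (source.D\<Gamma> x v w u) - P x (source.D\<Gamma> x u w v) + P x (?\<Gamma> u (?\<Gamma> v w)) - P x (?\<Gamma> v (?\<Gamma> u w))"
    by (simp add: source.R_def' P_simps x)
  also have "\<dots> = target.D\<Gamma> (\<phi> x) (P x v) (P x w) (P x u) - target.D\<Gamma> (\<phi> x) (P x u) (P x w) (P x v) +
      ?\<Gamma>' (P x u) (?\<Gamma>' (P x v) (P x w)) - ?\<Gamma>' (P x v) (?\<Gamma>' (P x u) (P x w))"
    using eq[of v w u] eq[of u w v] D2_sym[OF x, of u v] D3_sym[OF x, of w u v]
    unfolding D2\<Gamma> by (simp add: algebra_simps)
  finally show ?thesis unfolding target.R_def' .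
qed

lemma constant_curvature_pullback:
  assumes x: "x \<in> \<Omega>" and "\<And>u v w. target.R (\<phi> x) u v w = K *\<^sub>R (G' (\<phi> x) v w *\<^sub>R u - G' (\<phi> x) u w *\<^sub>R v)"
  shows "source.R x u v w = K *\<^sub>R (G x v w *\<^sub>R u - G x u w *\<^sub>R v)"
  by (rule P_eqD[OF x]) (simp add: curvature_transform x assms(2) P_simps isometry)

text \<open>The hypothesis on \<open>w\<close> is \<open>\<nabla>\<^sub>u w = \<kappa> u\<close>.\<close>

lemma hessian_equation_transform:
  assumes x: "x \<in> \<Omega>" and w: "(w has_derivative (\<lambda>u. \<kappa> *\<^sub>R u - source.\<Gamma> x u (w x))) (at x)"
    and w': "\<And>y. y \<in> \<Omega> \<Longrightarrow> w' (\<phi> y) = P y (w y)"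
  shows "(w' has_derivative (\<lambda>u. \<kappa> *\<^sub>R u - target.\<Gamma> (\<phi> x) u (w' (\<phi> x)))) (at (\<phi> x))"
proof -
  have y: "\<phi> x \<in> \<Omega>'" using maps(1)[OF x] .
  have "((\<lambda>y. P y (w y)) has_derivative
      (\<lambda>u. D2 x (w x) u + P x (\<kappa> *\<^sub>R u - source.\<Gamma> x u (w x)))) (at x)"
    by (rule has_derivative_linear_family[OF source.open_dom x P_linear D2[OF x] w])
  then have "((\<lambda>y. P y (w y)) has_derivative
      (\<lambda>u. \<kappa> *\<^sub>R P x u - target.\<Gamma> (\<phi> x) (P x u) (w' (\<phi> x)))) (at (\<psi> (\<phi> x)))"
    by (simp add: P_simps x christoffel_transform w' inverse algebra_simps)
  from has_derivative_compose[OF Q[OF y] this]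
  have "((\<lambda>z. P (\<psi> z) (w (\<psi> z))) has_derivative
      (\<lambda>u. \<kappa> *\<^sub>R u - target.\<Gamma> (\<phi> x) u (w' (\<phi> x)))) (at (\<phi> x))"
    by (simp add: PQ x)
  then show ?thesis
    by (rule has_derivative_transform_within_open[OF _ target.open_dom y])
      (metis w' maps(2) inverse(2))
qed

end

section \<open>Flat connections\<close>

lemma linear_ode_bound:
  fixes e :: "real \<Rightarrow> 'v::real_normed_vector"
  assumes e: "\<And>t. t \<in> {0..1} \<Longrightarrow> (e has_vector_derivative blinfun_apply (A t) (e t) + \<rho> t) (at t within {0..1})"
    and A: "\<And>t. t \<in> {0..1} \<Longrightarrow> norm (A t) \<le> 1/2" and \<rho>: "\<And>t. t \<in> {0..1} \<Longrightarrow> norm (\<rho> t) \<le> c"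
    and "e 0 = 0" and t: "t \<in> {0..1}"
  shows "norm (e t) \<le> 2 * c"
proof -
  have cont: "continuous_on {0..1} (\<lambda>t. norm (e t))"
    using e by (intro continuous_on_norm continuous_on_vector_derivative)
  \<comment> \<open>At a maximum of the norm the mean value estimate reads
    \<open>norm (e t1) \<le> norm (e t1) / 2 + c\<close>; the bound 1/2 on \<open>A\<close> plays
    the part of Gronwall's inequality.\<close>
  obtain t1 where t1: "t1 \<in> {0..1}" "\<And>t. t \<in> {0..1} \<Longrightarrow> norm (e t) \<le> norm (e t1)"
    using continuous_attains_sup[OF compact_Icc _ cont] by auto
  have "norm (e t1 - e 0) \<le> (norm (e t1) / 2 + c) * norm (t1 - 0)"
  proof (rule differentiable_bound[of "{0..1}" e "\<lambda>t h. h *\<^sub>R (blinfun_apply (A t) (e t) + \<rho> t)"])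
    fix t :: real assume t: "t \<in> {0..1}"
    show "(e has_derivative (\<lambda>h. h *\<^sub>R (blinfun_apply (A t) (e t) + \<rho> t))) (at t within {0..1})"
      using e[OF t] by (simp add: has_vector_derivative_def)
    have "norm (blinfun_apply (A t) (e t) + \<rho> t) \<le> norm (A t) * norm (e t) + norm (\<rho> t)"
      using norm_triangle_ineq norm_blinfun order_trans by (metis add_right_mono)
    also have "\<dots> \<le> 1/2 * norm (e t1) + c"
      using A[OF t] \<rho>[OF t] t1(2)[OF t] by (intro add_mono mult_mono) auto
    finally have "norm (blinfun_apply (A t) (e t) + \<rho> t) \<le> norm (e t1) / 2 + c" by simp
    then show "onorm (\<lambda>h. h *\<^sub>R (blinfun_apply (A t) (e t) + \<rho> t)) \<le> norm (e t1) / 2 + c"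
      by (intro onorm_le) (auto simp: mult.commute[of _ "\<bar>_\<bar>"] intro!: mult_left_mono)
  qed (use t1 in auto)
  moreover have "(norm (e t1) / 2 + c) * norm (t1 - 0) \<le> norm (e t1) / 2 + c"
    using t1(1) order_trans[OF norm_ge_zero \<rho>[OF t]] by (intro mult_left_le) auto
  ultimately show ?thesis using \<open>e 0 = 0\<close> t1(2)[OF t] by simp
qed

text \<open>Picard iteration: a bound 1/2 over an interval of length 1 makes the integral operator a
  contraction at once. Clamping time yields bounded continuous functions on the line, which form a
  complete space.\<close>

lemma linear_ode_exists:
  fixes A :: "real \<Rightarrow> ('v::banach \<Rightarrow>\<^sub>L 'v)"
  assumes A: "continuous_on {0..1} A" "\<And>t. t \<in> {0..1} \<Longrightarrow> norm (A t) \<le> 1/2"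
  shows "\<exists>y. y 0 = v0 \<and> (\<forall>t\<in>{0..1}. (y has_vector_derivative blinfun_apply (A t) (y t)) (at t within {0..1}))"
proof -
  define c where "c t = max 0 (min 1 t)" for t :: real
  have c: "c t \<in> {0..1}" "t \<in> {0..1} \<Longrightarrow> c t = t" for t by (auto simp: c_def)
  have contc: "continuous_on UNIV c" unfolding c_def by (intro continuous_intros)
  define T where "T y t = v0 + integral {0..c t} (\<lambda>s. blinfun_apply (A s) (apply_bcontfun y s))" for y :: "real \<Rightarrow>\<^sub>C 'v" and t
  have cont: "continuous_on {0..1} (\<lambda>s. blinfun_apply (A s) (apply_bcontfun y s))" for y :: "real \<Rightarrow>\<^sub>C 'v"
    by (intro bounded_bilinear.continuous_on[OF bounded_bilinear_blinfun_apply] A(1)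
        continuous_on_apply_bcontfun continuous_on_id)
  have int: "(\<lambda>s. blinfun_apply (A s) (apply_bcontfun y s)) integrable_on {0..c t}" for y t
    by (rule integrable_continuous_real[OF continuous_on_subset[OF cont]]) (use c(1)[of t] in auto)
  have bc: "T y \<in> bcontfun" for y
  proof -
    have "continuous_on {0..1} (\<lambda>t. v0 + integral {0..t} (\<lambda>s. blinfun_apply (A s) (apply_bcontfun y s)))"
      by (intro continuous_intros indefinite_integral_continuous_1 integrable_continuous_real cont)
    then have 1: "continuous_on UNIV (T y)"
      unfolding T_def by (rule continuous_on_compose2[OF _ contc]) (use c in auto)
    have "compact (T y ` {0..1})" by (rule compact_continuous_image[OF continuous_on_subset[OF 1]]) auto
    moreover have "range (T y) = T y ` {0..1}"
      unfolding T_def using c by (auto simp: image_iff) (metis c)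
    ultimately show ?thesis using 1 by (simp add: bcontfun_def compact_imp_bounded)
  qed
  have "dist (Bcontfun (T y)) (Bcontfun (T z)) \<le> 1/2 * dist y z" for y z
  proof (rule dist_bound)
    fix t
    have "T y t - T z t = integral {0..c t} (\<lambda>s. blinfun_apply (A s) (apply_bcontfun y s) - blinfun_apply (A s) (apply_bcontfun z s))"
      unfolding T_def using integral_diff[OF int[of y t] int[of z t]] by simp
    also have "norm \<dots> \<le> (1/2 * dist y z) * (c t - 0)"
    proof (rule integral_bound)
      show "norm (blinfun_apply (A s) (apply_bcontfun y s) - blinfun_apply (A s) (apply_bcontfun z s)) \<le> 1/2 * dist y z" if "s \<in> {0..c t}" for s
      proof -
        have "norm (blinfun_apply (A s) (apply_bcontfun y s) - blinfun_apply (A s) (apply_bcontfun z s)) \<le> norm (A s) * norm (apply_bcontfun y s - apply_bcontfun z s)"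
          using norm_blinfun[of "A s" "apply_bcontfun y s - apply_bcontfun z s"] by (simp add: blinfun.diff_right)
        also have "\<dots> \<le> 1/2 * dist y z"
          using A(2)[of s] that c(1)[of t] dist_bounded[of y s z] by (intro mult_mono) (auto simp: dist_norm)
        finally show ?thesis .
      qed
      show "continuous_on {0..c t} (\<lambda>s. blinfun_apply (A s) (apply_bcontfun y s) - blinfun_apply (A s) (apply_bcontfun z s))"
        by (rule continuous_on_subset[OF continuous_on_diff[OF cont cont]]) (use c(1)[of t] in auto)
    qed (use c(1)[of t] in auto)
    also have "\<dots> \<le> 1/2 * dist y z" using c(1)[of t] by (simp add: mult_left_le)
    finally show "dist (apply_bcontfun (Bcontfun (T y)) t) (apply_bcontfun (Bcontfun (T z)) t) \<le> 1/2 * dist y z"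
      by (simp add: Bcontfun_inverse[OF bc] dist_norm)
  qed
  then obtain y where "Bcontfun (T y) = y" using banach_fix_type[of "1/2" "\<lambda>y. Bcontfun (T y)"] by auto
  then have y: "apply_bcontfun y = T y" using Bcontfun_inverse[OF bc] by metis
  have yt: "apply_bcontfun y t = v0 + integral {0..t} (\<lambda>s. blinfun_apply (A s) (apply_bcontfun y s))" if "t \<in> {0..1}" for t
    by (subst y) (simp add: T_def c(2)[OF that])
  have "(apply_bcontfun y has_vector_derivative blinfun_apply (A t) (apply_bcontfun y t)) (at t within {0..1})" if "t \<in> {0..1}" for t
  proof -
    have "((\<lambda>t. v0 + integral {0..t} (\<lambda>s. blinfun_apply (A s) (apply_bcontfun y s))) has_vector_derivative
        0 + blinfun_apply (A t) (apply_bcontfun y t)) (at t within {0..1})"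
      by (intro has_vector_derivative_add has_vector_derivative_const integral_has_vector_derivative cont that)
    then have "((\<lambda>t. v0 + integral {0..t} (\<lambda>s. blinfun_apply (A s) (apply_bcontfun y s))) has_vector_derivative
        blinfun_apply (A t) (apply_bcontfun y t)) (at t within {0..1})"
      by simp
    from has_vector_derivative_transform[OF that _ this] show ?thesis
      using yt by simp
  qed
  moreover have "apply_bcontfun y 0 = v0" by (simp add: yt)
  ultimately show ?thesis by blast
qed

section \<open>Parallel sections of a flat connection\<close>

locale flat_connection =
  fixes \<Omega> :: "'e::euclidean_space set" and B :: "'e \<Rightarrow> 'e \<Rightarrow>\<^sub>L ('v::banach \<Rightarrow>\<^sub>L 'v)"
    and B' :: "'e \<Rightarrow> 'e \<Rightarrow> 'e \<Rightarrow>\<^sub>L ('v \<Rightarrow>\<^sub>L 'v)"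
  assumes open_dom: "open \<Omega>"
    and B: "x \<in> \<Omega> \<Longrightarrow> (B has_derivative B' x) (at x)"
    and B'_cont: "continuous_on \<Omega> (\<lambda>x. B' x h)"
    and flat: "x \<in> \<Omega> \<Longrightarrow> B' x u v s - B' x v u s + B x u (B x v s) - B x v (B x u s) = 0"
begin

definition flat_at :: "('e \<Rightarrow> 'v) \<Rightarrow> 'e \<Rightarrow> bool" where
  "flat_at s x \<longleftrightarrow> (s has_derivative (\<lambda>u. - B x u (s x))) (at x)"

lemma B'_linear: "x \<in> \<Omega> \<Longrightarrow> linear (B' x)"
  using B has_derivative_linear by blast

lemma B_cont: "continuous_on \<Omega> B"
  using B has_derivative_continuous continuous_at_imp_continuous_on by blast

lemma B'_diff_le:
  assumes "x \<in> \<Omega>" "y \<in> \<Omega>"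
  shows "norm (B' x h - B' y h) \<le> (\<Sum>b\<in>Basis. norm (B' x b - B' y b)) * norm h"
proof -
  have l: "linear (\<lambda>h. B' x h - B' y h)" using B'_linear assms by (auto intro: linear_compose_sub)
  have "B' x h - B' y h = (\<Sum>b\<in>Basis. (h \<bullet> b) *\<^sub>R (B' x b - B' y b))"
    using linear_sum[OF l, of "\<lambda>b. (h \<bullet> b) *\<^sub>R b" Basis] linear_scale[OF l]
    by (simp add: euclidean_representation)
  also have "norm \<dots> \<le> (\<Sum>b\<in>Basis. norm h * norm (B' x b - B' y b))"
    by (intro sum_norm_le) (auto intro!: mult_right_mono Basis_le_norm)
  finally show ?thesis by (simp add: sum_distrib_left mult.commute)
qed

lemma B'_le:
  assumes "x \<in> \<Omega>"
  shows "norm (B' x h) \<le> (\<Sum>b\<in>Basis. norm (B' x b)) * norm h"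
proof -
  have l: "linear (B' x)" using B'_linear assms by auto
  have "B' x h = (\<Sum>b\<in>Basis. (h \<bullet> b) *\<^sub>R B' x b)"
    using linear_sum[OF l, of "\<lambda>b. (h \<bullet> b) *\<^sub>R b" Basis] linear_scale[OF l]
    by (simp add: euclidean_representation)
  also have "norm \<dots> \<le> (\<Sum>b\<in>Basis. norm h * norm (B' x b))"
    by (intro sum_norm_le) (auto intro!: mult_right_mono Basis_le_norm)
  finally show ?thesis by (simp add: sum_distrib_left mult.commute)
qed

lemma bounds:
  assumes K: "compact K" "K \<subseteq> \<Omega>"
  obtains M where "M \<ge> 0" "\<And>z. z \<in> K \<Longrightarrow> norm (B z) \<le> M" "\<And>z h. z \<in> K \<Longrightarrow> norm (B' z h) \<le> M * norm h"
proof -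
  have "bounded (B ` K)" "bounded ((\<lambda>z. \<Sum>b\<in>Basis. norm (B' z b)) ` K)"
    using K B_cont B'_cont
    by (auto intro!: compact_imp_bounded compact_continuous_image continuous_intros intro: continuous_on_subset)
  then obtain M1 M2 where M: "\<And>z. z \<in> K \<Longrightarrow> norm (B z) \<le> M1" "\<And>z. z \<in> K \<Longrightarrow> norm (\<Sum>b\<in>Basis. norm (B' z b)) \<le> M2"
    unfolding bounded_iff by blast
  have "norm (B' z h) \<le> max 0 (max M1 M2) * norm h" if "z \<in> K" for z h
  proof -
    have "norm (B' z h) \<le> (\<Sum>b\<in>Basis. norm (B' z b)) * norm h" using B'_le K that by blast
    also have "\<dots> \<le> max 0 (max M1 M2) * norm h"
      using M(2)[OF that] by (intro mult_right_mono) (auto simp: real_norm_def)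
    finally show ?thesis .
  qed
  moreover have "norm (B z) \<le> max 0 (max M1 M2)" if "z \<in> K" for z using M(1)[OF that] by auto
  ultimately show ?thesis using that[of "max 0 (max M1 M2)"] by auto
qed

text \<open>Uniform continuity of \<open>B'\<close> on a compact set gives one
  \<open>\<delta>\<close> for all base points; the error in \<open>flat_section_exists\<close> has
  to be controlled along a whole ray at once.\<close>

lemma uniform_differentiability:
  assumes K: "compact K" "convex K" "K \<subseteq> \<Omega>" and "\<epsilon> > 0"
  obtains \<delta> where "\<delta> > 0" "\<And>z z'. z \<in> K \<Longrightarrow> z' \<in> K \<Longrightarrow> norm (z' - z) < \<delta> \<Longrightarrow>
    norm (B z' - B z - B' z (z' - z)) \<le> \<epsilon> * norm (z' - z)"
proof -
  define N where "N = real (card (Basis :: 'e set))"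
  have N: "N > 0" unfolding N_def by simp
  have "\<exists>\<delta>>0. \<forall>x\<in>K. \<forall>y\<in>K. dist x y < \<delta> \<longrightarrow> dist (B' x b) (B' y b) < \<epsilon> / N" for b
    using compact_uniformly_continuous[OF continuous_on_subset[OF B'_cont K(3)] K(1), of b] \<open>\<epsilon> > 0\<close> N
    unfolding uniformly_continuous_on_def by (metis dist_commute divide_pos_pos)
  then obtain \<delta> where \<delta>: "\<And>b. \<delta> b > 0" "\<And>b x y. x \<in> K \<Longrightarrow> y \<in> K \<Longrightarrow> dist x y < \<delta> b \<Longrightarrow> dist (B' x b) (B' y b) < \<epsilon> / N"
    by metis
  define d where "d = Min (\<delta> ` Basis)"
  have d: "d > 0" "\<And>b. b \<in> Basis \<Longrightarrow> d \<le> \<delta> b" unfolding d_def using \<delta>(1) by auto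
  have "norm (B z' - B z - B' z (z' - z)) \<le> norm (z' - z) * \<epsilon>" if z: "z \<in> K" "z' \<in> K" "norm (z' - z) < d" for z z'
  proof (rule differentiable_bound_linearization[of z z' "closed_segment z z'" B B' z])
    have sub: "closed_segment z z' \<subseteq> K" using z K(2) by (simp add: closed_segment_subset)
    show "z + t *\<^sub>R (z' - z) \<in> closed_segment z z'" if "t \<in> {0..1}" for t
      using that unfolding closed_segment_def by (auto intro!: exI[of _ t] simp: algebra_simps)
    show "(B has_derivative B' x) (at x within closed_segment z z')" if "x \<in> closed_segment z z'" for x
      using B sub K(3) that by (blast intro: has_derivative_at_withinI)
    show "onorm (B' x - B' z) \<le> \<epsilon>" if x: "x \<in> closed_segment z z'" for x
    proof (rule onorm_bound)
      fix h :: 'e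
      have "norm (B' x b - B' z b) \<le> \<epsilon> / N" if b: "b \<in> Basis" for b
      proof -
        have "dist x z \<le> dist z z'" using x dist_in_closed_segment(1)[OF x] by (simp add: dist_commute)
        then have "dist x z < \<delta> b" using z(3) d(2)[OF b] by (simp add: dist_norm norm_minus_commute)
        then show ?thesis using \<delta>(2)[of x z b] sub x z(1) by (force simp: dist_norm)
      qed
      then have "(\<Sum>b\<in>Basis. norm (B' x b - B' z b)) \<le> (\<Sum>b\<in>(Basis :: 'e set). \<epsilon> / N)" by (intro sum_mono) auto
      then have "(\<Sum>b\<in>Basis. norm (B' x b - B' z b)) \<le> \<epsilon>" using N by (simp add: N_def)
      then have "(\<Sum>b\<in>Basis. norm (B' x b - B' z b)) * norm h \<le> \<epsilon> * norm h" by (intro mult_right_mono) auto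
      then show "norm ((B' x - B' z) h) \<le> \<epsilon> * norm h"
        using order_trans[OF B'_diff_le[of x z h]] sub x z(1) K(3) by (simp add: subset_iff)
    qed (use \<open>\<epsilon> > 0\<close> in simp)
  qed simp
  then show ?thesis using that[OF d(1)] by (simp add: mult.commute)
qed

lemma lipschitz:
  assumes "convex K" "K \<subseteq> \<Omega>" "\<And>z h. z \<in> K \<Longrightarrow> norm (B' z h) \<le> M * norm h" "M \<ge> 0" "z \<in> K" "z' \<in> K"
  shows "norm (B z' - B z) \<le> M * norm (z' - z)"
  by (rule differentiable_bound[of K B B'])
    (use assms in \<open>auto intro!: onorm_bound has_derivative_at_withinI[OF B]\<close>)

text \<open>The section with value \<open>v0\<close> at \<open>x0\<close> is defined by parallel transport along the rays from
  \<open>x0\<close>. With \<open>z = x0 + t d\<close>, the function \<open>e t = Y\<^bsub>x + u\<^esub> t - Y\<^bsub>x\<^esub> t + t B z u (Y\<^bsub>x\<^esub> t)\<close> solves a linear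
  equation whose inhomogeneity is \<open>o(u)\<close> exactly because the curvature vanishes.\<close>

lemma flat_section_exists:
  assumes r: "r > 0" and K: "cball q r \<subseteq> \<Omega>" and small: "\<And>z. z \<in> cball q r \<Longrightarrow> norm (B z) * (2 * r) \<le> 1/2"
    and x0: "x0 \<in> ball q r"
  shows "\<exists>s. s x0 = v0 \<and> (\<forall>x\<in>ball q r. flat_at s x)"
proof -
  have dist_le: "norm (x - x0) \<le> 2 * r" if "x \<in> cball q r" for x
    using that x0 norm_triangle_ineq4[of "x - q" "x0 - q"] by (auto simp: dist_norm norm_minus_commute)
  have ray: "x0 + t *\<^sub>R (x - x0) \<in> cball q r" if "x \<in> cball q r" "t \<in> {0..1}" for x t
    using convexD_alt[of "cball q r" x0 x t] that x0 by (auto simp: algebra_simps)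
  define A where "A x t = - blinfun_apply (B (x0 + t *\<^sub>R (x - x0))) (x - x0)" for x t
  have A_le: "norm (A x t) \<le> 1/2" if "x \<in> cball q r" "t \<in> {0..1}" for x t
  proof -
    have "norm (A x t) \<le> norm (B (x0 + t *\<^sub>R (x - x0))) * norm (x - x0)" unfolding A_def using norm_blinfun by simp
    also have "\<dots> \<le> norm (B (x0 + t *\<^sub>R (x - x0))) * (2 * r)" using dist_le that by (intro mult_left_mono) auto
    finally show ?thesis using small[OF ray[OF that]] by linarith
  qed
  have A_cont: "continuous_on {0..1} (A x)" if "x \<in> cball q r" for x
    unfolding A_def using ray[OF that] K
    by (intro continuous_intros continuous_on_compose2[OF B_cont]) auto
  have "\<exists>y. y 0 = v0 \<and> (\<forall>t\<in>{0..1}. (y has_vector_derivative A x t (y t)) (at t within {0..1}))"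
    if "x \<in> cball q r" for x
    by (rule linear_ode_exists[OF A_cont[OF that] A_le[OF that]])
  then obtain Y where Y: "\<And>x. x \<in> cball q r \<Longrightarrow> Y x 0 = v0"
    "\<And>x t. x \<in> cball q r \<Longrightarrow> t \<in> {0..1} \<Longrightarrow> (Y x has_vector_derivative A x t (Y x t)) (at t within {0..1})"
    by metis
  obtain M where M: "M \<ge> 0" "\<And>z. z \<in> cball q r \<Longrightarrow> norm (B z) \<le> M" "\<And>z h. z \<in> cball q r \<Longrightarrow> norm (B' z h) \<le> M * norm h"
    using bounds[OF compact_cball K] by blast
  have "flat_at (\<lambda>x. Y x 1) x" if x: "x \<in> ball q r" for x
  proof -
    have xc: "x \<in> cball q r" using x by auto
    define d where "d = x - x0"
    have "continuous_on {0..1} (Y x)" using Y(2)[OF xc] by (rule continuous_on_vector_derivative)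
    then have "bounded (Y x ` {0..1})" by (intro compact_imp_bounded compact_continuous_image) auto
    then obtain N where "\<forall>y\<in>Y x ` {0..1}. norm y \<le> N" unfolding bounded_iff by blast
    then have N: "norm (Y x t) \<le> N" if "t \<in> {0..1}" for t using that by blast
    have N0: "N \<ge> 0" using N[of 0] norm_ge_zero order_trans by (metis atLeastAtMost_iff order_refl zero_le_one)
    have key: "norm (Y (x + u) 1 - Y x 1 + B x u (Y x 1)) \<le> 2 * ((2 * r * \<epsilon> + (M + M * M * (2 * r + 1)) * norm u) * norm u * N)"
      if u: "x + u \<in> cball q r" and \<epsilon>: "\<epsilon> > 0" and
        rem: "\<And>z z'. z \<in> cball q r \<Longrightarrow> z' \<in> cball q r \<Longrightarrow> norm (z' - z) \<le> norm u \<Longrightarrow>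
           norm (B z' - B z - B' z (z' - z)) \<le> \<epsilon> * norm (z' - z)" for u \<epsilon>
    proof -
      define z where "z t = x0 + t *\<^sub>R d" for t
      define z' where "z' t = x0 + t *\<^sub>R (d + u)" for t
      have z: "z t \<in> cball q r" "z' t \<in> cball q r" if "t \<in> {0..1}" for t
        using ray[OF xc that] ray[OF u that] unfolding z_def z'_def d_def by (simp_all add: algebra_simps)
      have Az: "A x t = - B (z t) d" "A (x + u) t = - B (z' t) (d + u)" for t
        unfolding A_def z_def z'_def d_def by (simp_all add: algebra_simps)
      define e where "e t = Y (x + u) t - Y x t + t *\<^sub>R B (z t) u (Y x t)" for t
      \<comment> \<open>The first term is a Taylor remainder of \<open>B\<close>, at most a multiple
        of \<open>\<epsilon> * norm u\<close>; the other two are quadratic in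
        \<open>u\<close>.\<close>
      define \<rho> where "\<rho> t = - (B (z' t) - B (z t) - t *\<^sub>R B' (z t) u) (d + u) (Y x t) - t *\<^sub>R B' (z t) u u (Y x t)
         + t *\<^sub>R (B (z' t) (d + u) - B (z t) d) (B (z t) u (Y x t))" for t
      have "norm (e 1) \<le> 2 * ((2 * r * \<epsilon> + (M + M * M * (2 * r + 1)) * norm u) * norm u * N)"
      proof (rule linear_ode_bound)
        fix t :: real assume t: "t \<in> {0..1}"
        have zO: "z t \<in> \<Omega>" using z(1)[OF t] K by auto
        have zd: "(z has_derivative (\<lambda>h. h *\<^sub>R d)) (at t within {0..1})"
          unfolding z_def by (auto intro!: derivative_eq_intros)
        have "((\<lambda>t. B (z t)) has_derivative (\<lambda>h. B' (z t) (h *\<^sub>R d))) (at t within {0..1})"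
          by (rule has_derivative_compose[OF zd B[OF zO]])
        then have "((\<lambda>t. B (z t)) has_vector_derivative B' (z t) d) (at t within {0..1})"
          by (simp add: has_vector_derivative_def linear_scale[OF B'_linear[OF zO]])
        then have "((\<lambda>t. B (z t) u) has_vector_derivative B' (z t) d u) (at t within {0..1})"
          by (rule bounded_linear.has_vector_derivative[OF blinfun.bounded_linear_left])
        then have "(e has_vector_derivative A (x + u) t (Y (x + u) t) - A x t (Y x t)
            + (t *\<^sub>R (B (z t) u (A x t (Y x t)) + B' (z t) d u (Y x t)) + 1 *\<^sub>R B (z t) u (Y x t))) (at t within {0..1})"
          unfolding e_def
          by (intro derivative_intros bounded_bilinear.has_vector_derivative[OF bounded_bilinear_blinfun_apply] Y(2) xc u t)
        moreover have "A (x + u) t (Y (x + u) t) - A x t (Y x t)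
            + (t *\<^sub>R (B (z t) u (A x t (Y x t)) + B' (z t) d u (Y x t)) + 1 *\<^sub>R B (z t) u (Y x t)) = A (x + u) t (e t) + \<rho> t"
        proof -
          \<comment> \<open>Flatness exchanges the derivative of \<open>B u\<close> along the ray
            for the derivative of \<open>B d\<close> in direction \<open>u\<close>, which is what
            the Taylor remainder in \<open>\<rho>\<close> requires.\<close>
          have fl: "t *\<^sub>R (B' (z t) d u (Y x t)) = t *\<^sub>R (B' (z t) u d (Y x t)) - t *\<^sub>R (B (z t) d (B (z t) u (Y x t))) + t *\<^sub>R (B (z t) u (B (z t) d (Y x t)))"
            using flat[OF zO, of d u "Y x t"] by (simp add: algebra_simps flip: scaleR_add_right scaleR_diff_right)
          show ?thesis unfolding e_def \<rho>_def Az
            by (simp add: fl blinfun.bilinear_simps algebra_simps)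
        qed
        ultimately show "(e has_vector_derivative A (x + u) t (e t) + \<rho> t) (at t within {0..1})" by simp
        show "norm (A (x + u) t) \<le> 1/2" by (rule A_le[OF u t])
        have zz: "z' t - z t = t *\<^sub>R u" unfolding z_def z'_def by (simp add: algebra_simps)
        have tu: "norm (t *\<^sub>R u) \<le> norm u" using t by (simp add: mult_left_le_one_le)
        have du: "norm (d + u) \<le> 2 * r" "norm d \<le> 2 * r"
          using dist_le[OF u] dist_le[OF xc] unfolding d_def by (simp_all add: algebra_simps)
        have Yt: "norm (Y x t) \<le> N" using N[OF t] .
        have n1: "norm ((B (z' t) - B (z t) - t *\<^sub>R B' (z t) u) (d + u) (Y x t)) \<le> \<epsilon> * norm u * (2 * r) * N"
        proof -
          have "norm (B (z' t) - B (z t) - t *\<^sub>R B' (z t) u) \<le> \<epsilon> * norm (t *\<^sub>R u)"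
            using rem[OF z[OF t]] tu unfolding zz by (simp add: linear_scale[OF B'_linear[OF zO]])
          also have "\<dots> \<le> \<epsilon> * norm u" using tu \<epsilon> by (intro mult_left_mono) auto
          finally have 1: "norm (B (z' t) - B (z t) - t *\<^sub>R B' (z t) u) \<le> \<epsilon> * norm u" .
          have "norm ((B (z' t) - B (z t) - t *\<^sub>R B' (z t) u) (d + u) (Y x t)) \<le>
             norm (B (z' t) - B (z t) - t *\<^sub>R B' (z t) u) * norm (d + u) * norm (Y x t)"
            by (meson norm_blinfun order_trans mult_right_mono norm_ge_zero)
          also have "\<dots> \<le> \<epsilon> * norm u * (2 * r) * N"
            using 1 du(1) Yt \<epsilon> r by (intro mult_mono) auto
          finally show ?thesis .
        qed
        have n2: "norm (t *\<^sub>R B' (z t) u u (Y x t)) \<le> M * norm u * norm u * N"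
        proof -
          have "norm (t *\<^sub>R B' (z t) u u (Y x t)) \<le> norm (B' (z t) u u (Y x t))"
            using t by (simp add: mult_left_le_one_le)
          also have "\<dots> \<le> norm (B' (z t) u) * norm u * norm (Y x t)"
            by (meson norm_blinfun order_trans mult_right_mono norm_ge_zero)
          also have "\<dots> \<le> M * norm u * norm u * N"
            using M(3)[OF z(1)[OF t], of u] Yt M(1) by (intro mult_mono) auto
          finally show ?thesis .
        qed
        have n3: "norm (t *\<^sub>R (B (z' t) (d + u) - B (z t) d) (B (z t) u (Y x t))) \<le> (M * (2 * r + 1) * norm u) * (M * norm u * N)"
        proof -
          have "B (z' t) (d + u) - B (z t) d = (B (z' t) - B (z t)) (d + u) + B (z t) u"
            by (simp add: blinfun.bilinear_simps)
          also have "norm \<dots> \<le> norm (B (z' t) - B (z t)) * norm (d + u) + norm (B (z t)) * norm u"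
            by (intro order_trans[OF norm_triangle_ineq] add_mono norm_blinfun)
          also have "\<dots> \<le> (M * norm u) * (2 * r) + M * norm u"
            using lipschitz[OF convex_cball K M(3,1) z[OF t]] tu du(1) M(1) M(2)[OF z(1)[OF t]] r
            unfolding zz by (intro add_mono mult_mono) (auto intro: order_trans mult_left_mono)
          finally have 1: "norm (B (z' t) (d + u) - B (z t) d) \<le> M * (2 * r + 1) * norm u" by (simp add: algebra_simps)
          have 2: "norm (B (z t) u (Y x t)) \<le> M * norm u * N"
          proof -
            have "norm (B (z t) u (Y x t)) \<le> norm (B (z t)) * norm u * norm (Y x t)"
              by (meson norm_blinfun order_trans mult_right_mono norm_ge_zero)
            also have "\<dots> \<le> M * norm u * N" using M(1) M(2)[OF z(1)[OF t]] Yt by (intro mult_mono) auto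
            finally show ?thesis .
          qed
          have "norm (t *\<^sub>R (B (z' t) (d + u) - B (z t) d) (B (z t) u (Y x t))) \<le> norm ((B (z' t) (d + u) - B (z t) d) (B (z t) u (Y x t)))"
            using t by (simp add: mult_left_le_one_le)
          also have "\<dots> \<le> norm (B (z' t) (d + u) - B (z t) d) * norm (B (z t) u (Y x t))" by (rule norm_blinfun)
          also have "\<dots> \<le> (M * (2 * r + 1) * norm u) * (M * norm u * N)"
            using 1 2 M(1) r by (intro mult_mono) auto
          finally show ?thesis .
        qed
        have "norm (\<rho> t) \<le> \<epsilon> * norm u * (2 * r) * N + M * norm u * norm u * N + (M * (2 * r + 1) * norm u) * (M * norm u * N)"
          unfolding \<rho>_def using n1 n2 n3
          by (intro order_trans[OF norm_triangle_ineq] add_mono order_trans[OF norm_triangle_ineq4]) auto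
        also have "\<dots> = (2 * r * \<epsilon> + (M + M * M * (2 * r + 1)) * norm u) * norm u * N" by (simp add: algebra_simps)
        finally show "norm (\<rho> t) \<le> (2 * r * \<epsilon> + (M + M * M * (2 * r + 1)) * norm u) * norm u * N" .
      qed (use Y(1) xc u in \<open>auto simp: e_def\<close>)
      then show ?thesis by (simp add: e_def z_def d_def)
    qed
    show ?thesis unfolding flat_at_def has_derivative_at'
    proof (intro conjI allI impI)
      show "bounded_linear (\<lambda>u. - B x u (Y x 1))"
        by (intro bounded_linear_minus bounded_linear_compose[OF blinfun.bounded_linear_left blinfun.bounded_linear_right])
      fix \<eta> :: real assume \<eta>: "\<eta> > 0"
      \<comment> \<open>With this \<open>\<epsilon>\<close> the Taylor part of the bound is at most
        \<open>\<eta> / 2\<close>; the radius \<open>D\<close> below makes the quadratic part less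
        than \<open>\<eta> / 2\<close>. The summands 1 keep the denominators positive.\<close>
      define \<epsilon> where "\<epsilon> = \<eta> / (8 * r * (N + 1))"
      define C where "C = M + M * M * (2 * r + 1)"
      have \<epsilon>: "\<epsilon> > 0" unfolding \<epsilon>_def using \<eta> r N0 by simp
      have C: "C \<ge> 0" unfolding C_def using M(1) r by simp
      obtain \<delta> where \<delta>: "\<delta> > 0" "\<And>z z'. z \<in> cball q r \<Longrightarrow> z' \<in> cball q r \<Longrightarrow> norm (z' - z) < \<delta> \<Longrightarrow>
        norm (B z' - B z - B' z (z' - z)) \<le> \<epsilon> * norm (z' - z)"
        using uniform_differentiability[OF compact_cball convex_cball K \<epsilon>] by blast
      obtain \<delta>' where \<delta>': "\<delta>' > 0" "ball x \<delta>' \<subseteq> ball q r" using x open_ball open_contains_ball by blast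
      define D where "D = min (min \<delta> \<delta>') (\<eta> / (8 * (C + 1) * (N + 1)))"
      have D: "D > 0" unfolding D_def using \<delta>(1) \<delta>'(1) \<eta> C N0 by simp
      show "\<exists>d>0. \<forall>x'. 0 < norm (x' - x) \<and> norm (x' - x) < d \<longrightarrow>
          norm (Y x' 1 - Y x 1 - - B x (x' - x) (Y x 1)) / norm (x' - x) < \<eta>"
      proof (intro exI[of _ D] conjI allI impI D)
        fix x' assume x': "0 < norm (x' - x) \<and> norm (x' - x) < D"
        define u where "u = x' - x"
        have u: "norm u > 0" "norm u < \<delta>" "norm u < \<delta>'" "norm u < \<eta> / (8 * (C + 1) * (N + 1))"
          using x' unfolding u_def D_def by auto
        have "x + u \<in> ball x \<delta>'" using u(3) by (simp add: dist_norm)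
        then have "x + u \<in> cball q r" using \<delta>'(2) ball_subset_cball by blast
        then have "norm (Y (x + u) 1 - Y x 1 + B x u (Y x 1)) \<le> 2 * ((2 * r * \<epsilon> + C * norm u) * norm u * N)"
          unfolding C_def by (rule key[OF _ \<epsilon>]) (use \<delta>(2) u(2) in auto)
        also have "\<dots> = (4 * r * \<epsilon> * N + 2 * C * norm u * N) * norm u" by (simp add: algebra_simps)
        also have "\<dots> < \<eta> * norm u"
        proof (rule mult_strict_right_mono[OF _ u(1)])
          have "4 * r * \<epsilon> * N = \<eta> / 2 * (N / (N + 1))" 
          proof -
            have "8 * r * (N + 1) > 0" using r N0 by simp
            then show ?thesis unfolding \<epsilon>_def using N0 r by (simp add: divide_simps)
          qed
          also have "\<dots> \<le> \<eta> / 2 * 1" using \<eta> N0 by (intro mult_left_mono) auto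
          finally have 1: "4 * r * \<epsilon> * N \<le> \<eta> / 2" by simp
          have "2 * C * norm u * N \<le> 2 * (C + 1) * norm u * (N + 1)"
            using C N0 by (intro mult_mono) auto
          also have "\<dots> < \<eta> / 2"
          proof -
            have "8 * (C + 1) * (N + 1) > 0" using C N0 by simp
            with u(4) have "norm u * (8 * (C + 1) * (N + 1)) < \<eta>" by (simp only: pos_less_divide_eq)
            then have "4 * (2 * (C + 1) * norm u * (N + 1)) < \<eta>" by (simp add: mult_ac)
            then show ?thesis using \<eta> by linarith
          qed
          finally show "4 * r * \<epsilon> * N + 2 * C * norm u * N < \<eta>" using 1 by simp
        qed
        finally show "norm (Y x' 1 - Y x 1 - - B x (x' - x) (Y x 1)) / norm (x' - x) < \<eta>"
          using u(1) by (simp add: u_def field_simps)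
      qed
    qed
  qed
  moreover have "Y x0 1 = v0"
  proof -
    have xc: "x0 \<in> cball q r" using x0 by auto
    have "norm (Y x0 1 - v0) \<le> 2 * 0"
      by (rule linear_ode_bound[where e = "\<lambda>t. Y x0 t - v0" and A = "A x0" and \<rho> = "\<lambda>_. 0"])
        (use Y[OF xc] in \<open>auto simp: A_def blinfun.bilinear_simps intro!: derivative_eq_intros\<close>)
    then show ?thesis by simp
  qed
  ultimately show ?thesis by (intro exI[of _ "\<lambda>x. Y x 1"]) auto
qed

text \<open>Along a ray from the centre the difference of two sections solves the homogeneous linear
  equation with initial value 0, so the bound with \<open>c = 0\<close> kills it.\<close>

lemma flat_section_unique_ball:
  assumes r: "r > 0" and K: "cball q r \<subseteq> \<Omega>" and small: "\<And>z. z \<in> cball q r \<Longrightarrow> norm (B z) * r \<le> 1/2"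
    and s: "\<And>x. x \<in> ball q r \<Longrightarrow> flat_at s x" "\<And>x. x \<in> ball q r \<Longrightarrow> flat_at s' x" and eq: "s q = s' q"
    and x: "x \<in> ball q r"
  shows "s x = s' x"
proof -
  define d where "d = x - q"
  define z where "z t = q + t *\<^sub>R d" for t
  have z: "z t \<in> ball q r" if "t \<in> {0..1}" for t
  proof -
    have "\<bar>t\<bar> * norm d \<le> 1 * norm d" using that by (intro mult_right_mono) auto
    then show ?thesis using x by (simp add: z_def d_def dist_norm norm_minus_commute)
  qed
  have "norm (s (z 1) - s' (z 1)) \<le> 2 * 0"
  proof (rule linear_ode_bound[where e = "\<lambda>t. s (z t) - s' (z t)" and A = "\<lambda>t. - B (z t) d" and \<rho> = "\<lambda>_. 0"])
    fix t :: real assume t: "t \<in> {0..1}"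
    have zd: "(z has_derivative (\<lambda>h. h *\<^sub>R d)) (at t within {0..1})"
      unfolding z_def by (auto intro!: derivative_eq_intros)
    have "((\<lambda>t. s (z t)) has_derivative (\<lambda>h. - B (z t) (h *\<^sub>R d) (s (z t)))) (at t within {0..1})"
      "((\<lambda>t. s' (z t)) has_derivative (\<lambda>h. - B (z t) (h *\<^sub>R d) (s' (z t)))) (at t within {0..1})"
      using s z[OF t] unfolding flat_at_def by (auto intro: has_derivative_compose[OF zd])
    from has_derivative_diff[OF this]
    show "((\<lambda>t. s (z t) - s' (z t)) has_vector_derivative (- B (z t) d) (s (z t) - s' (z t)) + 0) (at t within {0..1})"
      by (simp add: has_vector_derivative_def blinfun.bilinear_simps algebra_simps)
    have "norm (- B (z t) d) \<le> norm (B (z t)) * norm d" using norm_blinfun by simp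
    also have "\<dots> \<le> norm (B (z t)) * r" using x by (intro mult_left_mono) (auto simp: d_def dist_norm norm_minus_commute)
    also have "\<dots> \<le> 1/2" using small[of "z t"] z[OF t] ball_subset_cball by blast
    finally show "norm (- B (z t) d) \<le> 1/2" .
  qed (use eq in \<open>auto simp: z_def\<close>)
  then show ?thesis by (simp add: z_def d_def)
qed

lemma small_ball:
  assumes "q \<in> \<Omega>"
  obtains r where "r > 0" "cball q r \<subseteq> \<Omega>" "\<And>z. z \<in> cball q r \<Longrightarrow> norm (B z) * (2 * r) \<le> 1/2"
proof -
  obtain R where R: "R > 0" "cball q R \<subseteq> \<Omega>" using assms open_dom open_contains_cball by blast
  obtain M where M: "M \<ge> 0" "\<And>z. z \<in> cball q R \<Longrightarrow> norm (B z) \<le> M"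
    using bounds[OF compact_cball R(2)] by metis
  define r where "r = min R (1 / (4 * (M + 1)))"
  have r: "r > 0" "r \<le> R" "r \<le> 1 / (4 * (M + 1))" unfolding r_def using R(1) M(1) by auto
  have "norm (B z) * (2 * r) \<le> 1/2" if "z \<in> cball q r" for z
  proof -
    have "z \<in> cball q R" using that r(2) by auto
    then have "norm (B z) * (2 * r) \<le> (M + 1) * (2 * (1 / (4 * (M + 1))))"
      using M(1) M(2)[of z] r by (intro mult_mono) auto
    also have "\<dots> = 1/2" using M(1) by (simp add: divide_simps)
    finally show ?thesis .
  qed
  then show ?thesis using that[OF r(1)] R(2) r(2) by (meson order_trans subset_cball)
qed

lemma flat_section_unique:
  assumes U: "open U" "connected U" "U \<subseteq> \<Omega>"
    and s: "\<And>x. x \<in> U \<Longrightarrow> flat_at s x" "\<And>x. x \<in> U \<Longrightarrow> flat_at s' x"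
    and eq: "a \<in> U" "s a = s' a" and x: "x \<in> U"
  shows "s x = s' x"
proof (rule connected_eventually_induct[where P = "\<lambda>x. s x = s' x", OF U(2,1) eq(1)])
  fix x assume x: "x \<in> U"
  show "eventually (\<lambda>y. s y = s' y \<longleftrightarrow> s x = s' x) (nhds x)"
  proof (cases "s x = s' x")
    case True
    obtain r where r: "r > 0" "cball x r \<subseteq> \<Omega>" "\<And>z. z \<in> cball x r \<Longrightarrow> norm (B z) * (2 * r) \<le> 1/2"
      using small_ball x U(3) by blast
    obtain r' where r': "r' > 0" "ball x r' \<subseteq> U" using U(1) x open_contains_ball by blast
    define m where "m = min r r'"
    have m: "m > 0" "m \<le> r" "m \<le> r'" unfolding m_def using r(1) r'(1) by auto
    have "s y = s' y" if y: "y \<in> ball x m" for y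
    proof (rule flat_section_unique_ball[OF m(1) _ _ s True y])
      show "cball x m \<subseteq> \<Omega>" using r(2) m(2) by (meson order_trans subset_cball)
      show "norm (B z) * m \<le> 1/2" if "z \<in> cball x m" for z
      proof -
        have "norm (B z) * m \<le> norm (B z) * (2 * r)" using m r(1) by (intro mult_left_mono) auto
        then show ?thesis using r(3)[of z] that m(2) by auto
      qed
    qed (use r'(2) m(3) in auto)
    then have "eventually (\<lambda>y. s y = s' y) (nhds x)"
      using m(1) unfolding eventually_nhds by (intro exI[of _ "ball x m"]) auto
    then show ?thesis using True by simp
  next
    case False
    have "isCont (\<lambda>y. s y - s' y) x"
      using s[OF x] unfolding flat_at_def by (intro continuous_intros) (auto dest: has_derivative_continuous)
    then have "eventually (\<lambda>y. s y - s' y \<noteq> 0) (nhds x)"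
      by (rule isCont_eventually_nhds) (use False in \<open>auto intro!: eventually_nhds_in_open[of "- {0}", simplified]\<close>)
    then show ?thesis using False by simp
  qed
qed (use eq x in auto)

end

section \<open>The connection whose parallel sections solve the Hessian equation\<close>

lemma bilinear_family_blinfun:
  fixes \<beta> :: "'x::euclidean_space \<Rightarrow> 'a::euclidean_space \<Rightarrow> 'b::euclidean_space \<Rightarrow> 'c::euclidean_space"
  assumes S: "open S" and bil: "\<And>x. x \<in> S \<Longrightarrow> bilinear (\<beta> x)"
    and C: "\<And>u v. Ck_on 1 S (\<lambda>x. \<beta> x u v)"
  obtains B :: "'x \<Rightarrow> 'a \<Rightarrow>\<^sub>L ('b \<Rightarrow>\<^sub>L 'c)" and B' where
    "\<And>x u v. x \<in> S \<Longrightarrow> B x u v = \<beta> x u v"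
    "\<And>x. x \<in> S \<Longrightarrow> (B has_derivative B' x) (at x)"
    "\<And>h. continuous_on S (\<lambda>x. B' x h)"
    "\<And>x h u v. x \<in> S \<Longrightarrow> B' x h u v = frechet_derivative (\<lambda>x. \<beta> x u v) (at x) h"
proof -
  \<comment> \<open>Elementary operators, the basis in which an operator-valued map is assembled
    from the real components of \<open>\<beta>\<close>; its differentiability is then that of
    finitely many real functions.\<close>
  define E where "E = (\<lambda>(i::'a) (j::'b) (c::'c). Blinfun (\<lambda>u. (u \<bullet> i) *\<^sub>R Blinfun (\<lambda>v. (v \<bullet> j) *\<^sub>R c)))"
  have E: "blinfun_apply (blinfun_apply (E i j c) u) v = ((u \<bullet> i) * (v \<bullet> j)) *\<^sub>R c" for i j c u v
  proof -
    have 1: "bounded_linear (\<lambda>v. (v \<bullet> j) *\<^sub>R c)"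
      by (intro bounded_linear_scaleR_const bounded_linear_inner_left)
    have 2: "bounded_linear (\<lambda>u. (u \<bullet> i) *\<^sub>R Blinfun (\<lambda>v. (v \<bullet> j) *\<^sub>R c))"
      by (intro bounded_linear_scaleR_const bounded_linear_inner_left)
    show ?thesis unfolding E_def by (simp add: bounded_linear_Blinfun_apply[OF 2] bounded_linear_Blinfun_apply[OF 1] blinfun.scaleR_left)
  qed
  define D where "D = (\<lambda>x i j. frechet_derivative (\<lambda>x. \<beta> x i j) (at x))"
  have D: "((\<lambda>x. \<beta> x i j) has_derivative D x i j) (at x)" if "x \<in> S" for x i j
    using C that by (simp add: D_def flip: frechet_derivative_works)
  have Dc: "continuous_on S (\<lambda>x. D x i j h)" for i j h
    using C[of i j] by (simp add: D_def)
  define B where "B = (\<lambda>x. \<Sum>i\<in>Basis. \<Sum>j\<in>Basis. \<Sum>c\<in>Basis. (\<beta> x i j \<bullet> c) *\<^sub>R E i j c)"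
  define B' where "B' = (\<lambda>x h. \<Sum>i\<in>Basis. \<Sum>j\<in>Basis. \<Sum>c\<in>Basis. (D x i j h \<bullet> c) *\<^sub>R E i j c)"
  have B: "blinfun_apply (blinfun_apply (B x) u) v = \<beta> x u v" if "x \<in> S" for x u v
  proof -
    have "blinfun_apply (blinfun_apply (B x) u) v =
        (\<Sum>i\<in>Basis. \<Sum>j\<in>Basis. \<Sum>c\<in>Basis. ((u \<bullet> i) * (v \<bullet> j)) *\<^sub>R ((\<beta> x i j \<bullet> c) *\<^sub>R c))"
      unfolding B_def by (simp add: blinfun.sum_left blinfun.scaleR_left E mult.commute)
    also have "\<dots> = \<beta> x u v"
      by (simp add: euclidean_representation bilinear_expand[OF bil[OF that], of u v] flip: scaleR_sum_right del: scaleR_scaleR)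
    finally show ?thesis .
  qed
  have B': "(B has_derivative B' x) (at x)" if "x \<in> S" for x
    unfolding B_def B'_def
    by (intro has_derivative_sum has_derivative_scaleR_left has_derivative_inner_left D that)
  show ?thesis
  proof (rule that[of B B'])
    show "continuous_on S (\<lambda>x. B' x h)" for h
      unfolding B'_def by (intro continuous_intros Dc)
    fix x h u v assume x: "x \<in> S"
    have "((\<lambda>x. blinfun_apply (blinfun_apply (B x) u) v) has_derivative (\<lambda>h. blinfun_apply (blinfun_apply (B' x h) u) v)) (at x)"
      by (intro bounded_linear.has_derivative[OF blinfun.bounded_linear_left] B' x)
    then have "((\<lambda>x. \<beta> x u v) has_derivative (\<lambda>h. blinfun_apply (blinfun_apply (B' x h) u) v)) (at x)"
      by (rule has_derivative_transform_within_open[OF _ S x]) (rule B)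
    then show "blinfun_apply (blinfun_apply (B' x h) u) v = frechet_derivative (\<lambda>x. \<beta> x u v) (at x) h"
      using frechet_derivative_eqI by metis
  qed (use B B' in auto)
qed

text \<open>Pairs \<open>(f, w)\<close> that are parallel for this connection are the solutions of \<open>grad f = w\<close>,
  \<open>\<nabla>\<^sub>u w = \<kappa> f u\<close>, that is, of \<open>Hess f = \<kappa> f G\<close>.\<close>

locale hyperbolic_patch = riemannian_patch \<Omega> G
  for \<Omega> :: "'e::euclidean_space set" and G +
  fixes \<kappa> :: real
  assumes curvature: "x \<in> \<Omega> \<Longrightarrow> R x u v w = (- \<kappa>) *\<^sub>R (G x v w *\<^sub>R u - G x u w *\<^sub>R v)"
begin

definition hess_at :: "('e \<Rightarrow> real) \<Rightarrow> ('e \<Rightarrow> 'e) \<Rightarrow> 'e \<Rightarrow> bool" where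
  "hess_at f w x \<longleftrightarrow> (f has_derivative (\<lambda>u. G x (w x) u)) (at x) \<and>
     (w has_derivative (\<lambda>u. (\<kappa> * f x) *\<^sub>R u - \<Gamma> x u (w x))) (at x)"

text \<open>The sign is such that \<open>- conn x u (f, w)\<close> is the derivative of
  \<open>(f, w)\<close> in direction \<open>u\<close> dictated by the Hessian equation.\<close>

definition conn :: "'e \<Rightarrow> 'e \<Rightarrow> real \<times> 'e \<Rightarrow> real \<times> 'e" where
  "conn x u s = (- G x (snd s) u, \<Gamma> x u (snd s) - (\<kappa> * fst s) *\<^sub>R u)"

lemma conn_bilinear: "x \<in> \<Omega> \<Longrightarrow> bilinear (conn x)"
  unfolding bilinear_def
  by (intro conjI allI linearI)
    (auto simp: conn_def G_simps \<Gamma>_simps algebra_simps)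

lemma conn_Ck: "Ck_on n \<Omega> (\<lambda>x. conn x u s)"
proof -
  have G: "Ck_on n \<Omega> (\<lambda>x. G x u v)" and \<Gamma>: "Ck_on n \<Omega> (\<lambda>x. \<Gamma> x u v)" for u v
    using smooth christoffel_smooth unfolding smooth_on_def by blast+
  have 1: "bounded_linear (\<lambda>a::real. (- a, 0::'e))" and 2: "bounded_linear (\<lambda>b::'e. (0::real, b))"
    by (intro bounded_linear_Pair bounded_linear_minus bounded_linear_ident bounded_linear_zero)+
  have "Ck_on n \<Omega> (\<lambda>x. (- G x (snd s) u, 0) + (0, \<Gamma> x u (snd s) - (\<kappa> * fst s) *\<^sub>R u))"
    by (intro Ck_on_add Ck_on_bounded_linear[OF 1] Ck_on_bounded_linear[OF 2] Ck_on_diff Ck_on_const G \<Gamma> open_dom)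
  then show ?thesis by (simp add: conn_def)
qed

lemma flat_connection_exists:
  obtains B :: "'e \<Rightarrow> 'e \<Rightarrow>\<^sub>L ((real \<times> 'e) \<Rightarrow>\<^sub>L (real \<times> 'e))" and B' where "flat_connection \<Omega> B B'" "\<And>x u s. x \<in> \<Omega> \<Longrightarrow> B x u s = conn x u s"
proof -
  obtain B :: "'e \<Rightarrow> 'e \<Rightarrow>\<^sub>L ((real \<times> 'e) \<Rightarrow>\<^sub>L (real \<times> 'e))"
    and B' :: "'e \<Rightarrow> 'e \<Rightarrow> 'e \<Rightarrow>\<^sub>L ((real \<times> 'e) \<Rightarrow>\<^sub>L (real \<times> 'e))" where B:
    "\<And>x u v. x \<in> \<Omega> \<Longrightarrow> B x u v = conn x u v"
    "\<And>x. x \<in> \<Omega> \<Longrightarrow> (B has_derivative B' x) (at x)"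
    "\<And>h. continuous_on \<Omega> (\<lambda>x. B' x h)"
    "\<And>x h u v. x \<in> \<Omega> \<Longrightarrow> B' x h u v = frechet_derivative (\<lambda>x. conn x u v) (at x) h"
    using bilinear_family_blinfun[OF open_dom conn_bilinear conn_Ck] by metis
  have D: "B' x h u s = (- DG x (snd s) u h, D\<Gamma> x u (snd s) h)" if x: "x \<in> \<Omega>" for x h u and s :: "real \<times> 'e"
  proof -
    have "((\<lambda>x. conn x u s) has_derivative (\<lambda>h. (- DG x (snd s) u h, D\<Gamma> x u (snd s) h - 0))) (at x)"
      unfolding conn_def by (intro has_derivative_Pair has_derivative_minus has_derivative_diff has_derivative_const DG D\<Gamma> x)
    then show ?thesis unfolding B(4)[OF x] using frechet_derivative_eqI by fastforce
  qed
  have "flat_connection \<Omega> B B'"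
  proof
    fix x u v :: 'e and s :: "real \<times> 'e" assume x: "x \<in> \<Omega>"
    obtain f w where s: "s = (f, w)" by (cases s)
    have Rx: "D\<Gamma> x v w u - D\<Gamma> x u w v + \<Gamma> x u (\<Gamma> x v w) - \<Gamma> x v (\<Gamma> x u w) = (- \<kappa>) *\<^sub>R (G x v w *\<^sub>R u - G x u w *\<^sub>R v)"
      using curvature[OF x, of u v w] unfolding R_def' .
    have 1: "fst (B' x u v s - B' x v u s + B x u (B x v s) - B x v (B x u s)) = 0"
      unfolding D[OF x] B(1)[OF x] s conn_def
      using symm[OF x] christoffel_sym[OF x, of u v] by (simp add: metric_compatible x G_simps)
    \<comment> \<open>The first component vanished for every metric. This one is the curvature minus
      its value for constant curvature \<open>- \<kappa>\<close>: the curvature hypothesis is the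
      integrability condition.\<close>
    have "snd (B' x u v s - B' x v u s + B x u (B x v s) - B x v (B x u s)) =
      (D\<Gamma> x v w u - D\<Gamma> x u w v + \<Gamma> x u (\<Gamma> x v w) - \<Gamma> x v (\<Gamma> x u w)) + \<kappa> *\<^sub>R (G x v w *\<^sub>R u - G x u w *\<^sub>R v)"
      unfolding D[OF x] B(1)[OF x] s conn_def
      using symm[OF x, of w] christoffel_sym[OF x, of u v] by (simp add: \<Gamma>_simps x algebra_simps)
    then have 2: "snd (B' x u v s - B' x v u s + B x u (B x v s) - B x v (B x u s)) = 0"
      unfolding Rx by simp
    show "B' x u v s - B' x v u s + B x u (B x v s) - B x v (B x u s) = 0"
      using 1 2 by (simp add: prod_eq_iff)
  qed (use B open_dom in auto)
  then show ?thesis using that B(1) by blast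
qed

lemma flat_at_iff_hess_at:
  fixes B :: "'e \<Rightarrow> 'e \<Rightarrow>\<^sub>L ((real \<times> 'e) \<Rightarrow>\<^sub>L (real \<times> 'e))"
  assumes "flat_connection \<Omega> B B'" "\<And>x u s. x \<in> \<Omega> \<Longrightarrow> B x u s = conn x u s" and x: "x \<in> \<Omega>"
  shows "flat_connection.flat_at B (\<lambda>x. (f x, w x)) x \<longleftrightarrow> hess_at f w x"
proof -
  interpret flat_connection \<Omega> B B' by fact
  have "flat_at (\<lambda>x. (f x, w x)) x \<longleftrightarrow>
    ((\<lambda>x. (f x, w x)) has_derivative (\<lambda>u. (G x (w x) u, (\<kappa> * f x) *\<^sub>R u - \<Gamma> x u (w x)))) (at x)"
    unfolding flat_at_def by (simp add: assms(2) x conn_def)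
  also have "\<dots> \<longleftrightarrow> hess_at f w x"
    unfolding hess_at_def
    by (auto intro: has_derivative_Pair dest: has_derivative_fst has_derivative_snd)
  finally show ?thesis .
qed

text \<open>The jet is prescribed at any point of the ball, not only at its centre, because
  \<open>local_system\<close> asks for one neighbourhood that serves all initial points in
  it.\<close>

lemma hess_exists:
  assumes "q \<in> \<Omega>"
  obtains r where "r > 0" "ball q r \<subseteq> \<Omega>"
    "\<And>x0 f0 w0. x0 \<in> ball q r \<Longrightarrow> \<exists>f w. f x0 = f0 \<and> w x0 = w0 \<and> (\<forall>x\<in>ball q r. hess_at f w x)"
proof -
  obtain B :: "'e \<Rightarrow> 'e \<Rightarrow>\<^sub>L ((real \<times> 'e) \<Rightarrow>\<^sub>L (real \<times> 'e))" and B' where fc: "flat_connection \<Omega> B B'" and B_conn: "\<And>x u s. x \<in> \<Omega> \<Longrightarrow> B x u s = conn x u s"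
    using flat_connection_exists by blast
  interpret flat_connection \<Omega> B B' by fact
  obtain r where r: "r > 0" "cball q r \<subseteq> \<Omega>" "\<And>z. z \<in> cball q r \<Longrightarrow> norm (B z) * (2 * r) \<le> 1/2"
    using small_ball assms by blast
  have "\<exists>f w. f x0 = f0 \<and> w x0 = w0 \<and> (\<forall>x\<in>ball q r. hess_at f w x)" if x0: "x0 \<in> ball q r" for x0 f0 w0
  proof -
    obtain s where s: "s x0 = (f0, w0)" "\<forall>x\<in>ball q r. flat_at s x"
      using flat_section_exists[OF r x0] by blast
    have "hess_at (fst \<circ> s) (snd \<circ> s) x" if "x \<in> ball q r" for x
      using s(2) that r(2) flat_at_iff_hess_at[OF fc B_conn, of x "fst \<circ> s" "snd \<circ> s"] ball_subset_cball by force
    then show ?thesis using s(1) by (intro exI[of _ "fst \<circ> s"] exI[of _ "snd \<circ> s"]) auto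
  qed
  then show ?thesis using that[of r] r ball_subset_cball by blast
qed

lemma hess_unique:
  assumes U: "open U" "connected U" "U \<subseteq> \<Omega>"
    and s: "\<And>x. x \<in> U \<Longrightarrow> hess_at f w x" "\<And>x. x \<in> U \<Longrightarrow> hess_at f' w' x"
    and eq: "a \<in> U" "f a = f' a" "w a = w' a" and x: "x \<in> U"
  shows "f x = f' x" "w x = w' x"
proof -
  obtain B :: "'e \<Rightarrow> 'e \<Rightarrow>\<^sub>L ((real \<times> 'e) \<Rightarrow>\<^sub>L (real \<times> 'e))" and B' where fc: "flat_connection \<Omega> B B'" and B_conn: "\<And>x u s. x \<in> \<Omega> \<Longrightarrow> B x u s = conn x u s"
    using flat_connection_exists by blast
  interpret flat_connection \<Omega> B B' by fact
  have "(f x, w x) = (f' x, w' x)"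
    by (rule flat_section_unique[OF U _ _ eq(1) _ x])
      (use s eq U(3) flat_at_iff_hess_at[OF fc B_conn] in \<open>auto simp: subset_iff\<close>)
  then show "f x = f' x" "w x = w' x" by auto
qed

end

section \<open>Elementary hyperbolic functions\<close>

lemma second_order_cosh:
  fixes f y :: "real \<Rightarrow> real"
  assumes f: "\<And>t. (f has_real_derivative y t) (at t)" and y: "\<And>t. (y has_real_derivative K\<^sup>2 * f t) (at t)"
    and K: "K \<noteq> 0"
  shows "f t = f 0 * cosh (K * t) + y 0 * (sinh (K * t) / K)"
proof -
  \<comment> \<open>First integrals from factoring the operator of \<open>f'' = K\<^sup>2 f\<close>
    into two first-order ones; solving for \<open>f\<close> from \<open>P\<close> and
    \<open>M\<close> gives the formula.\<close>
  define P where "P t = (y t + K * f t) * exp (- (K * t))" for t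
  define M where "M t = (y t - K * f t) * exp (K * t)" for t
  have "(P has_real_derivative 0) (at t)" "(M has_real_derivative 0) (at t)" for t
    unfolding P_def M_def
    by (auto intro!: derivative_eq_intros f y simp: power2_eq_square algebra_simps)
  then have PM: "P t = P 0" "M t = M 0" using DERIV_isconst_all by blast+
  have e: "exp (- (K * t)) * exp (K * t) = 1" by (simp flip: exp_add)
  have "2 * K * f t = P t * exp (K * t) - M t * exp (- (K * t))"
    unfolding P_def M_def using e by (simp add: algebra_simps)
  also have "\<dots> = (y 0 + K * f 0) * exp (K * t) - (y 0 - K * f 0) * exp (- (K * t))"
    unfolding PM by (simp add: P_def M_def)
  also have "\<dots> = 2 * K * (f 0 * cosh (K * t) + y 0 * (sinh (K * t) / K))"
    using K by (simp add: cosh_field_def sinh_field_def field_simps)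
  finally show ?thesis using K by simp
qed

text \<open>The continuous extension of \<open>sinh r / r\<close>, which lets formulas along
  geodesics include the zero vector.\<close>

definition shc :: "real \<Rightarrow> real" where "shc r = (if r = 0 then 1 else sinh r / r)"

text \<open>The radial factor that undoes \<open>shc\<close>: it rescales a vector of length
  \<open>r\<close> to length \<open>arsinh r\<close>, continuously at 0.\<close>

definition ashc :: "real \<Rightarrow> real" where "ashc r = (if r = 0 then 1 else arsinh r / r)"

lemma shc_ashc: "shc (arsinh r) * ashc r = 1" 
  by (simp add: shc_def ashc_def)

lemma isCont_shc: "isCont shc r"
proof (cases "r = 0")
  case True
  have "(sinh has_real_derivative 1) (at (0::real))" by (auto intro!: derivative_eq_intros)
  then have "((\<lambda>h. sinh h / h) \<longlongrightarrow> (1::real)) (at 0)" by (simp add: DERIV_def)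
  then have "(shc \<longlongrightarrow> 1) (at 0)"
    by (rule Lim_transform_eventually) (auto simp: shc_def eventually_at_filter)
  then show ?thesis using True by (simp add: isCont_def shc_def)
next
  case False
  have "eventually (\<lambda>x. x \<in> - {0}) (nhds r)" using False by (intro eventually_nhds_in_open) auto
  then have "eventually (\<lambda>x. sinh x / x = shc x) (nhds r)" by eventually_elim (auto simp: shc_def)
  moreover have "isCont (\<lambda>x. sinh x / x) r" using False by (intro continuous_intros) auto
  ultimately show ?thesis using isCont_cong by fast
qed

lemma isCont_ashc: "isCont ashc r"
proof (cases "r = 0")
  case True
  have "(arsinh has_real_derivative 1) (at (0::real))" by (auto intro!: derivative_eq_intros)
  then have "((\<lambda>h. arsinh h / h) \<longlongrightarrow> (1::real)) (at 0)" by (simp add: DERIV_def)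
  then have "(ashc \<longlongrightarrow> 1) (at 0)"
    by (rule Lim_transform_eventually) (auto simp: ashc_def eventually_at_filter)
  then show ?thesis using True by (simp add: isCont_def ashc_def)
next
  case False
  have "eventually (\<lambda>x. x \<in> - {0}) (nhds r)" using False by (intro eventually_nhds_in_open) auto
  then have "eventually (\<lambda>x. arsinh x / x = ashc x) (nhds r)" by eventually_elim (auto simp: ashc_def)
  moreover have "isCont (\<lambda>x. arsinh x / x) r" using False by (intro continuous_intros) auto
  ultimately show ?thesis using isCont_cong by fast
qed

lemma continuous_on_shc [continuous_intros]: "continuous_on S f \<Longrightarrow> continuous_on S (\<lambda>x. shc (f x))"
  and continuous_on_ashc [continuous_intros]: "continuous_on S f \<Longrightarrow> continuous_on S (\<lambda>x. ashc (f x))"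
  using isCont_shc isCont_ashc
  by (auto intro!: continuous_on_compose2[of UNIV _ S f] continuous_at_imp_continuous_on)

text \<open>Factor out the exponential:
  \<open>\<alpha> * cosh t - \<beta> * sinh t = exp t * Y t\<close> with \<open>Y\<close> tending to
  \<open>(\<alpha> - \<beta>) / 2\<close>. The logarithm in \<open>arcosh\<close> then splits into
  \<open>t\<close> and a term whose limit is \<open>ln (\<alpha> - \<beta>)\<close>.\<close>

lemma arcosh_ray_limit:
  fixes \<alpha> \<beta> :: real
  assumes "\<bar>\<beta>\<bar> < \<alpha>"
  shows "((\<lambda>t. arcosh (\<alpha> * cosh t - \<beta> * sinh t) - t) \<longlongrightarrow> ln (\<alpha> - \<beta>)) at_top"
proof -
  define E where "E t = exp (- 2 * t)" for t :: real
  define Y where "Y t = (\<alpha> - \<beta>) / 2 + (\<alpha> + \<beta>) / 2 * E t" for t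
  have E: "(E \<longlongrightarrow> 0) at_top"
    unfolding E_def
    by (intro filterlim_compose[OF exp_at_bot] filterlim_tendsto_neg_mult_at_bot[OF tendsto_const _ filterlim_ident]) auto
  have Y: "(Y \<longlongrightarrow> (\<alpha> - \<beta>) / 2) at_top"
    unfolding Y_def by (rule tendsto_eq_intros E refl | simp)+
  have X: "\<alpha> * cosh t - \<beta> * sinh t = exp t * Y t" for t
  proof -
    have "exp t * E t = exp (- t)" by (simp add: E_def flip: exp_add)
    moreover have "exp t * Y t = (\<alpha> - \<beta>) / 2 * exp t + (\<alpha> + \<beta>) / 2 * (exp t * E t)"
      by (simp add: Y_def algebra_simps)
    ultimately have "exp t * Y t = (\<alpha> - \<beta>) / 2 * exp t + (\<alpha> + \<beta>) / 2 * exp (- t)"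
      by simp
    then show ?thesis by (simp add: cosh_field_def sinh_field_def field_simps)
  qed
  have "((\<lambda>t. ln (Y t + sqrt ((Y t)\<^sup>2 - E t))) \<longlongrightarrow> ln ((\<alpha> - \<beta>) / 2 + sqrt (((\<alpha> - \<beta>) / 2)\<^sup>2 - 0))) at_top"
    by (intro tendsto_ln tendsto_add tendsto_real_sqrt tendsto_diff tendsto_power Y E) (use assms in auto)
  moreover have "(\<alpha> - \<beta>) / 2 + sqrt (((\<alpha> - \<beta>) / 2)\<^sup>2 - 0) = \<alpha> - \<beta>"
    using assms by (simp only: diff_0_right real_sqrt_abs) (simp add: field_simps)
  moreover have "eventually (\<lambda>t. ln (Y t + sqrt ((Y t)\<^sup>2 - E t)) = arcosh (\<alpha> * cosh t - \<beta> * sinh t) - t) at_top"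
  proof -
    have "((\<lambda>t. (Y t)\<^sup>2 - E t) \<longlongrightarrow> ((\<alpha> - \<beta>) / 2)\<^sup>2 - 0) at_top" by (intro tendsto_intros Y E)
    moreover have "0 < ((\<alpha> - \<beta>) / 2)\<^sup>2 - 0" using assms by auto
    ultimately have "eventually (\<lambda>t. 0 < (Y t)\<^sup>2 - E t) at_top" by (rule order_tendstoD)
    moreover have "eventually (\<lambda>t. 0 < Y t) at_top" using Y assms by (intro order_tendstoD) auto
    ultimately show ?thesis
    proof eventually_elim
      case (elim t)
      have e: "(exp t * Y t)\<^sup>2 - 1 = (exp t)\<^sup>2 * ((Y t)\<^sup>2 - E t)"
        by (simp add: E_def algebra_simps power2_eq_square flip: exp_add)
      then have "((exp t * Y t)\<^sup>2 - 1) powr (1/2) = exp t * sqrt ((Y t)\<^sup>2 - E t)"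
        using elim by (simp add: powr_half_sqrt real_sqrt_mult)
      then have "arcosh (\<alpha> * cosh t - \<beta> * sinh t) = ln (exp t * (Y t + sqrt ((Y t)\<^sup>2 - E t)))"
        unfolding X by (simp add: arcosh_def algebra_simps)
      also have "\<dots> = t + ln (Y t + sqrt ((Y t)\<^sup>2 - E t))"
        using elim add_pos_nonneg[of "Y t" "sqrt ((Y t)\<^sup>2 - E t)"] by (simp add: ln_mult)
      finally show ?case by simp
    qed
  qed
  ultimately show ?thesis using Lim_transform_eventually by fastforce
qed

section \<open>The sharp inequality behind the infimum\<close>

lemma cosh_add_sinh_pos:
  fixes a r :: real assumes "\<bar>a\<bar> \<le> 1" shows "cosh r + a * sinh r > 0"
proof -
  have "\<bar>a * sinh r\<bar> \<le> 1 * \<bar>sinh r\<bar>" unfolding abs_mult by (rule mult_right_mono[OF assms]) simp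
  also have "\<bar>sinh r\<bar> < cosh r" using cosh_plus_sinh[of r] cosh_minus_sinh[of r] exp_gt_zero[of r] exp_gt_zero[of "- r"] by linarith
  finally show ?thesis by linarith
qed

text \<open>The second derivative is \<open>(x cosh x - sinh x) / (x sinh x)\<close> plus
  \<open>(cosh x sinh x - x) / (sinh x)\<^sup>2\<close>, up to the order of factors. Both numerators
  vanish at 0 and are nondecreasing.\<close>

lemma x_ln_shc_convex: "convex_on {0<..} (\<lambda>x::real. x * ln (sinh x / x))"
proof (rule f''_ge0_imp_convex[where f' = "\<lambda>x. ln (sinh x / x) + (x * cosh x / sinh x - 1)"
      and f'' = "\<lambda>x. (cosh x / sinh x - 1 / x) + ((cosh x + x * sinh x) * sinh x - x * cosh x * cosh x) / (sinh x * sinh x)"])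
  fix x :: real assume x: "x \<in> {0<..}"
  have s: "sinh x > 0" using x by simp
  show "((\<lambda>x. x * ln (sinh x / x)) has_real_derivative ln (sinh x / x) + (x * cosh x / sinh x - 1)) (at x)"
    using x s by (auto intro!: derivative_eq_intros simp: field_simps)
  show "((\<lambda>x. ln (sinh x / x) + (x * cosh x / sinh x - 1)) has_real_derivative
     (cosh x / sinh x - 1 / x) + ((cosh x + x * sinh x) * sinh x - x * cosh x * cosh x) / (sinh x * sinh x)) (at x)"
    using x s by (auto intro!: derivative_eq_intros simp: field_simps)
  have mono: "0 \<le> (f :: real \<Rightarrow> real) x" if "f 0 = 0" "\<And>y. (f has_real_derivative f' y) (at y)" "\<And>y. y \<ge> 0 \<Longrightarrow> f' y \<ge> 0" for f f'
    using DERIV_nonneg_imp_nondecreasing[of 0 x f] that x by force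
  have 1: "sinh x \<le> x * cosh x"
  proof -
    have "0 \<le> x * cosh x - sinh x"
      by (rule mono[of "\<lambda>x. x * cosh x - sinh x" "\<lambda>x. x * sinh x"]) (auto intro!: derivative_eq_intros)
    then show ?thesis by simp
  qed
  have 2: "x \<le> cosh x * sinh x"
  proof -
    have "0 \<le> cosh x * sinh x - x"
      by (rule mono[of "\<lambda>x. cosh x * sinh x - x" "\<lambda>x. sinh x * sinh x + cosh x * cosh x - 1"])
        (auto intro!: derivative_eq_intros simp: cosh_square_eq add_nonneg_nonneg simp flip: power2_eq_square)
    then show ?thesis by simp
  qed
  have "(cosh x + x * sinh x) * sinh x - x * cosh x * cosh x = cosh x * sinh x - x * (cosh x * cosh x - sinh x * sinh x)"
    by (simp add: algebra_simps)
  also have "cosh x * cosh x - sinh x * sinh x = 1" using hyperbolic_pythagoras[of x] by (simp add: power2_eq_square)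
  finally have "(cosh x + x * sinh x) * sinh x - x * cosh x * cosh x \<ge> 0" using 2 by simp
  moreover have "cosh x / sinh x - 1 / x \<ge> 0" using 1 x s by (simp add: field_simps)
  ultimately show "(cosh x / sinh x - 1 / x) + ((cosh x + x * sinh x) * sinh x - x * cosh x * cosh x) / (sinh x * sinh x) \<ge> 0"
    using s by simp
qed (auto)

text \<open>With \<open>D = cosh r + a sinh r\<close>, \<open>N = cosh \<rho> + a sinh \<rho>\<close>, \<open>s = \<rho> - r\<close>,
  \<open>P = 1 / D\<close>, \<open>Q = N / D\<close> one has \<open>sinh s P + sinh r Q = sinh \<rho>\<close>, so weighted AM-GM removes \<open>a\<close>;
  convexity of \<open>x ln (sinh x / x)\<close> then shows that \<open>r = s\<close> is the worst case.\<close>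

lemma weighted_log_cosh_ge:
  fixes a r \<rho> :: real
  assumes a: "\<bar>a\<bar> \<le> 1" and r: "r \<ge> 0" and \<rho>: "\<rho> \<ge> 0"
  shows "\<rho> * ln (cosh r + a * sinh r) - r * ln (cosh \<rho> + a * sinh \<rho>) \<ge> - \<rho> * ln (cosh (\<rho> / 2))"
proof -
  define u where "u x = ln (cosh x + a * sinh x)" for x
  have D: "cosh x + a * sinh x > 0" for x using cosh_add_sinh_pos[OF a] .
  have c1: "ln (cosh (\<rho> / 2)) \<ge> 0" using cosh_real_ge_1 by simp
  consider "\<rho> = 0" | "r = 0" "\<rho> > 0" | "r \<ge> \<rho>" "\<rho> > 0" | "0 < r" "r < \<rho>" using r \<rho> by linarith
  then show ?thesis
  proof cases
    case 3
    \<comment> \<open>Since \<open>u 0 = 0\<close>, convexity makes \<open>u x / x\<close>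
      nondecreasing, so for \<open>r \<ge> \<rho>\<close> the left-hand side is nonnegative while
      the claimed bound is at most 0.\<close>
    have "convex_on UNIV u"
    proof (rule f''_ge0_imp_convex[where f' = "\<lambda>x. (sinh x + a * cosh x) / (cosh x + a * sinh x)"
          and f'' = "\<lambda>x. (1 - a\<^sup>2) / (cosh x + a * sinh x)\<^sup>2"])
      fix x
      show "(u has_real_derivative (sinh x + a * cosh x) / (cosh x + a * sinh x)) (at x)"
        unfolding u_def using D[of x] by (auto intro!: derivative_eq_intros)
      have "((\<lambda>x. (sinh x + a * cosh x) / (cosh x + a * sinh x)) has_real_derivative
          ((cosh x + a * sinh x) * (cosh x + a * sinh x) - (sinh x + a * cosh x) * (sinh x + a * cosh x)) / ((cosh x + a * sinh x) * (cosh x + a * sinh x))) (at x)"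
        using D[of x] by (intro DERIV_divide) (auto intro!: derivative_eq_intros)
      moreover have "(cosh x + a * sinh x) * (cosh x + a * sinh x) - (sinh x + a * cosh x) * (sinh x + a * cosh x) = (1 - a\<^sup>2) * (cosh x ^ 2 - sinh x ^ 2)"
        by (simp add: algebra_simps power2_eq_square)
      ultimately show "((\<lambda>x. (sinh x + a * cosh x) / (cosh x + a * sinh x)) has_real_derivative (1 - a\<^sup>2) / (cosh x + a * sinh x)\<^sup>2) (at x)"
        using hyperbolic_pythagoras[of x] by (simp add: power2_eq_square)
      have "a\<^sup>2 \<le> 1" using a by (simp add: abs_square_le_1)
      then show "(1 - a\<^sup>2) / (cosh x + a * sinh x)\<^sup>2 \<ge> 0" by simp
    qed auto
    then have "u ((1 - \<rho> / r) *\<^sub>R 0 + (\<rho> / r) *\<^sub>R r) \<le> (1 - \<rho> / r) * u 0 + (\<rho> / r) * u r"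
      by (rule convex_onD) (use 3 in auto)
    then have "u \<rho> \<le> (\<rho> / r) * u r" using 3 by (simp add: u_def)
    then have "r * u \<rho> \<le> \<rho> * u r" using 3 by (simp add: field_simps)
    moreover have "- \<rho> * ln (cosh (\<rho> / 2)) \<le> 0" using c1 3 by simp
    ultimately show ?thesis unfolding u_def by linarith
  next
    case 4
    define s where "s = \<rho> - r"
    have s: "s > 0" "r + s = \<rho>" using 4 by (auto simp: s_def)
    define P where "P = 1 / (cosh r + a * sinh r)"
    define Q where "Q = (cosh \<rho> + a * sinh \<rho>) / (cosh r + a * sinh r)"
    have PQ: "P > 0" "Q > 0" unfolding P_def Q_def using D by auto
    have id: "sinh s * P + sinh r * Q = sinh \<rho>"
    proof -
      have "sinh s + sinh r * cosh \<rho> + a * (sinh r * sinh \<rho>) = sinh \<rho> * (cosh r + a * sinh r)"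
        unfolding s_def by (simp add: sinh_diff algebra_simps)
      then have "sinh s * P + sinh r * Q = sinh \<rho> * (cosh r + a * sinh r) / (cosh r + a * sinh r)"
        unfolding P_def Q_def by (simp add: algebra_simps flip: add_divide_distrib)
      then show ?thesis using D[of r] by simp
    qed
    \<comment> \<open>Scaled so that the mean of \<open>A\<close> and \<open>B\<close> with weights
      \<open>s / \<rho>\<close> and \<open>r / \<rho>\<close> is
      \<open>sinh s * P + sinh r * Q = sinh \<rho>\<close>, in which \<open>a\<close> no longer
      occurs.\<close>
    define A where "A = sinh s * P * \<rho> / s"
    define B where "B = sinh r * Q * \<rho> / r"
    have AB: "A > 0" "B > 0" unfolding A_def B_def using PQ s 4 by auto
    have sh: "sinh s > 0" "sinh r > 0" "sinh \<rho> > 0" using s 4 by auto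
    have "(s / \<rho>) * ln A + (r / \<rho>) * ln B \<le> ln ((s / \<rho>) * A + (r / \<rho>) * B)"
    proof -
      have "concave_on {0<..} (ln :: real \<Rightarrow> real)" by (rule ln_concave)
      from concave_onD[OF this, of "r / \<rho>" A B] show ?thesis
        using AB s 4 by (simp add: s_def field_simps)
    qed
    also have "(s / \<rho>) * A + (r / \<rho>) * B = sinh \<rho>"
      unfolding A_def B_def using s 4 id by simp
    finally have 1: "s * ln A + r * ln B \<le> \<rho> * ln (sinh \<rho>)" using 4 by (simp add: field_simps)
    have lA: "ln A = ln (sinh s / s) + ln P + ln \<rho>" "ln B = ln (sinh r / r) + ln Q + ln \<rho>"
      unfolding A_def B_def using PQ s 4 sh by (simp_all add: ln_mult ln_div)
    have 2: "s * ln P + r * ln Q = r * u \<rho> - \<rho> * u r"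
    proof -
      have "ln P = - u r" "ln Q = u \<rho> - u r"
        unfolding P_def Q_def u_def using D[of r] D[of \<rho>] by (simp_all add: ln_div)
      then show ?thesis by (simp only: s_def) (simp add: algebra_simps)
    qed
    have "(\<rho> / 2) * ln (sinh (\<rho> / 2) / (\<rho> / 2)) \<le> (1/2) * (s * ln (sinh s / s)) + (1/2) * (r * ln (sinh r / r))"
      using convex_onD[OF x_ln_shc_convex, of "1/2" s r] s 4 by (simp add: field_simps)
    then have 3: "\<rho> * ln (sinh (\<rho> / 2) / (\<rho> / 2)) \<le> s * ln (sinh s / s) + r * ln (sinh r / r)" by simp
    \<comment> \<open>The factor \<open>sinh (\<rho> / 2) / (\<rho> / 2)\<close> is the one compared
      in the convexity step; after it cancels, \<open>cosh (\<rho> / 2)\<close> is left.\<close>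
    have "sinh \<rho> = 2 * sinh (\<rho> / 2) * cosh (\<rho> / 2)" using sinh_double[of "\<rho> / 2"] by simp
    then have 5: "ln (sinh \<rho>) = ln (sinh (\<rho> / 2) / (\<rho> / 2)) + ln \<rho> + ln (cosh (\<rho> / 2))"
      using 4 by (simp add: ln_mult ln_div)
    have "\<rho> * ln \<rho> = s * ln \<rho> + r * ln \<rho>" using s(2) by (simp add: algebra_simps flip: s(2))
    with 1 2 3 show ?thesis unfolding lA 5 u_def[symmetric] by (simp add: algebra_simps)
  qed (use c1 in auto)
qed

text \<open>Origin of the witness for \<open>\<rho> > 0\<close>: equality in the convexity step
  forces \<open>r = s\<close>, and equality in AM-GM then forces \<open>P = Q\<close>, that is
  \<open>cosh \<rho> + a * sinh \<rho> = 1\<close>, whence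
  \<open>a = (1 - cosh \<rho>) / sinh \<rho> = - tanh (\<rho> / 2)\<close>.\<close>

lemma weighted_log_cosh_eq:
  fixes \<rho> :: real
  shows "\<rho> * ln (cosh (\<rho> / 2) + - tanh (\<rho> / 2) * sinh (\<rho> / 2)) - \<rho> / 2 * ln (cosh \<rho> + - tanh (\<rho> / 2) * sinh \<rho>)
    = - \<rho> * ln (cosh (\<rho> / 2))"
proof -
  define c s where "c = cosh (\<rho> / 2)" and "s = sinh (\<rho> / 2)"
  have c: "c > 0" "c\<^sup>2 - s\<^sup>2 = 1" unfolding c_def s_def using hyperbolic_pythagoras by auto
  have d: "cosh \<rho> = c\<^sup>2 + s\<^sup>2" "sinh \<rho> = 2 * s * c"
    using cosh_double[of "\<rho> / 2"] sinh_double[of "\<rho> / 2"] by (simp_all add: c_def s_def)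
  have t: "tanh (\<rho> / 2) = s / c" by (simp add: tanh_def c_def s_def)
  have "c + - (s / c) * s = 1 / c" using c by (simp add: field_simps power2_eq_square)
  moreover have "cosh \<rho> + - (s / c) * sinh \<rho> = 1" unfolding d using c by (simp add: field_simps power2_eq_square)
  ultimately show ?thesis unfolding t c_def[symmetric] s_def[symmetric] using c by (simp add: ln_div)
qed

section \<open>Riemannian manifolds\<close>

lemma riemannian_patch_subset:
  assumes "riemannian_patch \<Omega> G" "open \<Omega>'" "\<Omega>' \<subseteq> \<Omega>"
  shows "riemannian_patch \<Omega>' G"
proof -
  interpret riemannian_patch \<Omega> G by fact
  show ?thesis
    using assms(2,3) bilin symm pos smooth smooth_on_subset by unfold_locales blast+
qed

lemma at_within_Icc_neq_bot: "a < b \<Longrightarrow> t \<in> {a..b} \<Longrightarrow> at t within {a..b} \<noteq> bot" for a b :: real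
  by (simp add: trivial_limit_within islimpt_Icc)

locale riemannian_manifold =
  fixes A :: "('m::{t2_space, second_countable_topology}, 'e::euclidean_space) chart set"
    and g :: "'m \<Rightarrow> 'e \<Rightarrow> 'e \<Rightarrow> real"
  assumes atlas: "smooth_atlas A" and metric: "riemannian_metric A g"
begin

abbreviation cdom :: "('m, 'e) chart \<Rightarrow> 'm set" where "cdom \<equiv> chart_dom"
definition cimg :: "('m, 'e) chart \<Rightarrow> 'e set" where "cimg c = coord c ` cdom c"

lemma chart: "c \<in> A \<Longrightarrow> is_chart c"
  using atlas by (simp add: smooth_atlas_def)

lemma open_cdom: "c \<in> A \<Longrightarrow> open (cdom c)"
  using chart by (simp add: is_chart_def)

lemma open_cimg: "c \<in> A \<Longrightarrow> open (cimg c)"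
  using chart by (simp add: is_chart_def cimg_def)

lemma coord_inv_coord: "c \<in> A \<Longrightarrow> q \<in> cdom c \<Longrightarrow> coord_inv c (coord c q) = q"
  using chart unfolding is_chart_def homeomorphism_def by blast

lemma coord_coord_inv: "c \<in> A \<Longrightarrow> x \<in> cimg c \<Longrightarrow> coord c (coord_inv c x) = x"
  using chart unfolding is_chart_def homeomorphism_def cimg_def by blast

lemma coord_mem: "q \<in> cdom c \<Longrightarrow> coord c q \<in> cimg c"
  by (simp add: cimg_def)

lemma coord_inv_mem: "c \<in> A \<Longrightarrow> x \<in> cimg c \<Longrightarrow> coord_inv c x \<in> cdom c"
  by (auto simp: cimg_def coord_inv_coord)

lemma continuous_coord: "c \<in> A \<Longrightarrow> continuous_on (cdom c) (coord c)"
  using chart unfolding is_chart_def homeomorphism_def by blast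

lemma continuous_coord_inv: "c \<in> A \<Longrightarrow> continuous_on (cimg c) (coord_inv c)"
  using chart unfolding is_chart_def homeomorphism_def cimg_def by blast

lemma isCont_coord: "c \<in> A \<Longrightarrow> q \<in> cdom c \<Longrightarrow> isCont (coord c) q"
  using continuous_coord open_cdom continuous_on_eq_continuous_at by blast

lemma open_coord_image:
  assumes c: "c \<in> A" and "open U" shows "open (coord c ` (cdom c \<inter> U))"
proof -
  have "coord c ` (cdom c \<inter> U) = cimg c \<inter> coord_inv c -` U"
    using c by (auto simp: coord_inv_coord coord_mem) (metis IntI coord_coord_inv coord_inv_mem image_eqI)
  then show ?thesis
    using continuous_open_preimage[OF continuous_coord_inv[OF c] open_cimg[OF c] assms(2)] by simp
qed

lemma open_coord_inv_image:
  assumes c: "c \<in> A" and "open V" "V \<subseteq> cimg c" shows "open (coord_inv c ` V)"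
proof -
  have "coord_inv c ` V = cdom c \<inter> coord c -` V"
    using assms(3) coord_coord_inv[OF c] coord_inv_mem[OF c] coord_inv_coord[OF c]
    by (auto simp: subset_iff image_iff Bex_def) metis
  then show ?thesis
    using continuous_open_preimage[OF continuous_coord[OF c] open_cdom[OF c] assms(2)] by simp
qed

lemma chart_at: "chart_at A q \<in> A" "q \<in> cdom (chart_at A q)"
proof -
  have "\<exists>c. c \<in> A \<and> q \<in> cdom c" using atlas unfolding smooth_atlas_def by blast
  then have "chart_at A q \<in> A \<and> q \<in> cdom (chart_at A q)" unfolding chart_at_def by (rule someI_ex)
  then show "chart_at A q \<in> A" "q \<in> cdom (chart_at A q)" by auto
qed

text \<open>\<open>from_chart\<close> and \<open>to_chart\<close> are both instances, so every
  change of components of tangent vectors reduces to the cocycle identity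
  \<open>jac_comp\<close>.\<close>

definition jac :: "('m, 'e) chart \<Rightarrow> ('m, 'e) chart \<Rightarrow> 'm \<Rightarrow> 'e \<Rightarrow> 'e" where
  "jac c c' q = frechet_derivative (transition c c') (at (coord c q))"

lemma transition_coord: "c \<in> A \<Longrightarrow> q \<in> cdom c \<Longrightarrow> transition c c' (coord c q) = coord c' q"
  by (simp add: transition_def coord_inv_coord)

lemma transition_smooth: "c \<in> A \<Longrightarrow> c' \<in> A \<Longrightarrow> smooth_on (coord c ` (cdom c \<inter> cdom c')) (transition c c')"
  using atlas by (simp add: smooth_atlas_def)

lemma transition_has_derivative:
  "c \<in> A \<Longrightarrow> c' \<in> A \<Longrightarrow> q \<in> cdom c \<Longrightarrow> q \<in> cdom c' \<Longrightarrow> (transition c c' has_derivative jac c c' q) (at (coord c q))"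
  unfolding jac_def by (rule smooth_on_has_derivative[OF transition_smooth]) auto

lemma jac_linear:
  "c \<in> A \<Longrightarrow> c' \<in> A \<Longrightarrow> q \<in> cdom c \<Longrightarrow> q \<in> cdom c' \<Longrightarrow> linear (jac c c' q)"
  using transition_has_derivative has_derivative_linear by blast

lemma jac_comp:
  assumes c: "c \<in> A" "c' \<in> A" "c'' \<in> A" and q: "q \<in> cdom c" "q \<in> cdom c'" "q \<in> cdom c''"
  shows "jac c' c'' q (jac c c' q u) = jac c c'' q u"
proof -
  have "(transition c' c'' has_derivative jac c' c'' q) (at (transition c c' (coord c q)))"
    using transition_has_derivative c q transition_coord by metis
  from has_derivative_compose[OF transition_has_derivative[OF c(1,2) q(1,2)] this]
  have "((\<lambda>x. transition c' c'' (transition c c' x)) has_derivative (\<lambda>u. jac c' c'' q (jac c c' q u))) (at (coord c q))" .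
  then have "(transition c c'' has_derivative (\<lambda>u. jac c' c'' q (jac c c' q u))) (at (coord c q))"
  proof (rule has_derivative_transform_within_open[OF _ open_coord_image[OF c(1) open_cdom[OF c(2)]]])
    show "coord c q \<in> coord c ` (cdom c \<inter> cdom c')" using q by auto
    show "transition c' c'' (transition c c' x) = transition c c'' x" if "x \<in> coord c ` (cdom c \<inter> cdom c')" for x
      using that c by (auto simp: transition_coord)
  qed
  then show ?thesis using has_derivative_unique[OF transition_has_derivative[OF c(1,3) q(1,3)]] by metis
qed

lemma jac_refl:
  assumes c: "c \<in> A" and q: "q \<in> cdom c" shows "jac c c q u = u"
proof -
  have "((\<lambda>x. x) has_derivative jac c c q) (at (coord c q))"
    by (rule has_derivative_transform_within_open[OF transition_has_derivative[OF c c q q] open_cimg[OF c] coord_mem[OF q]])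
      (auto simp: transition_def coord_coord_inv c)
  then show ?thesis using has_derivative_unique[OF has_derivative_ident] by metis
qed

lemma from_chart_jac: "from_chart A c q = jac c (chart_at A q) q"
  by (simp add: from_chart_def jac_def)

definition to_chart :: "('m, 'e) chart \<Rightarrow> 'm \<Rightarrow> 'e \<Rightarrow> 'e" where
  "to_chart c q = jac (chart_at A q) c q"

lemma from_to_chart: "c \<in> A \<Longrightarrow> q \<in> cdom c \<Longrightarrow> from_chart A c q (to_chart c q u) = u"
  unfolding from_chart_jac to_chart_def by (simp add: jac_comp chart_at jac_refl)

lemma to_from_chart: "c \<in> A \<Longrightarrow> q \<in> cdom c \<Longrightarrow> to_chart c q (from_chart A c q u) = u"
  unfolding from_chart_jac to_chart_def by (simp add: jac_comp chart_at jac_refl)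

lemma from_chart_linear: "c \<in> A \<Longrightarrow> q \<in> cdom c \<Longrightarrow> linear (from_chart A c q)"
  unfolding from_chart_jac by (simp add: jac_linear chart_at)

lemma to_chart_linear: "c \<in> A \<Longrightarrow> q \<in> cdom c \<Longrightarrow> linear (to_chart c q)"
  unfolding to_chart_def by (simp add: jac_linear chart_at)

lemma from_chart_comp:
  "c \<in> A \<Longrightarrow> c' \<in> A \<Longrightarrow> q \<in> cdom c \<Longrightarrow> q \<in> cdom c' \<Longrightarrow> from_chart A c' q (jac c c' q u) = from_chart A c q u"
  unfolding from_chart_jac by (simp add: jac_comp chart_at)

lemma to_chart_comp:
  "c \<in> A \<Longrightarrow> c' \<in> A \<Longrightarrow> q \<in> cdom c \<Longrightarrow> q \<in> cdom c' \<Longrightarrow> jac c c' q (to_chart c q u) = to_chart c' q u"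
  unfolding to_chart_def by (simp add: jac_comp chart_at)

lemma g_bilinear: "bilinear (g q)" and g_sym: "g q u v = g q v u" and g_pos: "u \<noteq> 0 \<Longrightarrow> 0 < g q u u"
  using metric unfolding riemannian_metric_def by blast+

abbreviation G where "G \<equiv> metric_in A g"

lemma G_coord: "c \<in> A \<Longrightarrow> q \<in> cdom c \<Longrightarrow> G c (coord c q) u v = g q (from_chart A c q u) (from_chart A c q v)"
  by (simp add: metric_in_def coord_inv_coord)

lemma g_to_chart: "c \<in> A \<Longrightarrow> q \<in> cdom c \<Longrightarrow> g q u v = G c (coord c q) (to_chart c q u) (to_chart c q v)"
  by (simp add: G_coord from_to_chart)

lemma patch: assumes c: "c \<in> A" shows "riemannian_patch (cimg c) (G c)"
proof
  show "open (cimg c)" using open_cimg[OF c] .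
  show "smooth_on (cimg c) (\<lambda>x. G c x u v)" for u v
    using metric c unfolding riemannian_metric_def cimg_def by blast
  fix x assume "x \<in> cimg c"
  then obtain q where q: "q \<in> cdom c" "x = coord c q" by (auto simp: cimg_def)
  have G: "G c x u v = g q (from_chart A c q u) (from_chart A c q v)" for u v
    using G_coord c q by simp
  show "bilinear (G c x)"
    unfolding bilinear_def
    by (intro conjI allI linearI)
      (simp_all add: G linear_add[OF from_chart_linear[OF c q(1)]] linear_scale[OF from_chart_linear[OF c q(1)]]
        bilinear_ladd[OF g_bilinear] bilinear_radd[OF g_bilinear] bilinear_lmul[OF g_bilinear] bilinear_rmul[OF g_bilinear])
  show "G c x u v = G c x v u" for u v by (simp add: G g_sym)
  show "0 < G c x u u" if "u \<noteq> 0" for u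
  proof -
    have "from_chart A c q u \<noteq> 0"
      using that to_from_chart[OF c q(1), of u] linear_0[OF to_chart_linear[OF c q(1)]] by metis
    then show ?thesis using g_pos by (simp add: G)
  qed
qed

text \<open>Restricted to the overlap, where the transitions are mutually inverse. The isometry
  property holds because both local metrics are expressions of the same \<open>g\<close>.\<close>

lemma isometry_of_charts:
  assumes c: "c \<in> A" "c' \<in> A"
  shows "patch_isometry (coord c ` (cdom c \<inter> cdom c')) (G c) (coord c' ` (cdom c \<inter> cdom c')) (G c')
    (transition c c') (transition c' c)"
proof (rule patch_isometry.intro)
  show "riemannian_patch (coord c ` (cdom c \<inter> cdom c')) (G c)"
    by (rule riemannian_patch_subset[OF patch[OF c(1)] open_coord_image[OF c(1) open_cdom[OF c(2)]]]) (auto simp: cimg_def)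
  have eq: "cdom c \<inter> cdom c' = cdom c' \<inter> cdom c" by auto
  show "riemannian_patch (coord c' ` (cdom c \<inter> cdom c')) (G c')"
    unfolding eq
    by (rule riemannian_patch_subset[OF patch[OF c(2)] open_coord_image[OF c(2) open_cdom[OF c(1)]]]) (auto simp: cimg_def)
  show "patch_isometry_axioms (coord c ` (cdom c \<inter> cdom c')) (G c) (coord c' ` (cdom c \<inter> cdom c')) (G c')
    (transition c c') (transition c' c)"
  proof
    show "smooth_on (coord c ` (cdom c \<inter> cdom c')) (transition c c')" using transition_smooth c by blast
    show "smooth_on (coord c' ` (cdom c \<inter> cdom c')) (transition c' c)" unfolding eq using transition_smooth c by blast
    fix x u v assume "x \<in> coord c ` (cdom c \<inter> cdom c')"
    then obtain q where q: "q \<in> cdom c" "q \<in> cdom c'" "x = coord c q" by auto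
    show "G c x u v = G c' (transition c c' x) (frechet_derivative (transition c c') (at x) u) (frechet_derivative (transition c c') (at x) v)"
      using c q by (simp add: transition_coord G_coord from_chart_comp flip: jac_def)
  qed (auto simp: transition_coord c)
qed

section \<open>Curves and geodesics in charts\<close>

definition velocity_within :: "real set \<Rightarrow> (real \<Rightarrow> 'm) \<Rightarrow> real \<Rightarrow> 'e" where
  "velocity_within T \<gamma> t = vector_derivative (coord (chart_at A (\<gamma> t)) \<circ> \<gamma>) (at t within T)"

lemma velocity_within_UNIV: "velocity A \<gamma> t = velocity_within UNIV \<gamma> t"
  by (simp add: velocity_def velocity_within_def)

lemma eventually_in_chart:
  assumes "c \<in> A" "\<gamma> t \<in> cdom c" "continuous (at t within T) \<gamma>"
  shows "eventually (\<lambda>s. \<gamma> s \<in> cdom c) (at t within T)"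
  using assms open_cdom topological_tendstoD unfolding continuous_within by blast

text \<open>Continuity keeps the curve in the chart near \<open>t\<close>, where \<open>F\<close>
  has the coordinate expression \<open>\<phi>\<close> and the Euclidean chain rule applies. The set
  \<open>T\<close> admits one-sided derivatives at break points.\<close>

lemma has_vector_derivative_in_chart:
  assumes c: "c \<in> A" and t: "t \<in> T" "\<gamma> t \<in> cdom c" and cont: "continuous (at t within T) \<gamma>"
    and x: "((coord c \<circ> \<gamma>) has_vector_derivative v) (at t within T)"
    and W: "open W" "\<gamma> t \<in> W" and \<phi>: "(\<phi> has_derivative D) (at (coord c (\<gamma> t)))"
    and F: "\<And>q. q \<in> cdom c \<Longrightarrow> q \<in> W \<Longrightarrow> F q = \<phi> (coord c q)"
  shows "((\<lambda>s. F (\<gamma> s)) has_vector_derivative D v) (at t within T)"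
proof -
  have *: "((\<lambda>s. \<phi> (coord c (\<gamma> s))) has_vector_derivative D v) (at t within T)"
    using has_vector_derivative_chain[OF x, of \<phi> D] \<phi> by simp
  have "eventually (\<lambda>s. \<gamma> s \<in> W) (at t within T)"
    using cont W topological_tendstoD unfolding continuous_within by blast
  with eventually_in_chart[OF c t(2) cont]
  have "eventually (\<lambda>s. \<phi> (coord c (\<gamma> s)) = F (\<gamma> s)) (at t within T)"
    by eventually_elim (simp add: F)
  with * show ?thesis unfolding has_vector_derivative_def
    by (rule has_derivative_transform_eventually) (use F t W in auto)
qed

lemma velocity_within_chart:
  assumes c: "c \<in> A" and t: "t \<in> T" "\<gamma> t \<in> cdom c" and cont: "continuous (at t within T) \<gamma>"
    and x: "((coord c \<circ> \<gamma>) has_vector_derivative v) (at t within T)" and nb: "at t within T \<noteq> bot"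
  shows "velocity_within T \<gamma> t = from_chart A c (\<gamma> t) v"
proof -
  have "((\<lambda>s. coord (chart_at A (\<gamma> t)) (\<gamma> s)) has_vector_derivative jac c (chart_at A (\<gamma> t)) (\<gamma> t) v) (at t within T)"
    by (rule has_vector_derivative_in_chart[OF c t cont x open_UNIV _ transition_has_derivative[OF c chart_at(1) t(2) chart_at(2)]])
      (auto simp: transition_coord c)
  then show ?thesis
    unfolding velocity_within_def from_chart_jac o_def by (intro vector_derivative_within nb)
qed

lemma geodesic_chart:
  assumes \<gamma>: "is_geodesic A g \<gamma>" and c: "c \<in> A" "\<gamma> t \<in> cdom c"
  obtains x' where "((coord c \<circ> \<gamma>) has_vector_derivative x' t) (at t)"
    "(x' has_vector_derivative - christoffel (G c) (coord c (\<gamma> t)) (x' t) (x' t)) (at t)"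
    "eventually (\<lambda>s. \<gamma> s \<in> cdom c \<and> velocity A \<gamma> s = from_chart A c (\<gamma> s) (x' s)) (nhds t)"
proof -
  define x' where "x' s = vector_derivative (coord c \<circ> \<gamma>) (at s)" for s
  have cont: "isCont \<gamma> s" for s
    using \<gamma> unfolding is_geodesic_def by (simp add: continuous_on_eq_continuous_at)
  have D: "(coord c \<circ> \<gamma>) differentiable (at s) \<and>
      (x' has_vector_derivative - christoffel (G c) (coord c (\<gamma> s)) (x' s) (x' s)) (at s)" if "\<gamma> s \<in> cdom c" for s
    using \<gamma> c(1) that unfolding is_geodesic_def Let_def x'_def o_def by blast
  then have x: "((coord c \<circ> \<gamma>) has_vector_derivative x' s) (at s)" if "\<gamma> s \<in> cdom c" for s
    using that vector_derivative_works unfolding x'_def by blast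
  have "eventually (\<lambda>s. \<gamma> s \<in> cdom c) (nhds t)"
    by (rule isCont_eventually_nhds[OF cont eventually_nhds_in_open[OF open_cdom[OF c(1)] c(2)]])
  then have "eventually (\<lambda>s. \<gamma> s \<in> cdom c \<and> velocity A \<gamma> s = from_chart A c (\<gamma> s) (x' s)) (nhds t)"
  proof eventually_elim
    case (elim s)
    then show ?case unfolding velocity_within_UNIV
      using velocity_within_chart[OF c(1) UNIV_I elim cont x[OF elim]] by simp
  qed
  then show ?thesis using that x[OF c(2)] D[OF c(2)] by blast
qed

lemma geodesic_isCont: "is_geodesic A g \<gamma> \<Longrightarrow> isCont \<gamma> t"
  unfolding is_geodesic_def by (simp add: continuous_on_eq_continuous_at)

text \<open>In one fixed chart the velocity has zero covariant derivative and the metric product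
  rule gives derivative 0. The field \<open>velocity\<close> itself cannot be differentiated
  directly, as its chart changes along the curve.\<close>

lemma geodesic_speed_constant:
  assumes \<gamma>: "is_geodesic A g \<gamma>"
  shows "g (\<gamma> t) (velocity A \<gamma> t) (velocity A \<gamma> t) = g (\<gamma> 0) (velocity A \<gamma> 0) (velocity A \<gamma> 0)"
proof -
  have "((\<lambda>t. g (\<gamma> t) (velocity A \<gamma> t) (velocity A \<gamma> t)) has_real_derivative 0) (at t)" for t
  proof -
    define c where "c = chart_at A (\<gamma> t)"
    have c: "c \<in> A" "\<gamma> t \<in> cdom c" using chart_at by (auto simp: c_def)
    interpret riemannian_patch "cimg c" "G c" by (rule patch[OF c(1)])
    obtain x' where x': "((coord c \<circ> \<gamma>) has_vector_derivative x' t) (at t)"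
      "(x' has_vector_derivative - \<Gamma> (coord c (\<gamma> t)) (x' t) (x' t)) (at t)"
      "eventually (\<lambda>s. \<gamma> s \<in> cdom c \<and> velocity A \<gamma> s = from_chart A c (\<gamma> s) (x' s)) (nhds t)"
      using geodesic_chart[OF \<gamma> c] by blast
    have "((\<lambda>s. G c ((coord c \<circ> \<gamma>) s) (x' s) (x' s)) has_real_derivative 0) (at t)"
      using has_vector_derivative_G_along[OF x'(1) _ x'(2) x'(2)] coord_mem[OF c(2)] 
      by (simp add: G_simps coord_mem[OF c(2)])
    moreover have ev: "eventually (\<lambda>s. G c ((coord c \<circ> \<gamma>) s) (x' s) (x' s) = g (\<gamma> s) (velocity A \<gamma> s) (velocity A \<gamma> s)) (nhds t)"
      using x'(3) by eventually_elim (simp add: G_coord c)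
    ultimately show ?thesis using DERIV_cong_ev[OF refl ev refl] by simp
  qed
  then show ?thesis using DERIV_isconst_all by blast
qed

lemma geodesic_chart_derivatives:
  assumes \<gamma>: "is_geodesic A g \<gamma>" and c: "c \<in> A" "\<gamma> s \<in> cdom c"
  defines "x' \<equiv> \<lambda>s. vector_derivative (coord c \<circ> \<gamma>) (at s)"
  shows "((coord c \<circ> \<gamma>) has_vector_derivative x' s) (at s)"
    "(x' has_vector_derivative - christoffel (G c) ((coord c \<circ> \<gamma>) s) (x' s) (x' s)) (at s)"
  using \<gamma> c vector_derivative_works[of "coord c \<circ> \<gamma>" "at s"]
  unfolding is_geodesic_def Let_def x'_def by auto

lemma geodesic_constant: "is_geodesic A g (\<lambda>_. p)" "velocity A (\<lambda>_. p) t = 0"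
proof -
  show "is_geodesic A g (\<lambda>_. p)"
    unfolding is_geodesic_def Let_def
  proof (intro conjI ballI allI impI)
    fix c t assume c: "c \<in> A" "p \<in> cdom c"
    interpret riemannian_patch "cimg c" "G c" by (rule patch[OF c(1)])
    show "((\<lambda>s. vector_derivative (coord c \<circ> (\<lambda>_. p)) (at s)) has_vector_derivative
      - \<Gamma> ((coord c \<circ> (\<lambda>_. p)) t) (vector_derivative (coord c \<circ> (\<lambda>_. p)) (at t)) (vector_derivative (coord c \<circ> (\<lambda>_. p)) (at t))) (at t)"
      using coord_mem[OF c(2)] by (simp add: o_def \<Gamma>_simps)
  qed (auto simp: o_def)
  show "velocity A (\<lambda>_. p) t = 0" by (simp add: velocity_def o_def)
qed

lemma tnorm_scaleR: "tnorm g p (r *\<^sub>R v) = \<bar>r\<bar> * tnorm g p v"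
  by (simp add: tnorm_def bilinear_lmul[OF g_bilinear] bilinear_rmul[OF g_bilinear] real_sqrt_mult flip: mult.assoc)

lemma tnorm_nonneg: "tnorm g p v \<ge> 0"
  using g_pos[of v p] by (cases "v = 0") (auto simp: tnorm_def bilinear_lzero[OF g_bilinear])

lemma tnorm_square: "(tnorm g p v)\<^sup>2 = g p v v"
  using g_pos[of v p] by (cases "v = 0") (auto simp: tnorm_def bilinear_lzero[OF g_bilinear])

lemma tnorm_eq_0: "tnorm g p v = 0 \<longleftrightarrow> v = 0"
  using g_pos[of v p] by (cases "v = 0") (auto simp: tnorm_def bilinear_lzero[OF g_bilinear])

lemma continuous_g: "continuous_on S a \<Longrightarrow> continuous_on S b \<Longrightarrow> continuous_on S (\<lambda>x. g p (a x) (b x))"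
  by (rule bounded_bilinear.continuous_on[OF g_bilinear[unfolded bilinear_conv_bounded_bilinear]])

lemma continuous_tnorm: "continuous_on S a \<Longrightarrow> continuous_on S (\<lambda>x. tnorm g p (a x))"
  unfolding tnorm_def by (intro continuous_intros continuous_g)

lemma g_Cauchy_Schwarz: "\<bar>g q u v\<bar> \<le> tnorm g q u * tnorm g q v"
proof (cases "v = 0")
  case False
  define t where "t = g q u v / g q v v"
  have vv: "g q v v > 0" using g_pos[OF False] .
  have "0 \<le> g q (u - t *\<^sub>R v) (u - t *\<^sub>R v)"
    using g_pos[of "u - t *\<^sub>R v" q] by (cases "u - t *\<^sub>R v = 0") (auto simp: bilinear_lzero[OF g_bilinear])
  also have "\<dots> = g q u u - (g q u v)\<^sup>2 / g q v v"
    using vv g_sym[of q v u]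
    by (simp add: bilinear_lsub[OF g_bilinear] bilinear_rsub[OF g_bilinear] bilinear_lmul[OF g_bilinear] bilinear_rmul[OF g_bilinear]
        t_def power2_eq_square field_simps)
  finally have "(g q u v)\<^sup>2 \<le> (tnorm g q u * tnorm g q v)\<^sup>2"
    using vv by (simp add: power_mult_distrib tnorm_square field_simps)
  then show ?thesis using tnorm_nonneg by (metis abs_le_square_iff abs_of_nonneg mult_nonneg_nonneg)
qed (simp add: bilinear_rzero[OF g_bilinear] tnorm_nonneg)

lemma C1_curve_chart:
  assumes ab: "a < b" and \<gamma>: "C1_curve_on A \<gamma> a b" and t: "t \<in> {a..b}" and c: "c \<in> A" "\<gamma> t \<in> cdom c"
  defines "x' \<equiv> \<lambda>s. vector_derivative (coord c \<circ> \<gamma>) (at s within {a..b})"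
  shows "((coord c \<circ> \<gamma>) has_vector_derivative x' t) (at t within {a..b})"
    "continuous (at t within {a..b}) x'"
    "velocity_within {a..b} \<gamma> t = from_chart A c (\<gamma> t) (x' t)"
    "continuous (at t within {a..b}) \<gamma>"
proof -
  show cont: "continuous (at t within {a..b}) \<gamma>"
    using \<gamma> t unfolding C1_curve_on_def continuous_on_eq_continuous_within by blast
  show D: "((coord c \<circ> \<gamma>) has_vector_derivative x' t) (at t within {a..b})"
    using \<gamma> c t vector_derivative_works unfolding C1_curve_on_def x'_def by blast
  show "continuous (at t within {a..b}) x'"
    using \<gamma> c t unfolding C1_curve_on_def x'_def by blast
  show "velocity_within {a..b} \<gamma> t = from_chart A c (\<gamma> t) (x' t)"
    by (rule velocity_within_chart[OF c(1) t c(2) cont D at_within_Icc_neq_bot[OF ab t]])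
qed

text \<open>The velocity is read in \<open>chart_at A (\<gamma> t)\<close> and may jump with
  \<open>t\<close>; its norm is chart independent and is continuous when computed in a single
  chart.\<close>

lemma C1_curve_speed_continuous:
  assumes ab: "a < b" and \<gamma>: "C1_curve_on A \<gamma> a b"
  shows "continuous_on {a..b} (\<lambda>t. tnorm g (\<gamma> t) (velocity_within {a..b} \<gamma> t))"
  unfolding continuous_on_eq_continuous_within
proof
  fix t assume t: "t \<in> {a..b}"
  define c where "c = chart_at A (\<gamma> t)"
  have c: "c \<in> A" "\<gamma> t \<in> cdom c" using chart_at by (auto simp: c_def)
  interpret riemannian_patch "cimg c" "G c" by (rule patch[OF c(1)])
  define x' where "x' = (\<lambda>s. vector_derivative (coord c \<circ> \<gamma>) (at s within {a..b}))"
  note C = C1_curve_chart[OF ab \<gamma> t c, folded x'_def]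
  have x: "continuous (at t within {a..b}) (coord c \<circ> \<gamma>)"
    by (rule has_vector_derivative_continuous[OF C(1)])
  have Gc: "continuous (at t within {a..b}) (\<lambda>s. G c ((coord c \<circ> \<gamma>) s) i j)" for i j
  proof -
    have "isCont (\<lambda>x. G c x i j) ((coord c \<circ> \<gamma>) t)"
      using smooth_on_continuous[OF smooth] open_cimg[OF c(1)] coord_mem[OF c(2)]
      by (simp add: continuous_on_eq_continuous_at)
    then show ?thesis using continuous_within_compose3[OF _ x, of "\<lambda>x. G c x i j"] by blast
  qed
  have lhs: "continuous (at t within {a..b}) (\<lambda>s. sqrt (\<Sum>i\<in>Basis. \<Sum>j\<in>Basis. ((x' s \<bullet> i) * (x' s \<bullet> j)) *\<^sub>R G c ((coord c \<circ> \<gamma>) s) i j))"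
    by (intro continuous_intros C(2) Gc)
  have eq: "sqrt (\<Sum>i\<in>Basis. \<Sum>j\<in>Basis. ((x' s \<bullet> i) * (x' s \<bullet> j)) *\<^sub>R G c ((coord c \<circ> \<gamma>) s) i j)
      = tnorm g (\<gamma> s) (velocity_within {a..b} \<gamma> s)" if s: "s \<in> {a..b}" "\<gamma> s \<in> cdom c" for s
  proof -
    have "(\<Sum>i\<in>Basis. \<Sum>j\<in>Basis. ((x' s \<bullet> i) * (x' s \<bullet> j)) *\<^sub>R G c ((coord c \<circ> \<gamma>) s) i j) = G c (coord c (\<gamma> s)) (x' s) (x' s)"
      using bilinear_expand[OF bilin[OF coord_mem[OF s(2)]], of "x' s" "x' s"] by simp
    also have "\<dots> = g (\<gamma> s) (velocity_within {a..b} \<gamma> s) (velocity_within {a..b} \<gamma> s)"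
      using C1_curve_chart(3)[OF ab \<gamma> s(1) c(1) s(2)] by (simp add: G_coord c s x'_def)
    finally show ?thesis by (simp add: tnorm_def)
  qed
  have ev: "eventually (\<lambda>s. sqrt (\<Sum>i\<in>Basis. \<Sum>j\<in>Basis. ((x' s \<bullet> i) * (x' s \<bullet> j)) *\<^sub>R G c ((coord c \<circ> \<gamma>) s) i j)
      = tnorm g (\<gamma> s) (velocity_within {a..b} \<gamma> s)) (at t within {a..b})"
    using eventually_in_chart[of c \<gamma> t "{a..b}", OF c C(4)] 
    unfolding eventually_at_filter by eventually_elim (use eq in auto)
  show "continuous (at t within {a..b}) (\<lambda>t. tnorm g (\<gamma> t) (velocity_within {a..b} \<gamma> t))"
    using Lim_transform_eventually[OF lhs[unfolded continuous_within] ev]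
    unfolding continuous_within eq[OF t c(2)] .
qed

lemma velocity_within_interior: "a < t \<Longrightarrow> t < b \<Longrightarrow> velocity_within {a..b} \<gamma> t = velocity A \<gamma> t"
  by (simp add: velocity_within_def velocity_def at_within_Icc_at)

end

section \<open>The Hessian equation on a manifold of constant curvature\<close>

locale constant_curvature_manifold = riemannian_manifold A g
  for A :: "('m::{t2_space, second_countable_topology}, 'e::euclidean_space) chart set" and g +
  fixes k :: real
  assumes curv: "constant_curvature A g (- (k\<^sup>2))"
begin

text \<open>The curvature is prescribed at each point only in the chart chosen there. Isometry
  invariance of the curvature tensor carries it to every chart of the atlas.\<close>

lemma hyperbolic_chart: assumes c: "c \<in> A" shows "hyperbolic_patch (cimg c) (G c) (k\<^sup>2)"
proof (rule hyperbolic_patch.intro[OF patch[OF c]], unfold_locales)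
  fix x u v w assume "x \<in> cimg c"
  then obtain q where q: "q \<in> cdom c" "x = coord c q" by (auto simp: cimg_def)
  define c' where "c' = chart_at A q"
  have c': "c' \<in> A" "q \<in> cdom c'" unfolding c'_def using chart_at by auto
  interpret P: riemannian_patch "cimg c'" "G c'" by (rule patch[OF c'(1)])
  interpret I: patch_isometry "coord c ` (cdom c \<inter> cdom c')" "G c" "coord c' ` (cdom c \<inter> cdom c')" "G c'"
    "transition c c'" "transition c' c" by (rule isometry_of_charts[OF c c'(1)])
  have x: "x \<in> coord c ` (cdom c \<inter> cdom c')" using q c' by auto
  have y: "transition c c' x = coord c' q" using q transition_coord c by simp
  have "curvature_tensor (G c') (coord c' q) u v w =
      (- (k\<^sup>2)) *\<^sub>R (G c' (coord c' q) v w *\<^sub>R u - G c' (coord c' q) u w *\<^sub>R v)" for u v w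
  proof (rule P.constant_sectional_curvature[OF coord_mem[OF c'(2)]])
    fix u v :: 'e assume "u \<noteq> v" "independent {u, v}"
    then show "sectional (G c') (coord c' q) u v = - (k\<^sup>2)"
      using curv unfolding constant_curvature_def sectional_curvature_def c'_def by blast
  qed
  then show "curvature_tensor (G c) x u v w = - (k\<^sup>2) *\<^sub>R (G c x v w *\<^sub>R u - G c x u w *\<^sub>R v)"
    by (intro I.constant_curvature_pullback[OF x]) (simp add: y)
qed

definition local_f :: "('m, 'e) chart \<Rightarrow> ('m \<Rightarrow> real \<times> 'e) \<Rightarrow> 'e \<Rightarrow> real" where
  "local_f c s x = fst (s (coord_inv c x))"

text \<open>The gradient part of \<open>s\<close> is stored in the chart chosen at each point; only
  after conversion to one chart can it be differentiated.\<close>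

definition local_w :: "('m, 'e) chart \<Rightarrow> ('m \<Rightarrow> real \<times> 'e) \<Rightarrow> 'e \<Rightarrow> 'e" where
  "local_w c s x = to_chart c (coord_inv c x) (snd (s (coord_inv c x)))"

definition hess_in :: "('m, 'e) chart \<Rightarrow> ('m \<Rightarrow> real \<times> 'e) \<Rightarrow> 'm \<Rightarrow> bool" where
  "hess_in c s q \<longleftrightarrow> hyperbolic_patch.hess_at (G c) (k\<^sup>2) (local_f c s) (local_w c s) (coord c q)"

text \<open>\<open>s = (f, grad f)\<close> near \<open>q\<close>, with \<open>Hess f = k\<^sup>2 f g\<close>.\<close>

definition hessian :: "'m \<Rightarrow> ('m \<Rightarrow> real \<times> 'e) \<Rightarrow> bool" where
  "hessian q s \<longleftrightarrow> (\<forall>c\<in>A. q \<in> cdom c \<longrightarrow> hess_in c s q)"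

lemma local_f_coord: "c \<in> A \<Longrightarrow> q \<in> cdom c \<Longrightarrow> local_f c s (coord c q) = fst (s q)"
  and local_w_coord: "c \<in> A \<Longrightarrow> q \<in> cdom c \<Longrightarrow> local_w c s (coord c q) = to_chart c q (snd (s q))"
  by (simp_all add: local_f_def local_w_def coord_inv_coord)

text \<open>The gradient is a vector field and its covariant derivative is tensorial, so the
  equation holds in all charts around a point if it holds in one.\<close>

lemma hess_in_transfer:
  assumes c: "c \<in> A" "c' \<in> A" and q: "q \<in> cdom c" "q \<in> cdom c'" and H: "hess_in c s q"
  shows "hess_in c' s q"
proof -
  interpret S: hyperbolic_patch "cimg c" "G c" "k\<^sup>2" by (rule hyperbolic_chart[OF c(1)])
  interpret T: hyperbolic_patch "cimg c'" "G c'" "k\<^sup>2" by (rule hyperbolic_chart[OF c(2)])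
  interpret I: patch_isometry "coord c ` (cdom c \<inter> cdom c')" "G c" "coord c' ` (cdom c \<inter> cdom c')" "G c'"
    "transition c c'" "transition c' c" by (rule isometry_of_charts[OF c])
  define x where "x = coord c q"
  have x: "x \<in> coord c ` (cdom c \<inter> cdom c')" using q by (auto simp: x_def)
  have y: "transition c c' x = coord c' q" "transition c' c (coord c' q) = x" "coord c' q \<in> coord c' ` (cdom c \<inter> cdom c')"
    using q transition_coord c by (auto simp: x_def)
  have f: "(local_f c s has_derivative (\<lambda>u. G c x (local_w c s x) u)) (at x)"
    and w: "(local_w c s has_derivative (\<lambda>u. (k\<^sup>2 * local_f c s x) *\<^sub>R u - christoffel (G c) x u (local_w c s x))) (at x)"
    using H unfolding hess_in_def S.hess_at_def x_def by auto
  have w': "local_w c' s (transition c c' y) = frechet_derivative (transition c c') (at y) (local_w c s y)"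
    if "y \<in> coord c ` (cdom c \<inter> cdom c')" for y
    using that c by (auto simp: transition_coord local_w_coord to_chart_comp simp flip: jac_def)
  have f': "local_f c s (transition c' c y) = local_f c' s y" if "y \<in> coord c' ` (cdom c \<inter> cdom c')" for y
    using that c by (auto simp: transition_coord local_f_coord)
  have "(local_w c' s has_derivative (\<lambda>u. (k\<^sup>2 * local_f c s x) *\<^sub>R u - christoffel (G c') (transition c c' x) u (local_w c' s (transition c c' x)))) (at (transition c c' x))"
    by (rule I.hessian_equation_transform[OF x w w'])
  moreover have "(local_f c' s has_derivative (\<lambda>u. G c' (coord c' q) (local_w c' s (coord c' q)) u)) (at (coord c' q))"
  proof -
    have "(local_f c s has_derivative (\<lambda>u. G c x (local_w c s x) u)) (at (transition c' c (coord c' q)))"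
      using f y by simp
    from has_derivative_compose[OF I.Q[OF y(3)] this]
    have "((\<lambda>y. local_f c s (transition c' c y)) has_derivative
      (\<lambda>u. G c x (local_w c s x) (I.Q (coord c' q) u))) (at (coord c' q))" .
    then have "(local_f c' s has_derivative
      (\<lambda>u. G c x (local_w c s x) (I.Q (coord c' q) u))) (at (coord c' q))"
      by (rule has_derivative_transform_within_open[OF _ I.target.open_dom y(3)]) (rule f')
    moreover have "G c x (local_w c s x) (I.Q (coord c' q) u) = G c' (coord c' q) (local_w c' s (coord c' q)) u" for u
      using I.isometry[OF x, of "local_w c s x" "I.Q (coord c' q) u"] I.PQ[OF x, of u] w'[OF x] y by simp
    ultimately show ?thesis by simp
  qed
  moreover have "local_f c s x = local_f c' s (coord c' q)"
    using q c by (simp add: x_def local_f_coord)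
  ultimately show ?thesis unfolding hess_in_def T.hess_at_def y by simp
qed

lemma hessianI: "c \<in> A \<Longrightarrow> q \<in> cdom c \<Longrightarrow> hess_in c s q \<Longrightarrow> hessian q s"
  unfolding hessian_def using hess_in_transfer by blast

lemma hess_at_cong:
  assumes "c \<in> A" "open V" "x \<in> V" "\<And>y. y \<in> V \<Longrightarrow> f y = f' y \<and> w y = w' y"
    and "hyperbolic_patch.hess_at (G c) (k\<^sup>2) f w x"
  shows "hyperbolic_patch.hess_at (G c) (k\<^sup>2) f' w' x"
proof -
  interpret hyperbolic_patch "cimg c" "G c" "k\<^sup>2" by (rule hyperbolic_chart[OF assms(1)])
  have H: "(f has_derivative (\<lambda>u. G c x (w' x) u)) (at x)"
     "(w has_derivative (\<lambda>u. (k\<^sup>2 * f' x) *\<^sub>R u - \<Gamma> x u (w' x))) (at x)"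
    using assms(3-5) unfolding hess_at_def by auto
  show ?thesis unfolding hess_at_def
    using has_derivative_transform_within_open[OF H(1) assms(2,3)]
      has_derivative_transform_within_open[OF H(2) assms(2,3)] assms(4) by blast
qed

lemma chart_ball:
  assumes c: "c \<in> A" and "r > 0" and q: "q \<in> cdom c" and b: "ball (coord c q) r \<subseteq> cimg c"
  shows "open (coord_inv c ` ball (coord c q) r)" "path_connected (coord_inv c ` ball (coord c q) r)"
    "q \<in> coord_inv c ` ball (coord c q) r" "coord_inv c ` ball (coord c q) r \<subseteq> cdom c"
proof -
  show "open (coord_inv c ` ball (coord c q) r)" by (rule open_coord_inv_image[OF c open_ball b])
  show "path_connected (coord_inv c ` ball (coord c q) r)"
    by (rule path_connected_continuous_image[OF continuous_on_subset[OF continuous_coord_inv[OF c] b]])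
      (simp add: convex_imp_path_connected)
  show "q \<in> coord_inv c ` ball (coord c q) r"
    using coord_inv_coord[OF c q] \<open>r > 0\<close> by (metis centre_in_ball image_eqI)
  show "coord_inv c ` ball (coord c q) r \<subseteq> cdom c" using b coord_inv_mem[OF c] by auto
qed

lemma chart_ball_in:
  assumes c: "c \<in> A" and q: "q \<in> cdom c" and W: "open W" "q \<in> W"
  obtains r where "r > 0" "ball (coord c q) r \<subseteq> cimg c" "coord_inv c ` ball (coord c q) r \<subseteq> W"
proof -
  have "open (coord c ` (cdom c \<inter> W))" by (rule open_coord_image[OF c W(1)])
  moreover have "coord c q \<in> coord c ` (cdom c \<inter> W)" using q W by auto
  ultimately obtain r where r: "r > 0" "ball (coord c q) r \<subseteq> coord c ` (cdom c \<inter> W)"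
    by (meson open_contains_ball)
  show ?thesis
  proof (rule that[OF r(1)])
    show "ball (coord c q) r \<subseteq> cimg c" using r(2) by (auto simp: cimg_def)
    show "coord_inv c ` ball (coord c q) r \<subseteq> W" using r(2) coord_inv_coord[OF c] by auto
  qed
qed

lemma hess_in_iff_ball:
  assumes c: "c \<in> A" and "x \<in> cimg c"
  shows "hess_in c s (coord_inv c x) \<longleftrightarrow> hyperbolic_patch.hess_at (G c) (k\<^sup>2) (local_f c s) (local_w c s) x"
  using assms by (simp add: hess_in_def coord_coord_inv)

lemma hessian_dichotomy:
  assumes W: "open W" "q \<in> W" and s: "\<And>z. z \<in> W \<Longrightarrow> hessian z s" "\<And>z. z \<in> W \<Longrightarrow> hessian z s'"
  shows "eventually (\<lambda>z. s z = s' z \<longleftrightarrow> s q = s' q) (nhds q)"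
proof -
  define c where "c = chart_at A q"
  have c: "c \<in> A" "q \<in> cdom c" unfolding c_def using chart_at by auto
  interpret hyperbolic_patch "cimg c" "G c" "k\<^sup>2" by (rule hyperbolic_chart[OF c(1)])
  obtain r where r: "r > 0" "ball (coord c q) r \<subseteq> cimg c" "coord_inv c ` ball (coord c q) r \<subseteq> W"
    using chart_ball_in[OF c W] by blast
  let ?b = "ball (coord c q) r"
  note U = chart_ball[OF c(1) r(1) c(2) r(2)]
  have H: "hess_at (local_f c s) (local_w c s) x" "hess_at (local_f c s') (local_w c s') x" if "x \<in> ?b" for x
    using s[of "coord_inv c x"] that r(2,3) c(1) coord_inv_mem[OF c(1)] hess_in_iff_ball[OF c(1), of x]
    unfolding hessian_def by (auto simp: subset_iff)
  have inj: "s z = s' z \<longleftrightarrow> local_f c s (coord c z) = local_f c s' (coord c z) \<and> local_w c s (coord c z) = local_w c s' (coord c z)"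
    if "z \<in> cdom c" for z
    using from_to_chart[OF c(1) that] by (simp add: local_f_coord local_w_coord c that prod_eq_iff) metis
  have "s z = s' z \<longleftrightarrow> s q = s' q" if "z \<in> coord_inv c ` ?b" for z
  proof -
    have zd: "z \<in> cdom c" using U(4) that by auto
    have zb: "coord c z \<in> ?b" using that r(2) coord_coord_inv[OF c(1)] by (auto simp: subset_iff)
    have qb: "coord c q \<in> ?b" using r(1) by simp
    show ?thesis unfolding inj[OF zd] inj[OF c(2)]
      using hess_unique[OF open_ball connected_ball r(2) H, of "coord c z" "coord c q"]
       hess_unique[OF open_ball connected_ball r(2) H, of "coord c q" "coord c z"] zb qb by blast
  qed
  then show ?thesis using U(1,3) unfolding eventually_nhds by blast
qed

text \<open>Existence on coordinate balls comes from \<open>hess_exists\<close>, unique continuation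
  from \<open>hessian_dichotomy\<close>. From here \<open>global_section\<close> provides a global
  solution for every jet \<open>(f, grad f)\<close> at a point.\<close>

sublocale local_system hessian
proof
  fix q
  define c where "c = chart_at A q"
  have c: "c \<in> A" "q \<in> cdom c" unfolding c_def using chart_at by auto
  interpret hyperbolic_patch "cimg c" "G c" "k\<^sup>2" by (rule hyperbolic_chart[OF c(1)])
  obtain r where r: "r > 0" "ball (coord c q) r \<subseteq> cimg c"
    "\<And>x0 f0 w0. x0 \<in> ball (coord c q) r \<Longrightarrow> \<exists>f w. f x0 = f0 \<and> w x0 = w0 \<and> (\<forall>x\<in>ball (coord c q) r. hess_at f w x)"
    using hess_exists[OF coord_mem[OF c(2)]] by blast
  let ?b = "ball (coord c q) r"
  note U = chart_ball[OF c(1) r(1) c(2) r(2)]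
  have "\<exists>s. s x = v \<and> (\<forall>z\<in>coord_inv c ` ?b. hessian z s)" if x: "x \<in> coord_inv c ` ?b" for x v
  proof -
    have xd: "x \<in> cdom c" using U(4) x by auto
    have xb: "coord c x \<in> ?b" using x r(2) coord_coord_inv[OF c(1)] by (auto simp: subset_iff)
    obtain f w where fw: "f (coord c x) = fst v" "w (coord c x) = to_chart c x (snd v)" "\<forall>x\<in>?b. hess_at f w x"
      using r(3)[OF xb] by blast
    define s where "s z = (f (coord c z), from_chart A c z (w (coord c z)))" for z
    have "hessian z s" if z: "z \<in> coord_inv c ` ?b" for z
    proof (rule hessianI[OF c(1)])
      show zd: "z \<in> cdom c" using U(4) z by auto
      have zb: "coord c z \<in> ?b" using z r(2) coord_coord_inv[OF c(1)] by (auto simp: subset_iff)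
      show "hess_in c s z" unfolding hess_in_def
      proof (rule hess_at_cong[OF c(1) open_ball zb])
        show "f y = local_f c s y \<and> w y = local_w c s y" if "y \<in> ?b" for y
          using that r(2) c(1) by (auto simp: local_f_def local_w_def s_def coord_coord_inv to_from_chart coord_inv_mem subset_iff)
        show "hess_at f w (coord c z)" using fw(3) zb by blast
      qed
    qed
    moreover have "s x = v" using fw from_to_chart[OF c(1) xd] by (simp add: s_def)
    ultimately show ?thesis by blast
  qed
  then show "\<exists>U. open U \<and> path_connected U \<and> q \<in> U \<and> (\<forall>x\<in>U. \<forall>v. \<exists>s. s x = v \<and> (\<forall>z\<in>U. hessian z s))"
    using U by blast
next
  fix U s s' x z
  assume U: "open U" "connected U" and s: "\<And>z. z \<in> U \<Longrightarrow> hessian z s" "\<And>z. z \<in> U \<Longrightarrow> hessian z s'"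
    and x: "x \<in> U" "s x = s' x" "z \<in> U"
  show "s z = s' z"
    by (rule connected_eventually_induct[where P = "\<lambda>z. s z = s' z", OF U(2,1) x])
      (rule hessian_dichotomy[OF U(1) _ s])
next
  fix W :: "'m set" and q assume W: "open W" "q \<in> W"
  obtain r where r: "r > 0" "ball (coord (chart_at A q) q) r \<subseteq> cimg (chart_at A q)"
      "coord_inv (chart_at A q) ` ball (coord (chart_at A q) q) r \<subseteq> W"
    using chart_ball_in[OF chart_at W] by blast
  show "\<exists>U. open U \<and> connected U \<and> q \<in> U \<and> U \<subseteq> W"
    using chart_ball[OF chart_at(1) r(1) chart_at(2) r(2)] r(3) path_connected_imp_connected by blast
next
  fix q s s' assume s: "hessian q s" and ev: "eventually (\<lambda>z. s z = s' z) (nhds q)"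
  obtain W where W: "open W" "q \<in> W" "\<And>z. z \<in> W \<Longrightarrow> s z = s' z" using ev by (auto simp: eventually_nhds)
  define c where "c = chart_at A q"
  have c: "c \<in> A" "q \<in> cdom c" unfolding c_def using chart_at by auto
  show "hessian q s'"
  proof (rule hessianI[OF c])
    show "hess_in c s' q" unfolding hess_in_def
    proof (rule hess_at_cong[OF c(1) open_coord_image[OF c(1) W(1)]])
      show "coord c q \<in> coord c ` (cdom c \<inter> W)" using c W by auto
      show "local_f c s y = local_f c s' y \<and> local_w c s y = local_w c s' y" if "y \<in> coord c ` (cdom c \<inter> W)" for y
        using that W(3) c(1) by (auto simp: local_f_coord local_w_coord)
      show "hyperbolic_patch.hess_at (G c) (k\<^sup>2) (local_f c s) (local_w c s) (coord c q)"
        using s c unfolding hessian_def hess_in_def by blast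
    qed
  qed
qed

lemma hessian_chart:
  assumes c: "c \<in> A" "q \<in> cdom c" and "hessian q s"
  shows "(local_f c s has_derivative (\<lambda>u. G c (coord c q) (local_w c s (coord c q)) u)) (at (coord c q))"
    "(local_w c s has_derivative (\<lambda>u. (k\<^sup>2 * fst (s q)) *\<^sub>R u - christoffel (G c) (coord c q) u (local_w c s (coord c q)))) (at (coord c q))"
  using assms hyperbolic_patch.hess_at_def[OF hyperbolic_chart[OF c(1)]] 
  unfolding hessian_def hess_in_def by (auto simp: local_f_coord)

lemma G_local_w: "c \<in> A \<Longrightarrow> q \<in> cdom c \<Longrightarrow> G c (coord c q) (local_w c s (coord c q)) v = g q (snd (s q)) (from_chart A c q v)"
  by (simp add: G_coord local_w_coord from_to_chart)

lemma hessian_along_geodesic: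
  assumes \<gamma>: "is_geodesic A g \<gamma>" and s: "\<And>q. hessian q s"
  shows "((\<lambda>t. fst (s (\<gamma> t))) has_real_derivative g (\<gamma> t) (snd (s (\<gamma> t))) (velocity A \<gamma> t)) (at t)"
    "((\<lambda>t. g (\<gamma> t) (snd (s (\<gamma> t))) (velocity A \<gamma> t)) has_real_derivative
       k\<^sup>2 * fst (s (\<gamma> t)) * g (\<gamma> t) (velocity A \<gamma> t) (velocity A \<gamma> t)) (at t)"
proof -
  define c where "c = chart_at A (\<gamma> t)"
  have c: "c \<in> A" "\<gamma> t \<in> cdom c" using chart_at by (auto simp: c_def)
  interpret riemannian_patch "cimg c" "G c" by (rule patch[OF c(1)])
  obtain x' where x': "((coord c \<circ> \<gamma>) has_vector_derivative x' t) (at t)"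
    "(x' has_vector_derivative - \<Gamma> (coord c (\<gamma> t)) (x' t) (x' t)) (at t)"
    "eventually (\<lambda>s. \<gamma> s \<in> cdom c \<and> velocity A \<gamma> s = from_chart A c (\<gamma> s) (x' s)) (nhds t)"
    using geodesic_chart[OF \<gamma> c] by blast
  have vt: "velocity A \<gamma> t = from_chart A c (\<gamma> t) (x' t)" using eventually_nhds_x_imp_x[OF x'(3)] by simp
  note H = hessian_chart[OF c s]
  have "((\<lambda>t. fst (s (\<gamma> t))) has_vector_derivative G c (coord c (\<gamma> t)) (local_w c s (coord c (\<gamma> t))) (x' t)) (at t)"
    by (rule has_vector_derivative_in_chart[OF c(1) UNIV_I c(2) geodesic_isCont[OF \<gamma>] x'(1) open_UNIV UNIV_I H(1)])
      (simp add: local_f_coord c)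
  then show "((\<lambda>t. fst (s (\<gamma> t))) has_real_derivative g (\<gamma> t) (snd (s (\<gamma> t))) (velocity A \<gamma> t)) (at t)"
    by (simp add: G_local_w c vt has_real_derivative_iff_has_vector_derivative)
  have w: "((\<lambda>t. local_w c s ((coord c \<circ> \<gamma>) t)) has_vector_derivative
      (k\<^sup>2 * fst (s (\<gamma> t))) *\<^sub>R x' t - \<Gamma> (coord c (\<gamma> t)) (x' t) (local_w c s (coord c (\<gamma> t)))) (at t)"
    by (rule has_vector_derivative_chain[OF x'(1)]) (use H(2) in simp)
  have "((\<lambda>t. G c ((coord c \<circ> \<gamma>) t) (local_w c s ((coord c \<circ> \<gamma>) t)) (x' t)) has_real_derivative
     k\<^sup>2 * fst (s (\<gamma> t)) * G c (coord c (\<gamma> t)) (x' t) (x' t)) (at t)"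
    using has_vector_derivative_G_along[OF x'(1) _ w x'(2)] coord_mem[OF c(2)] by (simp add: G_simps coord_mem[OF c(2)])
  moreover have ev: "eventually (\<lambda>t. G c ((coord c \<circ> \<gamma>) t) (local_w c s ((coord c \<circ> \<gamma>) t)) (x' t) = g (\<gamma> t) (snd (s (\<gamma> t))) (velocity A \<gamma> t)) (nhds t)"
    using x'(3) by eventually_elim (simp add: G_local_w c)
  ultimately have "((\<lambda>t. g (\<gamma> t) (snd (s (\<gamma> t))) (velocity A \<gamma> t)) has_real_derivative
     k\<^sup>2 * fst (s (\<gamma> t)) * G c (coord c (\<gamma> t)) (x' t) (x' t)) (at t)"
    using DERIV_cong_ev[OF refl ev refl] by simp
  then show "((\<lambda>t. g (\<gamma> t) (snd (s (\<gamma> t))) (velocity A \<gamma> t)) has_real_derivative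
       k\<^sup>2 * fst (s (\<gamma> t)) * g (\<gamma> t) (velocity A \<gamma> t) (velocity A \<gamma> t)) (at t)"
    by (simp add: vt G_coord c)
qed

lemma value_along_geodesic:
  assumes "k \<noteq> 0" and \<gamma>: "is_geodesic A g \<gamma>" "\<gamma> 0 = p" "velocity A \<gamma> 0 = v" and s: "\<And>q. hessian q s"
  shows "fst (s (\<gamma> t)) = fst (s p) * cosh (k * t * tnorm g p v) + t * shc (k * t * tnorm g p v) * g p (snd (s p)) v"
proof -
  define a where "a = tnorm g p v"
  have a2: "a\<^sup>2 = g p v v" unfolding a_def tnorm_def using g_pos[of v p] by (cases "v = 0") (auto simp: bilinear_lzero[OF g_bilinear])
  have E: "g (\<gamma> t) (velocity A \<gamma> t) (velocity A \<gamma> t) = a\<^sup>2" for t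
    using geodesic_speed_constant[OF \<gamma>(1)] \<gamma>(2,3) a2 by simp
  note D = hessian_along_geodesic[OF \<gamma>(1) s]
  show ?thesis
  proof (cases "a = 0")
    \<comment> \<open>A geodesic of speed 0 keeps every solution constant along it, and
      \<open>shc 0 = 1\<close> keeps the formula valid.\<close>
    case True
    then have v0: "velocity A \<gamma> t = 0" for t using E[of t] g_pos[of "velocity A \<gamma> t" "\<gamma> t"] by (cases "velocity A \<gamma> t = 0") auto
    have "((\<lambda>t. fst (s (\<gamma> t))) has_real_derivative 0) (at t)" for t
      using D(1)[of t] v0 by (simp add: bilinear_rzero[OF g_bilinear])
    then have "fst (s (\<gamma> t)) = fst (s (\<gamma> 0))" using DERIV_isconst_all by blast
    then show ?thesis using True \<gamma>(2,3) v0[of 0] by (simp add: a_def bilinear_rzero[OF g_bilinear])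
  next
    case False
    then have K: "k * a \<noteq> 0" using assms(1) by simp
    have "fst (s (\<gamma> t)) = fst (s (\<gamma> 0)) * cosh (k * a * t) + g (\<gamma> 0) (snd (s (\<gamma> 0))) (velocity A \<gamma> 0) * (sinh (k * a * t) / (k * a))"
      by (rule second_order_cosh[OF D(1) _ K]) (use D(2) in \<open>simp add: E power_mult_distrib mult_ac\<close>)
    then show ?thesis using \<gamma>(2,3) K unfolding a_def[symmetric] by (simp add: shc_def mult_ac)
  qed
qed

end

section \<open>Hyperbolic space\<close>

locale hyperbolic_space = constant_curvature_manifold A g k
  for A :: "('m::{t2_space, second_countable_topology}, 'e::euclidean_space) chart set" and g and k +
  assumes simply_connected: "simply_connected (UNIV :: 'm set)"
    and complete: "geodesically_complete A g"
    and k_pos: "k > 0"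
begin

lemma connected_manifold: "connected (UNIV :: 'm set)"
  using simply_connected_imp_path_connected_top[OF simply_connected] path_connected_imp_connected by blast

definition sol :: "'m \<Rightarrow> real \<times> 'e \<Rightarrow> 'm \<Rightarrow> real \<times> 'e" where
  "sol p v = (SOME s. s p = v \<and> (\<forall>q. hessian q s))"

lemma sol: "sol p v p = v" "hessian q (sol p v)"
  using someI_ex[OF global_section[OF simply_connected, of p v]] unfolding sol_def by auto

definition lorentz :: "('m \<Rightarrow> real \<times> 'e) \<Rightarrow> ('m \<Rightarrow> real \<times> 'e) \<Rightarrow> 'm \<Rightarrow> real" where
  "lorentz s s' q = g q (snd (s q)) (snd (s' q)) - k\<^sup>2 * fst (s q) * fst (s' q)"

text \<open>The Christoffel terms cancel by metric compatibility. The gradients change by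
  \<open>k\<^sup>2 f u\<close> and \<open>k\<^sup>2 f' u\<close>, and these contributions match the
  product rule for \<open>k\<^sup>2 f f'\<close>.\<close>

lemma lorentz_constant:
  assumes s: "\<And>q. hessian q s" "\<And>q. hessian q s'"
  shows "lorentz s s' q = lorentz s s' p"
proof (rule connected_eventually_induct[where P = "\<lambda>q. lorentz s s' q = lorentz s s' p", OF connected_manifold open_UNIV UNIV_I refl UNIV_I])
  fix q
  define c where "c = chart_at A q"
  have c: "c \<in> A" "q \<in> cdom c" using chart_at by (auto simp: c_def)
  interpret riemannian_patch "cimg c" "G c" by (rule patch[OF c(1)])
  obtain r where r: "r > 0" "ball (coord c q) r \<subseteq> cimg c" "coord_inv c ` ball (coord c q) r \<subseteq> UNIV"
    using chart_ball_in[OF c open_UNIV UNIV_I] by blast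
  let ?b = "ball (coord c q) r"
  note U = chart_ball[OF c(1) r(1) c(2) r(2)]
  define F where "F x = G c x (local_w c s x) (local_w c s' x) - k\<^sup>2 * (local_f c s x * local_f c s' x)" for x
  have F: "F (coord c z) = lorentz s s' z" if "z \<in> cdom c" for z
    using that c by (simp add: F_def lorentz_def g_to_chart[OF c(1) that] local_w_coord local_f_coord)
  have "(F has_derivative (\<lambda>h. 0)) (at x within ?b)" if x: "x \<in> ?b" for x
  proof -
    have xc: "x \<in> cimg c" using x r(2) by auto
    obtain z where z: "z \<in> cdom c" "x = coord c z" using xc by (auto simp: cimg_def)
    note H = hessian_chart[OF c(1) z(1) s(1)] hessian_chart[OF c(1) z(1) s(2)]
    have lf: "local_f c s x = fst (s z)" "local_f c s' x = fst (s' z)" using z c by (simp_all add: local_f_coord)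
    have "(F has_derivative (\<lambda>u. (G c x ((k\<^sup>2 * fst (s z)) *\<^sub>R u - \<Gamma> x u (local_w c s x) + \<Gamma> x u (local_w c s x)) (local_w c s' x)
      + G c x (local_w c s x) ((k\<^sup>2 * fst (s' z)) *\<^sub>R u - \<Gamma> x u (local_w c s' x) + \<Gamma> x u (local_w c s' x)))
      - k\<^sup>2 * (local_f c s x * G c x (local_w c s' x) u + G c x (local_w c s x) u * local_f c s' x))) (at x)"
      unfolding F_def using H
      by (intro has_derivative_diff has_derivative_G xc has_derivative_mult_right has_derivative_mult) (auto simp: z(2))
    moreover have "(G c x ((k\<^sup>2 * fst (s z)) *\<^sub>R u - \<Gamma> x u (local_w c s x) + \<Gamma> x u (local_w c s x)) (local_w c s' x)
      + G c x (local_w c s x) ((k\<^sup>2 * fst (s' z)) *\<^sub>R u - \<Gamma> x u (local_w c s' x) + \<Gamma> x u (local_w c s' x)))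
      - k\<^sup>2 * (local_f c s x * G c x (local_w c s' x) u + G c x (local_w c s x) u * local_f c s' x) = 0" for u
      using symm[OF xc, of u] by (simp add: G_simps xc lf algebra_simps)
    ultimately show ?thesis by (simp add: has_derivative_at_withinI)
  qed
  then obtain C where C: "\<And>x. x \<in> ?b \<Longrightarrow> F x = C"
    using has_derivative_zero_constant[OF convex_ball] by metis
  have "lorentz s s' z = lorentz s s' q" if z: "z \<in> coord_inv c ` ?b" for z
  proof -
    have "z \<in> cdom c" "coord c z \<in> ?b" using z U(4) r(2) coord_coord_inv[OF c(1)] by (auto simp: subset_iff)
    then show ?thesis using F[of z] F[OF c(2)] C[of "coord c z"] C[of "coord c q"] r(1) by simp
  qed
  then show "eventually (\<lambda>z. lorentz s s' z = lorentz s s' p \<longleftrightarrow> lorentz s s' q = lorentz s s' p) (nhds q)"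
    unfolding eventually_nhds using U(1,3) by metis
qed

section \<open>The hyperbolic cosine of the distance and linear coordinates at a point\<close>

text \<open>The function \<open>cosh (k d(x, \<cdot>))\<close>, introduced as a solution of \<open>Hess f = k\<^sup>2 f g\<close>.\<close>

definition cdist :: "'m \<Rightarrow> 'm \<Rightarrow> real" where "cdist x y = fst (sol x (1, 0) y)"

lemma cdist_self [simp]: "cdist x x = 1"
  by (simp add: cdist_def sol)

text \<open>Pair the solutions based at \<open>x\<close> and at \<open>y\<close>. Each has zero
  gradient at its own base point, so the constant form equals \<open>- k\<^sup>2\<close> times one
  of the two values at \<open>x\<close> and times the other at \<open>y\<close>.\<close>

lemma cdist_sym: "cdist x y = cdist y x"
  using lorentz_constant[OF sol(2) sol(2), of x "(1, 0)" y "(1, 0)" x y] k_pos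
  by (simp add: lorentz_def sol cdist_def bilinear_lzero[OF g_bilinear] bilinear_rzero[OF g_bilinear])

text \<open>In the hyperboloid model solutions are the restrictions of linear functions, and this
  is, up to a linear isomorphism, the projection along the time axis through
  \<open>p\<close>.\<close>

definition shadow :: "'m \<Rightarrow> 'm \<Rightarrow> 'e" where
  "shadow p y = (\<Sum>b\<in>Basis. fst (sol p (0, b) y) *\<^sub>R b)"

definition lower :: "'m \<Rightarrow> 'e \<Rightarrow> 'e" where
  "lower p v = (\<Sum>b\<in>Basis. g p b v *\<^sub>R b)"

lemma lower_linear: "linear (lower p)"
  by (rule linearI) (simp_all add: lower_def bilinear_radd[OF g_bilinear] bilinear_rmul[OF g_bilinear]
      scaleR_add_left sum.distrib scaleR_sum_right)

lemma lower_inner: "lower p v \<bullet> u = g p u v"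
proof -
  have l: "linear (\<lambda>u. g p u v)" using g_bilinear by (auto simp: bilinear_def)
  have "g p u v = g p (\<Sum>b\<in>Basis. (u \<bullet> b) *\<^sub>R b) v" by (simp add: euclidean_representation)
  also have "\<dots> = (\<Sum>b\<in>Basis. (u \<bullet> b) * g p b v)"
    by (simp add: linear_sum[OF l] linear_scale[OF l] o_def del: euclidean_representation)
  finally show ?thesis by (simp add: lower_def inner_sum_left inner_commute[of u] mult.commute)
qed

lemma g_zero_iff: "g q u u = 0 \<longleftrightarrow> u = 0"
  using g_pos[of u q] by (cases "u = 0") (auto simp: bilinear_lzero[OF g_bilinear])

lemma lower_inj: "inj (lower p)"
  unfolding linear_injective_0[OF lower_linear]
  using lower_inner g_zero_iff by (metis inner_zero_left)

lemma shadow_self [simp]: "shadow p p = 0"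
  by (simp add: shadow_def sol)

lemma shadow_along_geodesic:
  assumes "is_geodesic A g \<gamma>" "\<gamma> 0 = p" "velocity A \<gamma> 0 = v"
  shows "shadow p (\<gamma> t) = (t * shc (k * t * tnorm g p v)) *\<^sub>R lower p v"
  unfolding shadow_def lower_def
  using value_along_geodesic[OF _ assms sol(2), where t = t] k_pos
  by (simp add: sol scaleR_sum_right)

lemma solution_continuous: "hessian q s \<Longrightarrow> isCont (\<lambda>q. fst (s q)) q"
proof -
  assume s: "hessian q s"
  define c where "c = chart_at A q"
  have c: "c \<in> A" "q \<in> cdom c" using chart_at by (auto simp: c_def)
  have "isCont (local_f c s) (coord c q)"
    using hessian_chart(1)[OF c s] by (rule has_derivative_continuous)
  then have "isCont (\<lambda>z. local_f c s (coord c z)) q"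
    using isCont_o2[OF isCont_coord[OF c]] by blast
  moreover have ev: "eventually (\<lambda>z. local_f c s (coord c z) = fst (s z)) (nhds q)"
    using eventually_nhds_in_open[OF open_cdom[OF c(1)] c(2)] by eventually_elim (simp add: local_f_coord c)
  ultimately show ?thesis using isCont_cong[OF ev] by blast
qed

lemma shadow_continuous: "isCont (shadow p) q"
  unfolding shadow_def by (intro continuous_intros solution_continuous sol)

text \<open>If the gradients at \<open>q\<close> of the coordinates of \<open>shadow p\<close> were all orthogonal to \<open>u\<close>, the solution with
  jet \<open>(0, u)\<close> at \<open>q\<close> would be a multiple of \<open>cdist p\<close> and hence timelike for the Lorentz form, yet
  its Lorentz square is \<open>g q u u\<close>.\<close>

lemma shadow_immersion:
  assumes "\<And>b. b \<in> Basis \<Longrightarrow> g q (snd (sol p (0, b) q)) u = 0"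
  shows "u = 0"
proof -
  let ?s = "sol q (0, u)"
  have "g p b (snd (?s p)) = 0" if "b \<in> Basis" for b
    using lorentz_constant[OF sol(2) sol(2), of p "(0, b)" q "(0, u)" p q] assms[OF that]
    by (simp add: lorentz_def sol)
  then have "lower p (snd (?s p)) = 0" by (simp add: lower_def)
  then have 0: "snd (?s p) = 0" using lower_inj linear_0[OF lower_linear] by (metis injD)
  have "g q u u = - (k\<^sup>2 * fst (?s p) * fst (?s p))"
    using lorentz_constant[OF sol(2) sol(2), of q "(0, u)" q "(0, u)" q p]
    by (simp add: lorentz_def sol 0 bilinear_lzero[OF g_bilinear])
  also have "\<dots> \<le> 0" by (simp add: mult.assoc)
  finally show ?thesis using g_pos[of u q] by force
qed

text \<open>The coordinate derivative is continuous and, by \<open>shadow_immersion\<close>,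
  injective at \<open>q\<close>, so the map is injective on a small ball; invariance of domain gives
  the open image and the continuous inverse.\<close>

lemma shadow_local_homeomorphism:
  obtains U h where "open U" "q \<in> U" "open (shadow p ` U)" "continuous_on (shadow p ` U) h"
    "\<And>z. z \<in> U \<Longrightarrow> h (shadow p z) = z"
proof -
  define c where "c = chart_at A q"
  have c: "c \<in> A" "q \<in> cdom c" using chart_at by (auto simp: c_def)
  interpret riemannian_patch "cimg c" "G c" by (rule patch[OF c(1)])
  define F where "F x = shadow p (coord_inv c x)" for x
  define D where "D x u = (\<Sum>b\<in>Basis. G c x (local_w c (sol p (0, b)) x) u *\<^sub>R b)" for x u
  have "((\<lambda>x. \<Sum>b\<in>Basis. local_f c (sol p (0, b)) x *\<^sub>R b) has_derivative D x) (at x)" if x: "x \<in> cimg c" for x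
  proof -
    obtain z where z: "z \<in> cdom c" "x = coord c z" using x by (auto simp: cimg_def)
    show ?thesis unfolding D_def
      by (intro has_derivative_sum has_derivative_scaleR_left) (simp add: z(2) hessian_chart(1)[OF c(1) z(1) sol(2)])
  qed
  then have FD: "(F has_derivative D x) (at x)" if "x \<in> cimg c" for x
    using that unfolding F_def shadow_def local_f_def by simp
  have wc: "continuous_on (cimg c) (local_w c (sol p (0, b)))" for b
  proof (intro continuous_at_imp_continuous_on ballI)
    fix x assume "x \<in> cimg c"
    then obtain z where z: "z \<in> cdom c" "x = coord c z" by (auto simp: cimg_def)
    then show "isCont (local_w c (sol p (0, b))) x"
      using has_derivative_continuous[OF hessian_chart(2)[OF c(1) z(1) sol(2)]] by simp
  qed
  have Gc: "continuous_on (cimg c) (\<lambda>x. G c x (w x) u)" if "continuous_on (cimg c) w" for w u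
  proof -
    have "continuous_on (cimg c) (\<lambda>x. \<Sum>i\<in>Basis. \<Sum>j\<in>Basis. ((w x \<bullet> i) * (u \<bullet> j)) *\<^sub>R G c x i j)"
      by (intro continuous_intros that smooth_on_continuous[OF smooth])
    then show ?thesis using bilinear_expand[OF bilin] by (simp cong: continuous_on_cong)
  qed
  have Dc: "continuous_on (cimg c) (\<lambda>x. D x u)" for u
    unfolding D_def by (intro continuous_intros Gc wc)
  define x0 where "x0 = coord c q"
  have x0: "x0 \<in> cimg c" using coord_mem[OF c(2)] by (simp add: x0_def)
  have lin: "linear (D x)" if "x \<in> cimg c" for x using FD[OF that] has_derivative_linear by blast
  have inj: "inj (D x0)" unfolding linear_injective_0[OF lin[OF x0]]
  proof (intro allI impI)
    fix u assume "D x0 u = 0"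
    then have "D x0 u \<bullet> b = 0" for b by simp
    then have "G c x0 (local_w c (sol p (0, b)) x0) u = 0" if "b \<in> Basis" for b
      using inner_sum_left_Basis[OF that, of "\<lambda>b. G c x0 (local_w c (sol p (0, b)) x0) u"] by (simp add: D_def)
    then have "from_chart A c q u = 0"
      by (intro shadow_immersion[of q p]) (simp add: x0_def G_local_w[OF c])
    then show "u = 0" using to_from_chart[OF c, of u] linear_0[OF to_chart_linear[OF c]] by simp
  qed
  obtain J where J: "linear J" "J \<circ> D x0 = id" using linear_injective_left_inverse[OF lin[OF x0] inj] by blast
  have small: "\<exists>d>0. \<forall>x. dist x0 x < d \<longrightarrow> onorm (\<lambda>v. D x v - D x0 v) < e" if e: "e > 0" for e
  proof -
    define N where "N x = (\<Sum>b\<in>Basis. norm (D x b - D x0 b))" for x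
    have "isCont N x0" unfolding N_def
      using Dc open_cimg[OF c(1)] x0 by (intro continuous_intros) (auto simp: continuous_on_eq_continuous_at)
    then have "eventually (\<lambda>x. N x < e \<and> x \<in> cimg c) (nhds x0)"
      using e eventually_nhds_in_open[OF open_cimg[OF c(1)] x0]
      by (intro eventually_conj isCont_eventually_nhds[of x0 N "\<lambda>y. y < e"] eventually_nhds_in_open[of "{..<e}", simplified]) (auto simp: N_def)
    then obtain d where d: "d > 0" "\<And>x. dist x x0 < d \<Longrightarrow> N x < e \<and> x \<in> cimg c" unfolding eventually_nhds_metric by blast
    have "onorm (\<lambda>v. D x v - D x0 v) < e" if "dist x0 x < d" for x
    proof -
      have x: "N x < e" "x \<in> cimg c" using d(2)[of x] that by (auto simp: dist_commute)
      have l: "linear (\<lambda>v. D x v - D x0 v)" using lin x x0 by (intro linear_compose_sub) auto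
      have "onorm (\<lambda>v. D x v - D x0 v) \<le> N x"
      proof (rule onorm_le)
        fix h
        have "D x h - D x0 h = (\<Sum>b\<in>Basis. (h \<bullet> b) *\<^sub>R (D x b - D x0 b))"
          using linear_sum[OF l, of "\<lambda>b. (h \<bullet> b) *\<^sub>R b" Basis] linear_scale[OF l]
          by (simp add: euclidean_representation)
        also have "norm \<dots> \<le> (\<Sum>b\<in>Basis. norm h * norm (D x b - D x0 b))"
          by (intro sum_norm_le) (auto intro!: mult_right_mono Basis_le_norm)
        finally show "norm (D x h - D x0 h) \<le> N x * norm h" by (simp add: N_def sum_distrib_left mult.commute)
      qed
      then show ?thesis using x by simp
    qed
    then show ?thesis using d(1) by blast
  qed
  obtain r where r: "r > 0" "ball x0 r \<subseteq> cimg c" "inj_on F (ball x0 r)"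
    using has_derivative_locally_injective[where f = F and f' = D and g' = J,
        OF x0 open_cimg[OF c(1)] J(1)[unfolded linear_conv_bounded_linear] J(2) FD small] by blast
  have Fc: "continuous_on (ball x0 r) F"
    using FD r(2) by (intro continuous_at_imp_continuous_on ballI has_derivative_continuous[of F]) blast
  obtain h where h: "homeomorphism (ball x0 r) (F ` ball x0 r) F h"
    using invariance_of_domain_homeomorphism[OF open_ball Fc _ r(3)] by blast
  note U = chart_ball[OF c(1) r(1) c(2) r(2)[unfolded x0_def]]
  have img: "shadow p ` (coord_inv c ` ball (coord c q) r) = F ` ball x0 r"
    by (auto simp: F_def x0_def image_image)
  show ?thesis
  proof (rule that[OF U(1,3), of "coord_inv c \<circ> h"])
    show "open (shadow p ` (coord_inv c ` ball (coord c q) r))"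
      unfolding img by (rule invariance_of_domain[OF Fc open_ball r(3)])
    show "continuous_on (shadow p ` (coord_inv c ` ball (coord c q) r)) (coord_inv c \<circ> h)"
      unfolding img using h r(2)
      by (intro continuous_on_compose continuous_on_subset[OF continuous_coord_inv[OF c(1)]])
        (auto simp: homeomorphism_def)
    fix z assume "z \<in> coord_inv c ` ball (coord c q) r"
    then obtain x where x: "x \<in> ball x0 r" "z = coord_inv c x" by (auto simp: x0_def)
    then show "(coord_inv c \<circ> h) (shadow p z) = z"
      using h by (auto simp: homeomorphism_def F_def)
  qed
qed

section \<open>Geodesics and the exponential map\<close>

lemma geodesic_unique:
  assumes "is_geodesic A g \<gamma>" "is_geodesic A g \<gamma>'" "\<gamma> 0 = \<gamma>' 0" "velocity A \<gamma> 0 = velocity A \<gamma>' 0"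
  shows "\<gamma> = \<gamma>'"
proof
  fix t
  \<comment> \<open>Both curves lie over the same explicit curve. Where they meet, local injectivity
    of \<open>shadow\<close> keeps them together; where they differ, Hausdorff separation keeps them
    apart.\<close>
  have eq: "shadow (\<gamma> 0) (\<gamma> t) = shadow (\<gamma> 0) (\<gamma>' t)" for t
    using shadow_along_geodesic[OF assms(1) refl refl] shadow_along_geodesic[OF assms(2) refl refl] assms(3,4) by simp
  show "\<gamma> t = \<gamma>' t"
  proof (rule connected_eventually_induct[where P = "\<lambda>t. \<gamma> t = \<gamma>' t" and I = UNIV and a = 0])
    fix x
    note cont = geodesic_isCont[OF assms(1), of x] geodesic_isCont[OF assms(2), of x]
    show "eventually (\<lambda>y. \<gamma> y = \<gamma>' y \<longleftrightarrow> \<gamma> x = \<gamma>' x) (nhds x)"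
    proof (cases "\<gamma> x = \<gamma>' x")
      case True
      obtain U h where U: "open U" "\<gamma> x \<in> U" "\<And>z. z \<in> U \<Longrightarrow> h (shadow (\<gamma> 0) z) = z"
        using shadow_local_homeomorphism[of "\<gamma> x" "\<gamma> 0"] by metis
      have "eventually (\<lambda>y. \<gamma> y \<in> U) (nhds x)" "eventually (\<lambda>y. \<gamma>' y \<in> U) (nhds x)"
        using True U(1,2) isCont_eventually_nhds[OF cont(1) eventually_nhds_in_open[of U]]
          isCont_eventually_nhds[OF cont(2) eventually_nhds_in_open[of U]] by simp_all
      then show ?thesis by eventually_elim (metis True U(3) eq)
    next
      case False
      then obtain V W where VW: "open V" "open W" "\<gamma> x \<in> V" "\<gamma>' x \<in> W" "V \<inter> W = {}"
        using hausdorff by metis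
      have "eventually (\<lambda>y. \<gamma> y \<in> V) (nhds x)" "eventually (\<lambda>y. \<gamma>' y \<in> W) (nhds x)"
        using VW isCont_eventually_nhds[OF cont(1) eventually_nhds_in_open[of V]]
          isCont_eventually_nhds[OF cont(2) eventually_nhds_in_open[of W]] by simp_all
      then show ?thesis by eventually_elim (use False VW(5) in auto)
    qed
  qed (use assms(3) in auto)
qed

definition geo :: "'m \<Rightarrow> 'e \<Rightarrow> real \<Rightarrow> 'm" where
  "geo p v = (THE \<gamma>. is_geodesic A g \<gamma> \<and> \<gamma> 0 = p \<and> velocity A \<gamma> 0 = v)"

lemma geo: "is_geodesic A g (geo p v)" "geo p v 0 = p" "velocity A (geo p v) 0 = v"
proof -
  have "\<exists>!\<gamma>. is_geodesic A g \<gamma> \<and> \<gamma> 0 = p \<and> velocity A \<gamma> 0 = v"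
    using complete geodesic_unique unfolding geodesically_complete_def by metis
  then have "is_geodesic A g (geo p v) \<and> geo p v 0 = p \<and> velocity A (geo p v) 0 = v"
    unfolding geo_def by (rule theI')
  then show "is_geodesic A g (geo p v)" "geo p v 0 = p" "velocity A (geo p v) 0 = v" by auto
qed

lemma geo_eqI: "is_geodesic A g \<gamma> \<Longrightarrow> \<gamma> 0 = p \<Longrightarrow> velocity A \<gamma> 0 = v \<Longrightarrow> geo p v = \<gamma>"
  using geodesic_unique geo by metis

abbreviation Exp where "Exp \<equiv> riem_exp A g"

lemma Exp_geo: "Exp p v = geo p v 1"
  by (simp add: riem_exp_def geo_def)

lemma Exp_0 [simp]: "Exp p 0 = p"
  unfolding Exp_geo by (subst geo_eqI[OF geodesic_constant(1)]) (auto simp: geodesic_constant(2))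

lemma value_Exp:
  assumes "\<And>q. hessian q s"
  shows "fst (s (Exp p v)) = fst (s p) * cosh (k * tnorm g p v) + shc (k * tnorm g p v) * g p (snd (s p)) v"
  using value_along_geodesic[OF _ geo assms, where t = 1] k_pos unfolding Exp_geo by simp

lemma shadow_geo: "shadow p (geo p v t) = (t * shc (k * t * tnorm g p v)) *\<^sub>R lower p v"
  by (rule shadow_along_geodesic[OF geo])

lemma shadow_Exp: "shadow p (Exp p v) = shc (k * tnorm g p v) *\<^sub>R lower p v"
  using shadow_geo[of p v 1] by (simp add: Exp_geo)

text \<open>The shadow \<open>h\<close> of \<open>geo p v t\<close> is explicit and jointly
  continuous in \<open>(v, t)\<close>, so the geodesics form a lift of \<open>h\<close> through a
  local homeomorphism. The lift is continuous along each geodesic, and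
  \<open>parametrized_continuation\<close> upgrades this to joint continuity.\<close>

lemma Exp_continuous: "continuous_on UNIV (Exp p)"
proof -
  define h where "h z = (snd z * shc (k * snd z * tnorm g p (fst z))) *\<^sub>R lower p (fst z)" for z
  have h: "continuous_on UNIV h" unfolding h_def
    by (intro continuous_intros continuous_tnorm linear_continuous_on_compose[of UNIV fst] lower_linear)
  define \<Sigma> where "\<Sigma> z = geo p (fst z) (snd z)" for z
  have \<Sigma>: "shadow p (\<Sigma> z) = h z" for z by (simp add: \<Sigma>_def h_def shadow_geo)
  define L where "L z l \<longleftrightarrow> (\<exists>W. open W \<and> z \<in> W \<and> continuous_on W l \<and> (\<forall>z'\<in>W. shadow p (l z') = h z'))" for z l
  have local: "\<exists>l. L z l \<and> (\<exists>U. open U \<and> \<Sigma> z \<in> U \<and> (\<forall>z'. \<Sigma> z' \<in> U \<longrightarrow> \<Sigma> z' = l z'))" for z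
  proof -
    obtain U f where U: "open U" "\<Sigma> z \<in> U" "open (shadow p ` U)" "continuous_on (shadow p ` U) f"
      "\<And>q. q \<in> U \<Longrightarrow> f (shadow p q) = q" using shadow_local_homeomorphism[of "\<Sigma> z" p] by blast
    have "L z (f \<circ> h)" unfolding L_def
    proof (intro exI[of _ "h -` (shadow p ` U)"] conjI ballI)
      show "open (h -` (shadow p ` U))" using U(3) h continuous_on_open_vimage[of UNIV h] by auto
      show "z \<in> h -` (shadow p ` U)" using U(2) \<Sigma>[of z] by (auto simp: image_iff) metis
      show "continuous_on (h -` (shadow p ` U)) (f \<circ> h)"
        by (intro continuous_on_compose continuous_on_subset[OF h] continuous_on_subset[OF U(4)]) auto
      show "shadow p ((f \<circ> h) z') = h z'" if "z' \<in> h -` (shadow p ` U)" for z' using that U(5) by auto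
    qed
    moreover have "\<Sigma> z' = (f \<circ> h) z'" if "\<Sigma> z' \<in> U" for z' using U(5)[OF that] \<Sigma>[of z'] by simp
    ultimately show ?thesis using U(1,2) by blast
  qed
  have "\<exists>l. L (v, t) l \<and> eventually (\<lambda>z. \<Sigma> z = l z) (nhds (v, t))" for v t
  proof (rule parametrized_continuation)
    show "eventually (\<lambda>z'. L z' l) (nhds z)" if "L z l" for z l
      using that unfolding L_def eventually_nhds by blast
    show "eventually (\<lambda>z'. l z' = m z' \<longleftrightarrow> l z = m z) (nhds z)" if lm: "L z l" "L z m" for z l m
    proof -
      obtain W1 W2 where W: "open W1" "z \<in> W1" "continuous_on W1 l" "\<forall>z'\<in>W1. shadow p (l z') = h z'"
        "open W2" "z \<in> W2" "continuous_on W2 m" "\<forall>z'\<in>W2. shadow p (m z') = h z'"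
        using lm unfolding L_def by blast
      have cont: "isCont l z" "isCont m z" using W continuous_on_eq_continuous_at by blast+
      show ?thesis
      proof (cases "l z = m z")
        case True
        obtain U f where U: "open U" "l z \<in> U" "\<And>q. q \<in> U \<Longrightarrow> f (shadow p q) = q"
          using shadow_local_homeomorphism[of "l z" p] by metis
        have "eventually (\<lambda>z. l z \<in> U) (nhds z)" "eventually (\<lambda>z. m z \<in> U) (nhds z)"
          using True U(1,2) isCont_eventually_nhds[OF cont(1) eventually_nhds_in_open[of U]]
            isCont_eventually_nhds[OF cont(2) eventually_nhds_in_open[of U]] by simp_all
        moreover have "eventually (\<lambda>z. z \<in> W1) (nhds z)" "eventually (\<lambda>z. z \<in> W2) (nhds z)"
          using W by (simp_all add: eventually_nhds_in_open)
        ultimately show ?thesis by eventually_elim (metis True U(3) W(4,8))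
      next
        case False
        then obtain V1 V2 where V: "open V1" "open V2" "l z \<in> V1" "m z \<in> V2" "V1 \<inter> V2 = {}"
          using hausdorff by metis
        have "eventually (\<lambda>z. l z \<in> V1) (nhds z)" "eventually (\<lambda>z. m z \<in> V2) (nhds z)"
          using V isCont_eventually_nhds[OF cont(1) eventually_nhds_in_open[of V1]]
            isCont_eventually_nhds[OF cont(2) eventually_nhds_in_open[of V2]] by simp_all
        then show ?thesis by eventually_elim (use False V(5) in auto)
      qed
    qed
    show "\<exists>l. L (v, t) l \<and> eventually (\<lambda>t'. \<Sigma> (v, t') = l (v, t')) (nhds t)" for v t
    proof -
      obtain l U where l: "L (v, t) l" "open U" "\<Sigma> (v, t) \<in> U" "\<And>z'. \<Sigma> z' \<in> U \<Longrightarrow> \<Sigma> z' = l z'"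
        using local[of "(v, t)"] by blast
      have "eventually (\<lambda>t'. geo p v t' \<in> U) (nhds t)"
        using isCont_eventually_nhds[OF geodesic_isCont[OF geo(1)] eventually_nhds_in_open[of U]] l(2,3) by (simp add: \<Sigma>_def)
      then have "eventually (\<lambda>t'. \<Sigma> (v, t') = l (v, t')) (nhds t)"
        by eventually_elim (simp add: l(4) \<Sigma>_def flip: l(4))
      then show ?thesis using l(1) by blast
    qed
    show "\<exists>l. L (v, 0) l \<and> eventually (\<lambda>v. \<Sigma> (v, 0) = l (v, 0)) (nhds v)"
    proof -
      obtain l U where l: "L (v, 0) l" "open U" "\<Sigma> (v, 0) \<in> U" "\<And>z'. \<Sigma> z' \<in> U \<Longrightarrow> \<Sigma> z' = l z'"
        using local[of "(v, 0)"] by blast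
      \<comment> \<open>At time 0 every geodesic is at \<open>p\<close>, so one local inverse of
        \<open>shadow\<close> serves all initial velocities.\<close>
      have "\<Sigma> (v', 0) = l (v', 0)" for v' using l(3) l(4)[of "(v', 0)"] by (simp add: \<Sigma>_def geo)
      then show ?thesis using l(1) by (intro exI[of _ l]) simp
    qed
  qed
  then have "isCont \<Sigma> (v, 1)" for v
  proof -
    obtain l where l: "L (v, 1) l" "eventually (\<lambda>z. \<Sigma> z = l z) (nhds (v, 1))"
      using \<open>\<And>v t. \<exists>l. L (v, t) l \<and> eventually (\<lambda>z. \<Sigma> z = l z) (nhds (v, t))\<close> by blast
    then have "isCont l (v, 1)" unfolding L_def using continuous_on_eq_continuous_at by blast
    then show ?thesis using isCont_cong[OF l(2)] by simp
  qed
  then have "isCont (\<lambda>v. \<Sigma> (v, 1)) v" for v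
    by (rule isCont_o2[where f = "\<lambda>v. (v, 1)" and g = \<Sigma>, rotated]) (intro continuous_intros)
  then show ?thesis by (simp add: \<Sigma>_def Exp_geo continuous_at_imp_continuous_on)
qed

text \<open>Inverts \<open>v \<mapsto> shc (k * tnorm g p v) *\<^sub>R lower p v\<close>: first undo
  \<open>lower\<close>, then rescale radially by \<open>arsinh\<close>.\<close>

definition unshadow :: "'m \<Rightarrow> 'e \<Rightarrow> 'e" where
  "unshadow p z = (let n = inv (lower p) z in ashc (k * tnorm g p n) *\<^sub>R n)"

lemma inv_lower: "inv (lower p) (lower p v) = v" "lower p (inv (lower p) z) = z" "linear (inv (lower p))"
proof -
  show "inv (lower p) (lower p v) = v" by (rule inv_f_f[OF lower_inj])
  have surj: "surj (lower p)" using linear_injective_imp_surjective[OF lower_linear lower_inj] by simp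
  then show "lower p (inv (lower p) z) = z" by (rule surj_f_inv_f)
  obtain J where J: "linear J" "J \<circ> lower p = id" using linear_injective_left_inverse[OF lower_linear lower_inj] by blast
  have "inv (lower p) = J" by (rule inv_unique_comp[OF _ J(2)]) (metis J(2) surj comp_apply ext id_apply surjD)
  then show "linear (inv (lower p))" using J(1) by simp
qed

lemma unshadow_shadow_Exp: "unshadow p (shadow p (Exp p v)) = v"
proof (cases "v = 0")
  case False
  define a where "a = k * tnorm g p v"
  have a: "a > 0" using False k_pos tnorm_eq_0[of p v] tnorm_nonneg[of p v] by (simp add: a_def less_le)
  have n: "inv (lower p) (shadow p (Exp p v)) = shc a *\<^sub>R v"
    by (simp add: shadow_Exp linear_scale[OF inv_lower(3)] inv_lower(1) a_def)
  have s: "shc a = sinh a / a" "sinh a > 0" using a by (auto simp: shc_def)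
  have "k * tnorm g p (shc a *\<^sub>R v) = sinh a"
    using a s by (simp add: tnorm_scaleR flip: a_def mult.assoc) (simp add: a_def)
  then have "ashc (k * tnorm g p (shc a *\<^sub>R v)) * shc a = 1"
    using a s by (simp add: ashc_def arsinh_sinh_real)
  then show ?thesis unfolding unshadow_def Let_def n by simp
qed (simp add: unshadow_def linear_0[OF inv_lower(3)])

lemma shadow_Exp_unshadow: "shadow p (Exp p (unshadow p z)) = z"
proof -
  define n where "n = inv (lower p) z"
  define r where "r = k * tnorm g p n"
  have r: "r \<ge> 0" using k_pos tnorm_nonneg by (simp add: r_def)
  have "ashc r \<ge> 0" using r sinh_real_nonneg_iff[of "arsinh r"] by (simp add: ashc_def)
  then have "k * tnorm g p (unshadow p z) = r * ashc r"
    unfolding unshadow_def Let_def n_def[symmetric] r_def[symmetric]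
    by (simp add: tnorm_scaleR r_def)
  also have "\<dots> = arsinh r" by (simp add: ashc_def)
  finally have "shadow p (Exp p (unshadow p z)) = (shc (arsinh r) * ashc r) *\<^sub>R lower p n"
    unfolding shadow_Exp unshadow_def Let_def n_def[symmetric] r_def[symmetric]
    by (simp add: linear_scale[OF lower_linear])
  then show ?thesis by (simp add: shc_ashc n_def inv_lower(2))
qed

lemma unshadow_continuous: "continuous_on UNIV (unshadow p)"
  unfolding unshadow_def Let_def
  by (intro continuous_intros continuous_tnorm linear_continuous_on inv_lower(3)[unfolded linear_conv_bounded_linear])

text \<open>The map \<open>f\<close> is continuous, fixes \<open>p\<close> and preserves shadows.
  Local injectivity of \<open>shadow\<close> makes its fixed-point set open, Hausdorff separation
  makes it closed. This is the surjectivity of \<open>Exp p\<close>.\<close>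

lemma Exp_unshadow_shadow: "Exp p (unshadow p (shadow p y)) = y"
proof -
  define f where "f y = Exp p (unshadow p (shadow p y))" for y
  have cont: "isCont f y" for y
  proof -
    have "isCont (Exp p) v" "isCont (unshadow p) v" for v
      using Exp_continuous unshadow_continuous by (simp_all add: continuous_on_eq_continuous_at)
    then show ?thesis unfolding f_def
      using isCont_o2[OF isCont_o2[OF shadow_continuous[of y p], of "unshadow p"], of "Exp p"] by blast
  qed
  have "f y = y"
  proof (rule connected_eventually_induct[where P = "\<lambda>y. f y = y" and I = UNIV and a = p])
    show "f p = p"
      using unshadow_shadow_Exp[of p 0] by (simp add: f_def)
    fix y
    show "eventually (\<lambda>z. f z = z \<longleftrightarrow> f y = y) (nhds y)"
    proof (cases "f y = y")
      case True
      obtain U h where U: "open U" "y \<in> U" "\<And>q. q \<in> U \<Longrightarrow> h (shadow p q) = q"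
        using shadow_local_homeomorphism[of y p] by metis
      have "eventually (\<lambda>z. f z \<in> U) (nhds y)"
        using isCont_eventually_nhds[OF cont eventually_nhds_in_open[of U]] U True by simp
      moreover have "eventually (\<lambda>z. z \<in> U) (nhds y)" using U by (intro eventually_nhds_in_open)
      ultimately show ?thesis
        by eventually_elim (metis True U(3) f_def shadow_Exp_unshadow)
    next
      case False
      then obtain V1 V2 where V: "open V1" "open V2" "f y \<in> V1" "y \<in> V2" "V1 \<inter> V2 = {}"
        using hausdorff by metis
      have "eventually (\<lambda>z. f z \<in> V1) (nhds y)"
        using isCont_eventually_nhds[OF cont eventually_nhds_in_open[of V1]] V by simp
      moreover have "eventually (\<lambda>z. z \<in> V2) (nhds y)" using V by (intro eventually_nhds_in_open)
      ultimately show ?thesis by eventually_elim (use False V(5) in auto)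
    qed
  qed (auto simp: connected_manifold)
  then show ?thesis by (simp add: f_def)
qed

lemma Exp_bij: "bij (Exp p)"
  by (rule o_bij[of "\<lambda>y. unshadow p (shadow p y)"]) (auto simp: unshadow_shadow_Exp Exp_unshadow_shadow)

section \<open>Law of cosines and Riemannian distance\<close>

lemma cdist_Exp: "cdist p (Exp p v) = cosh (k * tnorm g p v)"
  unfolding cdist_def by (subst value_Exp[OF sol(2)]) (simp add: sol bilinear_lzero[OF g_bilinear])

text \<open>Evaluate the solution based at \<open>x = Exp p u\<close> along the geodesic from
  \<open>p\<close> with velocity \<open>v\<close>. This requires its gradient at \<open>p\<close>,
  found by pairing it with \<open>sol p (0, v)\<close> and comparing the Lorentz form at
  \<open>p\<close> and at \<open>x\<close>.\<close>

lemma hyperbolic_law_of_cosines: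
  "cdist (Exp p u) (Exp p v) = cosh (k * tnorm g p u) * cosh (k * tnorm g p v) -
    k\<^sup>2 * shc (k * tnorm g p u) * shc (k * tnorm g p v) * g p u v"
proof -
  let ?x = "Exp p u"
  let ?s = "sol ?x (1, 0)"
  have 1: "fst (?s p) = cosh (k * tnorm g p u)"
    using cdist_sym[of ?x p] cdist_Exp[of p u] by (simp add: cdist_def)
  have "g p (snd (?s p)) v = - k\<^sup>2 * fst (sol p (0, v) ?x)"
    using lorentz_constant[OF sol(2) sol(2), of ?x "(1, 0)" p "(0, v)" p ?x]
    by (simp add: lorentz_def sol bilinear_lzero[OF g_bilinear])
  also have "fst (sol p (0, v) ?x) = shc (k * tnorm g p u) * g p u v"
    by (subst value_Exp[OF sol(2)]) (simp add: sol g_sym[of p v u])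
  finally show ?thesis
    unfolding cdist_def value_Exp[OF sol(2)] 1 by (simp add: mult_ac)
qed

lemma cdist_ge_1: "cdist x y \<ge> 1"
  using cdist_Exp[of x "unshadow x (shadow x y)"] cosh_real_ge_1 by (simp add: Exp_unshadow_shadow)

text \<open>Regularises \<open>arcosh\<close>, which is not differentiable at \<open>1\<close>.\<close>

definition arcosh_reg :: "real \<Rightarrow> real \<Rightarrow> real" where
  "arcosh_reg \<delta> C = ln (C + sqrt (C\<^sup>2 - 1 + \<delta>\<^sup>2))"

lemma arcosh_reg_bounds:
  assumes "\<delta> > 0"
  shows "arcosh_reg \<delta> 1 \<le> \<delta>" "r \<ge> 0 \<Longrightarrow> r \<le> arcosh_reg \<delta> (cosh r)"
proof -
  show "arcosh_reg \<delta> 1 \<le> \<delta>" using assms ln_add_one_self_le_self[of \<delta>] by (simp add: arcosh_reg_def)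
  assume r: "r \<ge> 0"
  have "sinh r = sqrt ((cosh r)\<^sup>2 - 1)" using r by (simp add: cosh_square_eq)
  also have "\<dots> \<le> sqrt ((cosh r)\<^sup>2 - 1 + \<delta>\<^sup>2)" by simp
  finally have "exp r \<le> cosh r + sqrt ((cosh r)\<^sup>2 - 1 + \<delta>\<^sup>2)" using cosh_plus_sinh[of r] by linarith
  then show "r \<le> arcosh_reg \<delta> (cosh r)"
    unfolding arcosh_reg_def by (metis exp_gt_zero ln_exp ln_mono order_less_le_trans)
qed

text \<open>The Lorentz square of the solution is \<open>- k\<^sup>2\<close> at \<open>x\<close>,
  hence everywhere. This is the eikonal equation for the distance, written so that it also makes
  sense at \<open>x\<close>.\<close>

lemma cdist_gradient: "tnorm g q (snd (sol x (1, 0) q)) = k * sqrt ((cdist x q)\<^sup>2 - 1)"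
proof -
  have "g q (snd (sol x (1, 0) q)) (snd (sol x (1, 0) q)) = k\<^sup>2 * ((cdist x q)\<^sup>2 - 1)"
    using lorentz_constant[OF sol(2) sol(2), of x "(1, 0)" x "(1, 0)" q x]
    by (simp add: lorentz_def sol cdist_def bilinear_lzero[OF g_bilinear] power2_eq_square algebra_simps)
  then show ?thesis using k_pos by (simp add: tnorm_def real_sqrt_mult)
qed

text \<open>Along the curve \<open>arcosh_reg \<delta>\<close> of \<open>cdist x\<close> has
  derivative \<open>g(w, v) / S\<close>, at most \<open>k\<close> times the speed because the
  gradient has length \<open>k sqrt (F\<^sup>2 - 1) \<le> k S\<close>. The integral is given by a
  witness, since integrability over the whole path is assembled piece by piece.\<close>

lemma C1_piece_bound:
  assumes ab: "a < b" and \<gamma>: "C1_curve_on A \<gamma> a b" and \<delta>: "\<delta> > 0"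
  shows "\<exists>I. ((\<lambda>t. tnorm g (\<gamma> t) (velocity A \<gamma> t)) has_integral I) {a..b} \<and>
     arcosh_reg \<delta> (cdist x (\<gamma> b)) - arcosh_reg \<delta> (cdist x (\<gamma> a)) \<le> k * I"
proof -
  define v where "v = velocity_within {a..b} \<gamma>"
  define F where "F t = cdist x (\<gamma> t)" for t
  define w where "w t = snd (sol x (1, 0) (\<gamma> t))" for t
  define I where "I = integral {a..b} (\<lambda>t. tnorm g (\<gamma> t) (v t))"
  have cont: "continuous_on {a..b} (\<lambda>t. tnorm g (\<gamma> t) (v t))"
    unfolding v_def by (rule C1_curve_speed_continuous[OF ab \<gamma>])
  then have I: "((\<lambda>t. tnorm g (\<gamma> t) (v t)) has_integral I) {a..b}"
    unfolding I_def by (intro integrable_integral integrable_continuous_real)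
  \<comment> \<open>At the ends of the piece \<open>velocity\<close> is two-sided and may differ
    from the one-sided derivative; two points do not affect the integral.\<close>
  have "((\<lambda>t. tnorm g (\<gamma> t) (velocity A \<gamma> t)) has_integral I) {a..b}"
  proof (rule has_integral_spike_finite[OF _ _ I, of "{a, b}"])
    fix t assume "t \<in> {a..b} - {a, b}"
    then show "tnorm g (\<gamma> t) (velocity A \<gamma> t) = tnorm g (\<gamma> t) (v t)"
      using velocity_within_interior[of a t b \<gamma>] by (auto simp: v_def)
  qed simp
  moreover have "arcosh_reg \<delta> (F b) - arcosh_reg \<delta> (F a) \<le> k * I"
  proof (rule has_integral_le)
    show "((\<lambda>t. g (\<gamma> t) (w t) (v t) / sqrt ((F t)\<^sup>2 - 1 + \<delta>\<^sup>2)) has_integral arcosh_reg \<delta> (F b) - arcosh_reg \<delta> (F a)) {a..b}"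
    proof (rule fundamental_theorem_of_calculus)
      fix t assume t: "t \<in> {a..b}"
      define c where "c = chart_at A (\<gamma> t)"
      have c: "c \<in> A" "\<gamma> t \<in> cdom c" using chart_at by (auto simp: c_def)
      note C = C1_curve_chart[OF ab \<gamma> t c]
      note H = hessian_chart(1)[OF c sol(2)[of "\<gamma> t" x "(1, 0)"]]
      have "((\<lambda>s. fst (sol x (1, 0) (\<gamma> s))) has_vector_derivative g (\<gamma> t) (w t) (v t)) (at t within {a..b})"
        using has_vector_derivative_in_chart[OF c(1) t c(2) C(4) C(1) open_UNIV UNIV_I H, of "\<lambda>q. fst (sol x (1, 0) q)"]
        by (simp add: local_f_coord[OF c(1)] G_local_w[OF c] w_def v_def C(3))
      then have F: "(F has_field_derivative g (\<gamma> t) (w t) (v t)) (at t within {a..b})"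
        by (simp add: F_def[abs_def] cdist_def has_real_derivative_iff_has_vector_derivative)
      have F1: "F t \<ge> 1" using cdist_ge_1 by (simp add: F_def)
      then have pos: "(F t)\<^sup>2 - 1 + \<delta>\<^sup>2 > 0" using \<delta> one_le_power[OF F1, of 2] by (simp add: add_nonneg_pos)
      define S where "S = sqrt ((F t)\<^sup>2 - 1 + \<delta>\<^sup>2)"
      have S: "S > 0" using pos by (simp add: S_def)
      have "((\<lambda>t. arcosh_reg \<delta> (F t)) has_field_derivative
         (g (\<gamma> t) (w t) (v t) + (inverse S / 2) * (2 * F t * g (\<gamma> t) (w t) (v t))) / (F t + S)) (at t within {a..b})"
        unfolding arcosh_reg_def
        by (rule derivative_eq_intros F refl | (use F1 pos S in \<open>simp add: S_def add_pos_pos\<close>))+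
      moreover have "(g (\<gamma> t) (w t) (v t) + (inverse S / 2) * (2 * F t * g (\<gamma> t) (w t) (v t))) / (F t + S) = g (\<gamma> t) (w t) (v t) / S"
      proof -
        have "g (\<gamma> t) (w t) (v t) + (inverse S / 2) * (2 * F t * g (\<gamma> t) (w t) (v t)) = g (\<gamma> t) (w t) (v t) / S * (F t + S)"
          using S by (simp add: field_simps)
        then show ?thesis using S F1 by simp
      qed
      ultimately show "((\<lambda>t. arcosh_reg \<delta> (F t)) has_vector_derivative g (\<gamma> t) (w t) (v t) / sqrt ((F t)\<^sup>2 - 1 + \<delta>\<^sup>2)) (at t within {a..b})"
        by (simp add: S_def has_real_derivative_iff_has_vector_derivative)
    qed (use ab in simp)
    show "((\<lambda>t. k * tnorm g (\<gamma> t) (v t)) has_integral k * I) {a..b}"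
      by (rule has_integral_mult_right[OF I])
    fix t assume "t \<in> {a..b}"
    have F1: "F t \<ge> 1" using cdist_ge_1 by (simp add: F_def)
    then have F2: "(F t)\<^sup>2 \<ge> 1" by simp
    have S: "sqrt ((F t)\<^sup>2 - 1 + \<delta>\<^sup>2) > 0" using F2 \<delta> by (simp add: add_nonneg_pos)
    have "g (\<gamma> t) (w t) (v t) \<le> k * sqrt ((F t)\<^sup>2 - 1) * tnorm g (\<gamma> t) (v t)"
      using g_Cauchy_Schwarz[of "\<gamma> t" "w t" "v t"] unfolding w_def cdist_gradient F_def by linarith
    also have "\<dots> \<le> k * sqrt ((F t)\<^sup>2 - 1 + \<delta>\<^sup>2) * tnorm g (\<gamma> t) (v t)"
      using k_pos by (intro mult_right_mono mult_left_mono tnorm_nonneg) auto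
    finally show "g (\<gamma> t) (w t) (v t) / sqrt ((F t)\<^sup>2 - 1 + \<delta>\<^sup>2) \<le> k * tnorm g (\<gamma> t) (v t)"
      using S by (simp add: field_simps)
  qed
  ultimately show ?thesis unfolding F_def by blast
qed

text \<open>The bounds telescope over the break points. Regularising costs at most
  \<open>\<delta>\<close> at the starting point and only increases the value at the end, so
  \<open>\<delta>\<close> can tend to 0.\<close>

lemma curve_length_lower_bound:
  assumes \<gamma>: "piecewise_C1_path A \<gamma>" "pathstart \<gamma> = x" and y: "pathfinish \<gamma> = Exp x v"
  shows "tnorm g x v \<le> curve_length A g \<gamma>"
proof -
  obtain n and s :: "nat \<Rightarrow> real" where s: "s 0 = 0" "s n = 1"
    "\<And>i. i < n \<Longrightarrow> s i < s (Suc i)" "\<And>i. i < n \<Longrightarrow> C1_curve_on A \<gamma> (s i) (s (Suc i))"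
    using \<gamma>(1) unfolding piecewise_C1_path_def by blast
  have "k * tnorm g x v \<le> k * curve_length A g \<gamma> + \<delta>" if \<delta>: "\<delta> > 0" for \<delta>
  proof -
    have "0 \<le> s i \<and> (\<exists>I. ((\<lambda>t. tnorm g (\<gamma> t) (velocity A \<gamma> t)) has_integral I) {0..s i} \<and>
       arcosh_reg \<delta> (cdist x (\<gamma> (s i))) - arcosh_reg \<delta> (cdist x (\<gamma> 0)) \<le> k * I)" if "i \<le> n" for i
      using that
    proof (induction i)
      case 0
      then show ?case using s(1) by (auto intro!: exI[of _ 0])
    next
      case (Suc i)
      then obtain I where I: "0 \<le> s i" "((\<lambda>t. tnorm g (\<gamma> t) (velocity A \<gamma> t)) has_integral I) {0..s i}"
        "arcosh_reg \<delta> (cdist x (\<gamma> (s i))) - arcosh_reg \<delta> (cdist x (\<gamma> 0)) \<le> k * I" by auto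
      obtain J where J: "((\<lambda>t. tnorm g (\<gamma> t) (velocity A \<gamma> t)) has_integral J) {s i..s (Suc i)}"
        "arcosh_reg \<delta> (cdist x (\<gamma> (s (Suc i)))) - arcosh_reg \<delta> (cdist x (\<gamma> (s i))) \<le> k * J"
        using C1_piece_bound[OF s(3)[of i] s(4)[of i] \<delta>, of x] Suc.prems by auto
      have si: "s i < s (Suc i)" using s(3) Suc.prems by simp
      have "((\<lambda>t. tnorm g (\<gamma> t) (velocity A \<gamma> t)) has_integral I + J) {0..s (Suc i)}"
        by (rule has_integral_combine[OF I(1) _ I(2) J(1)]) (use si in simp)
      then show ?case using I J si by (intro conjI exI[of _ "I + J"]) (auto simp: algebra_simps)
    qed
    from this[of n] obtain I where I: "((\<lambda>t. tnorm g (\<gamma> t) (velocity A \<gamma> t)) has_integral I) {0..1}"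
      "arcosh_reg \<delta> (cdist x (\<gamma> 1)) - arcosh_reg \<delta> (cdist x (\<gamma> 0)) \<le> k * I"
      using s(2) by auto
    have "curve_length A g \<gamma> = I" unfolding curve_length_def by (rule integral_unique[OF I(1)])
    moreover have "cdist x (\<gamma> 0) = 1" "cdist x (\<gamma> 1) = cosh (k * tnorm g x v)"
      using \<gamma>(2) y cdist_Exp by (simp_all add: pathstart_def pathfinish_def)
    ultimately show ?thesis
      using I(2) arcosh_reg_bounds(1)[OF \<delta>] arcosh_reg_bounds(2)[OF \<delta>, of "k * tnorm g x v"] k_pos tnorm_nonneg[of x v] by simp
  qed
  then have "k * tnorm g x v \<le> k * curve_length A g \<gamma>" by (rule field_le_epsilon)
  then show ?thesis using k_pos by simp
qed

lemma geodesic_C1: "is_geodesic A g \<gamma> \<Longrightarrow> C1_curve_on A \<gamma> 0 1"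
proof -
  assume \<gamma>: "is_geodesic A g \<gamma>"
  have cont: "continuous_on UNIV \<gamma>" using \<gamma> by (simp add: is_geodesic_def)
  show ?thesis unfolding C1_curve_on_def
  proof (intro conjI ballI impI continuous_on_subset[OF cont])
    fix c t assume c: "c \<in> A" and t: "t \<in> {0..1::real}" "\<gamma> t \<in> cdom c"
    let ?y = "\<lambda>s. vector_derivative (coord c \<circ> \<gamma>) (at s)"
    note D = geodesic_chart_derivatives[OF \<gamma> c]
    show "(coord c \<circ> \<gamma>) differentiable (at t within {0..1})"
      using D(1)[OF t(2)] differentiableI_vector differentiable_at_withinI by blast
    have eq: "?y s = vector_derivative (coord c \<circ> \<gamma>) (at s within {0..1})" if "s \<in> {0..1}" "\<gamma> s \<in> cdom c" for s
      using vector_derivative_at_within_ivl[OF D(1)[OF that(2)], of 0 1] that(1) by simp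
    have "continuous (at t within {0..1}) ?y"
      using has_vector_derivative_continuous[OF D(2)[OF t(2)]] continuous_at_imp_continuous_at_within by blast
    moreover have "eventually (\<lambda>s. ?y s = vector_derivative (coord c \<circ> \<gamma>) (at s within {0..1})) (at t within {0..1})"
      using eventually_in_chart[of c \<gamma> t "{0..1}", OF c t(2) continuous_at_imp_continuous_at_within[OF geodesic_isCont[OF \<gamma>]]]
      unfolding eventually_at_filter by eventually_elim (use eq in auto)
    ultimately show "continuous (at t within {0..1}) (\<lambda>s. vector_derivative (coord c \<circ> \<gamma>) (at s within {0..1}))"
      unfolding continuous_within eq[OF t, symmetric] by (rule Lim_transform_eventually)
  qed auto
qed

lemma geodesic_length: "curve_length A g (geo x v) = tnorm g x v"
proof -
  have "tnorm g (geo x v t) (velocity A (geo x v) t) = tnorm g x v" for t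
    using geodesic_speed_constant[OF geo(1), of x v t] by (simp add: tnorm_def geo)
  then show ?thesis by (simp add: curve_length_def)
qed

text \<open>The lower bound holds for every competing curve and the geodesic attains it, so the
  infimum is a minimum.\<close>

theorem riem_dist_Exp: "riem_dist A g x (Exp x v) = tnorm g x v"
  unfolding riem_dist_def
proof (rule cInf_eq_minimum)
  have "piecewise_C1_path A (geo x v)"
    unfolding piecewise_C1_path_def
    by (intro exI[of _ 1] exI[of _ real]) (simp add: geodesic_C1[OF geo(1)])
  then show "tnorm g x v \<in> {curve_length A g \<gamma> |\<gamma>. piecewise_C1_path A \<gamma> \<and> pathstart \<gamma> = x \<and> pathfinish \<gamma> = Exp x v}"
    using geodesic_length[of x v] by (auto simp: pathstart_def pathfinish_def geo Exp_geo intro!: exI[of _ "geo x v"])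
qed (use curve_length_lower_bound in blast)

lemma cosh_riem_dist: "cosh (k * riem_dist A g x y) = cdist x y" and riem_dist_nonneg: "riem_dist A g x y \<ge> 0"
proof -
  obtain v where v: "y = Exp x v" using Exp_unshadow_shadow by metis
  show "cosh (k * riem_dist A g x y) = cdist x y" "riem_dist A g x y \<ge> 0"
    unfolding v riem_dist_Exp cdist_Exp using tnorm_nonneg by auto
qed

lemma riem_dist_arcosh: "riem_dist A g x y = arcosh (cdist x y) / k"
  using cosh_riem_dist[of x y] riem_dist_nonneg[of x y] k_pos arcosh_cosh_real[of "k * riem_dist A g x y"] by (simp add: field_simps)

lemma riem_dist_sym: "riem_dist A g x y = riem_dist A g y x"
  by (simp add: riem_dist_arcosh cdist_sym)

section \<open>Busemann functions and the infimum\<close>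

lemma busemann_Exp:
  assumes "u \<noteq> 0"
  shows "busemann A g p u (Exp p v) =
    ln (cosh (k * tnorm g p v) - k * shc (k * tnorm g p v) * g p v u / tnorm g p u) / k"
proof -
  define e where "e = u /\<^sub>R tnorm g p u"
  have u: "tnorm g p u > 0" using assms tnorm_nonneg[of p u] tnorm_eq_0[of p u] by (simp add: less_le)
  have e: "tnorm g p e = 1" using u by (simp add: e_def tnorm_scaleR)
  define \<alpha> where "\<alpha> = cosh (k * tnorm g p v)"
  define \<beta> where "\<beta> = k * shc (k * tnorm g p v) * g p v e"
  \<comment> \<open>Cauchy-Schwarz with the unit vector \<open>e\<close> bounds
    \<open>\<beta>\<close> by \<open>sinh (k * tnorm g p v)\<close>, which is less than the
    hyperbolic cosine.\<close>
  have "\<bar>\<beta>\<bar> < \<alpha>"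
  proof -
    have pos: "k * shc (k * tnorm g p v) \<ge> 0" using k_pos tnorm_nonneg[of p v] by (simp add: shc_def)
    have "\<bar>\<beta>\<bar> = k * shc (k * tnorm g p v) * \<bar>g p v e\<bar>" unfolding \<beta>_def abs_mult[of _ "g p v e"] using pos by simp
    also have "\<dots> \<le> k * shc (k * tnorm g p v) * tnorm g p v"
      using g_Cauchy_Schwarz[of p v e] e pos by (intro mult_left_mono) auto
    also have "\<dots> = sinh (k * tnorm g p v)" using k_pos by (simp add: shc_def)
    also have "\<dots> < \<alpha>" unfolding \<alpha>_def by (rule sinh_less_cosh_real)
    finally show ?thesis .
  qed
  then have "((\<lambda>t. arcosh (\<alpha> * cosh t - \<beta> * sinh t) - t) \<longlongrightarrow> ln (\<alpha> - \<beta>)) at_top"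
    by (rule arcosh_ray_limit)
  moreover have "filterlim (\<lambda>t. k * t) at_top at_top"
    using filterlim_tendsto_pos_mult_at_top[OF tendsto_const k_pos filterlim_ident] by simp
  ultimately have "((\<lambda>t. arcosh (\<alpha> * cosh (k * t) - \<beta> * sinh (k * t)) - k * t) \<longlongrightarrow> ln (\<alpha> - \<beta>)) at_top"
    by (rule filterlim_compose)
  then have "((\<lambda>t. (arcosh (\<alpha> * cosh (k * t) - \<beta> * sinh (k * t)) - k * t) / k) \<longlongrightarrow> ln (\<alpha> - \<beta>) / k) at_top"
    by (rule tendsto_divide[OF _ tendsto_const]) (use k_pos in simp)
  moreover have "eventually (\<lambda>t. (arcosh (\<alpha> * cosh (k * t) - \<beta> * sinh (k * t)) - k * t) / k =
      riem_dist A g (Exp p v) (Exp p (t *\<^sub>R e)) - t) at_top"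
    using eventually_gt_at_top[of 0]
  proof eventually_elim
    case (elim t)
    have "k\<^sup>2 * shc (k * tnorm g p v) * shc (k * t) * (t * g p v e) = \<beta> * (k * t * shc (k * t))"
      by (simp add: \<beta>_def power2_eq_square mult_ac)
    also have "k * t * shc (k * t) = sinh (k * t)" by (simp add: shc_def)
    finally have "cdist (Exp p v) (Exp p (t *\<^sub>R e)) = \<alpha> * cosh (k * t) - \<beta> * sinh (k * t)"
      unfolding hyperbolic_law_of_cosines using elim
      by (simp add: tnorm_scaleR e bilinear_rmul[OF g_bilinear] \<alpha>_def)
    then show ?case unfolding riem_dist_arcosh using k_pos by (simp add: diff_divide_distrib)
  qed
  ultimately have "((\<lambda>t. riem_dist A g (Exp p v) (Exp p (t *\<^sub>R e)) - t) \<longlongrightarrow> ln (\<alpha> - \<beta>) / k) at_top"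
    by (rule Lim_transform_eventually)
  then have "busemann A g p u (Exp p v) = ln (\<alpha> - \<beta>) / k"
    unfolding busemann_def e_def by (intro tendsto_Lim) auto
  then show ?thesis by (simp add: \<alpha>_def \<beta>_def e_def bilinear_rmul[OF g_bilinear] field_simps)
qed

text \<open>Division by zero gives 0 when a vector vanishes. In the coupling formula this value is
  harmless: it is multiplied by \<open>sinh 0\<close> or by a length 0.\<close>

definition cosine :: "'m \<Rightarrow> 'e \<Rightarrow> 'e \<Rightarrow> real" where
  "cosine p u v = g p u v / (tnorm g p u * tnorm g p v)"

lemma cosine_le: "\<bar>cosine p u v\<bar> \<le> 1"
  using g_Cauchy_Schwarz[of p u v] tnorm_nonneg[of p u] tnorm_nonneg[of p v]
  by (cases "tnorm g p u * tnorm g p v = 0") (auto simp: cosine_def divide_le_eq_1 abs_mult)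

lemma busemann_coupling_Exp:
  "busemann_coupling A g p (Exp p \<zeta>) (Exp p \<eta>) =
    tnorm g p \<zeta> * ln (cosh (k * tnorm g p \<eta>) + cosine p \<eta> \<zeta> * sinh (k * tnorm g p \<eta>)) / k"
proof (cases "\<zeta> = 0")
  case False
  have ne: "Exp p \<zeta> \<noteq> p" using False Exp_bij[of p] Exp_0[of p] by (metis bij_def injD)
  have z: "tnorm g p \<zeta> \<noteq> 0" using False tnorm_eq_0 by blast
  have "tnorm g p (- \<zeta>) = tnorm g p \<zeta>" using tnorm_scaleR[of p "-1" \<zeta>] by simp
  moreover have "k * shc (k * tnorm g p \<eta>) * g p \<eta> (- \<zeta>) / tnorm g p \<zeta> = - (cosine p \<eta> \<zeta> * sinh (k * tnorm g p \<eta>))"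
  proof (cases "\<eta> = 0")
    case True
    then show ?thesis by (simp add: cosine_def bilinear_lzero[OF g_bilinear])
  next
    case False
    then have "tnorm g p \<eta> \<noteq> 0" using tnorm_eq_0 by blast
    then show ?thesis using z k_pos by (simp add: cosine_def shc_def bilinear_rneg[OF g_bilinear] field_simps)
  qed
  ultimately show ?thesis
    using ne False busemann_Exp[of "- \<zeta>" p \<eta>] Exp_bij[of p]
    by (simp add: busemann_coupling_def riem_dist_Exp bij_is_inj)
qed (simp add: busemann_coupling_def tnorm_def bilinear_lzero[OF g_bilinear])

text \<open>Lengths scaled by \<open>k\<close> and a total factor \<open>k\<^sup>2\<close> reduce
  the problem to curvature -1, and the symmetry of \<open>cosine\<close> gives both terms the same
  angle, the shape of \<open>weighted_log_cosh_ge\<close>.\<close>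

lemma nonlinearity_term:
  "busemann_coupling A g p (Exp p \<eta>) (Exp p \<zeta>) - busemann_coupling A g p (Exp p \<zeta>) (Exp p \<eta>) =
    ((k * tnorm g p \<eta>) * ln (cosh (k * tnorm g p \<zeta>) + cosine p \<eta> \<zeta> * sinh (k * tnorm g p \<zeta>)) -
     (k * tnorm g p \<zeta>) * ln (cosh (k * tnorm g p \<eta>) + cosine p \<eta> \<zeta> * sinh (k * tnorm g p \<eta>))) / k\<^sup>2"
proof -
  have "cosine p \<zeta> \<eta> = cosine p \<eta> \<zeta>" by (simp add: cosine_def g_sym[of p \<zeta> \<eta>] mult.commute)
  then show ?thesis using k_pos by (simp add: busemann_coupling_Exp power2_eq_square field_simps)
qed

text \<open>Dimension at least 2 provides a vector off the line of \<open>\<eta>\<close>;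
  Gram-Schmidt turns it into a unit vector \<open>f\<close> orthogonal to \<open>e\<close>, and
  \<open>\<zeta>\<close> is taken at the required angle in the plane of \<open>e\<close> and
  \<open>f\<close>.\<close>

lemma exists_vector_with_cosine:
  assumes "DIM('e) \<ge> 2" "\<eta> \<noteq> 0" "\<bar>a\<bar> \<le> 1" "r > 0"
  obtains \<zeta> where "tnorm g p \<zeta> = r" "cosine p \<eta> \<zeta> = a"
proof -
  have "span {\<eta>} \<noteq> (UNIV :: 'e set)"
  proof
    assume "span {\<eta>} = (UNIV :: 'e set)"
    then have "dim (UNIV :: 'e set) = dim {\<eta>}" by (metis dim_span)
    also have "\<dots> \<le> card {\<eta>}" by (rule dim_le_card') simp
    finally show False using assms(1) by simp
  qed
  then obtain w where w: "w \<notin> span {\<eta>}" by blast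
  define e where "e = \<eta> /\<^sub>R tnorm g p \<eta>"
  have h: "tnorm g p \<eta> > 0" using assms(2) tnorm_nonneg[of p \<eta>] tnorm_eq_0[of p \<eta>] by (simp add: less_le)
  have "tnorm g p e = 1" using h by (simp add: e_def tnorm_scaleR)
  then have ee: "g p e e = 1" using tnorm_square[of p e] by simp
  define d where "d = w - g p e w *\<^sub>R e"
  have "d \<noteq> 0"
  proof
    assume "d = 0"
    then have "w = (g p e w / tnorm g p \<eta>) *\<^sub>R \<eta>" by (simp add: d_def e_def divide_inverse)
    then show False using w span_mul[OF span_base[of \<eta> "{\<eta>}"]] by (metis singletonI)
  qed
  then have d: "tnorm g p d > 0" using tnorm_nonneg[of p d] tnorm_eq_0[of p d] by (simp add: less_le)
  define f where "f = d /\<^sub>R tnorm g p d"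
  have "tnorm g p f = 1" using d by (simp add: f_def tnorm_scaleR)
  then have ff: "g p f f = 1" using tnorm_square[of p f] by simp
  have ef: "g p e f = 0"
    by (simp add: f_def d_def bilinear_rmul[OF g_bilinear] bilinear_rsub[OF g_bilinear] ee)
  define \<zeta> where "\<zeta> = r *\<^sub>R (a *\<^sub>R e + sqrt (1 - a\<^sup>2) *\<^sub>R f)"
  have a1: "1 - a\<^sup>2 \<ge> 0" using assms(3) by (simp add: abs_square_le_1)
  have "g p (a *\<^sub>R e + sqrt (1 - a\<^sup>2) *\<^sub>R f) (a *\<^sub>R e + sqrt (1 - a\<^sup>2) *\<^sub>R f) = 1"
    using a1 ef g_sym[of p f e]
    by (simp add: bilinear_radd[OF g_bilinear] bilinear_ladd[OF g_bilinear] bilinear_rmul[OF g_bilinear]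
        bilinear_lmul[OF g_bilinear] ee ff power2_eq_square)
  then have n: "tnorm g p \<zeta> = r" using assms(4) by (simp add: \<zeta>_def tnorm_scaleR) (simp add: tnorm_def)
  have "\<eta> = tnorm g p \<eta> *\<^sub>R e" using h by (simp add: e_def)
  then have "g p \<eta> \<zeta> = tnorm g p \<eta> * g p e \<zeta>"
    using bilinear_lmul[OF g_bilinear, of p "tnorm g p \<eta>" e \<zeta>] by simp
  also have "g p e \<zeta> = r * a"
    by (simp add: \<zeta>_def bilinear_rmul[OF g_bilinear] bilinear_radd[OF g_bilinear] ee ef)
  finally have "cosine p \<eta> \<zeta> = a" using h assms(4) by (simp add: cosine_def n)
  then show ?thesis using that n by blast
qed

theorem nonlinearity_eq:
  assumes "DIM('e) \<ge> 2"
  shows "nonlinearity A g p y = ereal (- (riem_dist A g y p / k) * ln (cosh (k * riem_dist A g y p / 2)))"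
proof -
  obtain \<eta> where \<eta>: "y = Exp p \<eta>" using Exp_unshadow_shadow by metis
  define \<rho> where "\<rho> = k * tnorm g p \<eta>"
  have \<rho>0: "\<rho> \<ge> 0" using k_pos tnorm_nonneg by (simp add: \<rho>_def)
  have dist: "riem_dist A g y p = \<rho> / k"
    using riem_dist_sym[of y p] riem_dist_Exp[of p \<eta>] k_pos by (simp add: \<eta> \<rho>_def)
  define m where "m = - \<rho> * ln (cosh (\<rho> / 2)) / k\<^sup>2"
  define T where "T z = busemann_coupling A g p y z - busemann_coupling A g p z y" for z
  have T: "T (Exp p \<zeta>) = (\<rho> * ln (cosh (k * tnorm g p \<zeta>) + cosine p \<eta> \<zeta> * sinh (k * tnorm g p \<zeta>)) -
     (k * tnorm g p \<zeta>) * ln (cosh \<rho> + cosine p \<eta> \<zeta> * sinh \<rho>)) / k\<^sup>2" for \<zeta>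
    unfolding T_def \<eta> \<rho>_def by (rule nonlinearity_term)
  have lower: "m \<le> T z" for z
  proof -
    obtain \<zeta> where z: "z = Exp p \<zeta>" using Exp_unshadow_shadow by metis
    show ?thesis unfolding z T m_def
      using weighted_log_cosh_ge[OF cosine_le[of p \<eta> \<zeta>], of "k * tnorm g p \<zeta>" \<rho>] \<rho>0 k_pos tnorm_nonneg
      by (intro divide_right_mono) auto
  qed
  have "\<exists>z. T z = m"
  proof (cases "\<eta> = 0")
    \<comment> \<open>Here \<open>y = p\<close>; the claimed value is 0 and \<open>z = p\<close>
      attains it.\<close>
    case True
    then have "\<rho> = 0" by (simp add: \<rho>_def tnorm_def bilinear_lzero[OF g_bilinear])
    then show ?thesis using T[of 0] by (intro exI[of _ "Exp p 0"]) (simp add: m_def tnorm_def bilinear_lzero[OF g_bilinear])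
  next
    case False
    then have h: "tnorm g p \<eta> > 0" using tnorm_nonneg[of p \<eta>] tnorm_eq_0[of p \<eta>] by (simp add: less_le)
    \<comment> \<open>The equality case from \<open>weighted_log_cosh_eq\<close>: half the length of
      \<open>\<eta>\<close>, at the angle for which \<open>y\<close> is on the horosphere through
      \<open>p\<close>.\<close>
    have "\<bar>- tanh (\<rho> / 2)\<bar> \<le> 1"
      using tanh_real_bounds[of "\<rho> / 2"] by (auto simp: abs_le_iff)
    from exists_vector_with_cosine[OF assms False this, of "tnorm g p \<eta> / 2" p] h
    obtain \<zeta> where \<zeta>: "tnorm g p \<zeta> = tnorm g p \<eta> / 2" "cosine p \<eta> \<zeta> = - tanh (\<rho> / 2)" by auto
    have half: "k * tnorm g p \<zeta> = \<rho> / 2" by (simp add: \<zeta> \<rho>_def)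
    have "T (Exp p \<zeta>) = m" unfolding T \<zeta>(2) half weighted_log_cosh_eq m_def ..
    then show ?thesis by blast
  qed
  then obtain z where "T z = m" by blast
  then have "(INF z. ereal (T z)) = ereal m"
    using lower by (intro antisym INF_greatest) (auto intro: INF_lower2[of z])
  moreover have "m = - (\<rho> / k / k) * ln (cosh (k * (\<rho> / k) / 2))"
    using k_pos by (simp add: m_def power2_eq_square)
  ultimately show ?thesis unfolding nonlinearity_def T_def dist by simp
qed

end

theorem proposition22:
  fixes A :: "('m::{t2_space, second_countable_topology}, 'e::euclidean_space) chart set"
    and g :: "'m \<Rightarrow> 'e \<Rightarrow> 'e \<Rightarrow> real"
    and p y :: 'm and k \<rho> :: real
  assumes "hadamard_manifold A g"
    and "DIM('e) \<ge> 2"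
    and "k > 0"
    and "constant_curvature A g (- (k\<^sup>2))"
    and "\<rho> = riem_dist A g y p"
  shows "nonlinearity A g p y = ereal (- (\<rho> / k) * ln (cosh (k * \<rho> / 2))) \<and>
    (\<rho> > 0 \<longrightarrow> nonlinearity A g p y = ereal (- (\<rho>\<^sup>2 / 2) * phi (k * \<rho> / 2))) \<and>
    (\<rho> = 1 \<longrightarrow> nonlinearity A g p y = ereal (- (1 / k) * ln (cosh (k / 2))))"
proof -
  interpret hyperbolic_space A g k
    using assms(1,3,4) unfolding hadamard_manifold_def by unfold_locales auto
  have N: "nonlinearity A g p y = ereal (- (\<rho> / k) * ln (cosh (k * \<rho> / 2)))"
    using nonlinearity_eq[OF assms(2)] assms(5) by simp
  moreover have "- (\<rho> / k) * ln (cosh (k * \<rho> / 2)) = - (\<rho>\<^sup>2 / 2) * phi (k * \<rho> / 2)" if "\<rho> > 0"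
    using that assms(3) by (simp add: phi_def power2_eq_square)
  ultimately show ?thesis by auto
qed

end
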